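(* For $\kappa>0$ let $\mathsf U^\kappa=(w^\kappa,u_0^\kappa,u_1^\kappa)\in\mathcal W\times\mathcal H\times\mathcal H^\perp$, $u^\kappa=u_0^\kappa+u_1^\kappa$, be the (unique) solution of the stationarity problem. As $\kappa\to0$ it admits the expansion $$\mathsf U^\kappa=\mathsf U^{(0)}+O(\kappa)$$ in the norm $\|\cdot\|_{\mathbb U}$, where the components $(w^{(0)},u_0^{(0)},u_1^{(0)})\in\mathcal W\times\mathcal H\times\mathcal H^\perp$ of $\mathsf U^{(0)}$ solve the well-posed problems $$Aw^{(0)}+Bu_1^{(0)}=\mathbf f\ \text{ in }\mathcal W',\qquad B^tw^{(0)}=0\ \text{ in }(\mathcal H^\perp)',$$ $$D_{00}u_0^{(0)}=\mathbf d_0-D_{10}u_1^{(0)}\ \text{ in }\mathcal H'.$$ Moreover, $w^{(0)}=0$ if $\mathcal K=\{0\}$.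
   Context: Setting. $\Omega\subset\mathbb R^s$ ($1\le s\le 3$) is a bounded connected domain with boundary $\Gamma$ regular enough (e.g. Lipschitz) for the usual trace, Korn and compact embedding results in $H^1$. $\Gamma_D,\Gamma_N\subseteq\Gamma$ satisfy $\Gamma_D\cap\Gamma_N=\emptyset$ and $\Gamma_c:=\Gamma\setminus(\Gamma_N\cup\Gamma_D)$ may be nonempty. $\rho\in L^\infty(\Omega)$ is bounded below by a positive constant; $\omega>0$ is fixed. $\mathcal C\in L^\infty(\Omega;\mathbb Q)$ is an elasticity tensor field, where $\mathbb Q$ is the space of fourth-order tensors with $C_{ijkl}=C_{klij}=C_{jikl}$, uniformly elliptic: $\varepsilon:\mathcal C(x):\varepsilon\ge c_0\,\varepsilon:\varepsilon$ for all symmetric $\varepsilon$, $c_0>0$. Spaces (real): $\mathcal V=H^1(\Omega;\mathbb R^s)$, $\mathcal U=\{v\in\mathcal V: v=0\text{ on }\Gamma_D\}$, $\mathcal W=\{v\in\mathcal V: v=0\text{ on }\Gamma_D\cup\Gamma_c\}\subseteq\mathcal U$. $(\cdot,\cdot)$ is the $L^2(\Omega)$ scalar product, $\varepsilon[v]=\frac12(\nabla v+\nabla v^T)$. Forms: $\mathcal A(v,\tilde v)=(\varepsilon[v],\mathcal C:\varepsilon[\tilde v])$; $\mathcal B(v,\tilde v)=\mathcal A(v,\tilde v)-\omega^2(\rho v,\tilde v)$; $\mathcal D:\mathcal U\times\mathcal U\to\mathbb R$ is a symmetric positive (semidefinite) continuous bilinear form. Inner product and norm on $\mathcal U,\mathcal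 W$: $(v,\tilde v)_\omega=\mathcal A(v,\tilde v)+\omega^2(\rho v,\tilde v)$, $\|v\|_\omega^2=(v,v)_\omega$. $\mathbb U=\mathcal W\times\mathcal U=\mathcal W\times\mathcal H\times\mathcal H^\perp$ with $\|(w,u)\|_{\mathbb U}^2=\|w\|_\omega^2+\|u\|_\omega^2$. Operators: $A:\mathcal W\to\mathcal W'$ and $B:\mathcal U\to\mathcal W'$ are associated with $\mathcal A$, $\mathcal B$ ($\langle Bu,\tilde w\rangle=\mathcal B(u,\tilde w)$), $B^t:\mathcal W\to\mathcal U'$ is the transpose; $\mathcal H=N(B)\subset\mathcal U$, $\mathcal K=N(B^t)\subset\mathcal W$; $\mathcal H^\perp$ is the orthogonal complement for $(\cdot,\cdot)_\omega$. Every $u\in\mathcal U$ is split as $u=u_0+u_1$, $u_0\in\mathcal H$, $u_1\in\mathcal H^\perp$, and $\mathbf d\in\mathcal U'$ into its restrictions $\mathbf d_0\in\mathcal H'$, $\mathbf d_1\in(\mathcal H^\perp)'$. $D_{00}:\mathcal H\to\mathcal H'$ and $D_{10}:\mathcal H^\perp\to\mathcal H'$ are defined by $\langle D_{00}u_0,\tilde u_0\rangle=\mathcal D(u_0,\tilde u_0)$, $\langle D_{10}u_1,\tilde u_0\rangle=\mathcal D(u_1,\tilde u_0)$ for $\tilde u_0\in\mathcal H$. Standing assumptions: $\mathcal D$ is coercive on $\mathcal H\times\mathcal H$ ($\mathcal D(v,v)\ge\delta\|v\|_\omega^2$ for $v\in\mathcal H$, $\delta>0$); $|\Gamma_D\cup\Gamma_c|>0$,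 so $\mathcal A$ is coercive on $\mathcal W\times\mathcal W$. Stationarity problem, with given $\mathbf f\in\mathcal W'$ and $\mathbf d\in\mathcal U'$ independent of $\kappa$ ($\langle\mathbf d,\tilde u\rangle=\mathcal D(u^{\rm m},\tilde u)$ for measured data $u^{\rm m}$): find $(w,u)\in\mathcal W\times\mathcal U$ with $\mathcal A(w,\tilde w)+\mathcal B(u,\tilde w)=\langle\mathbf f,\tilde w\rangle$ for all $\tilde w\in\mathcal W$ and $\mathcal B(\tilde u,w)-\kappa\mathcal D(u,\tilde u)=-\kappa\langle\mathbf d,\tilde u\rangle$ for all $\tilde u\in\mathcal U$. *)

theory Defs
  imports "HOL-Analysis.Analysis" "HOL-Library.Landau_Symbols"
begin

text \<open>
  Points and vector fields live in \<open>real ^ 'n\<close>, so the space dimension is \<open>CARD('n)\<close>.  Elements of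
  Lebesgue and Sobolev spaces are represented by functions on the whole space of which only the
  values on the domain matter; two of them denote the same element iff they agree almost
  everywhere on the domain.
\<close>

type_synonym 'n vfield = "real ^ 'n \<Rightarrow> real ^ 'n"
type_synonym 'n mfield = "real ^ 'n \<Rightarrow> real ^ 'n ^ 'n"
type_synonym 'n tensor4 = "real ^ 'n ^ 'n ^ 'n ^ 'n"

section \<open>Lebesgue spaces and smooth functions\<close>

definition L2 :: "'a measure \<Rightarrow> ('a \<Rightarrow> 'b::euclidean_space) set" where
  "L2 M = {f. f \<in> borel_measurable M \<and> integrable M (\<lambda>x. (norm (f x))\<^sup>2)}"

definition L2_inner :: "'a measure \<Rightarrow> ('a \<Rightarrow> 'b::euclidean_space) \<Rightarrow> ('a \<Rightarrow> 'b) \<Rightarrow> real" where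
  "L2_inner M f g = (\<integral>x. f x \<bullet> g x \<partial>M)"

definition L2_norm :: "'a measure \<Rightarrow> ('a \<Rightarrow> 'b::euclidean_space) \<Rightarrow> real" where
  "L2_norm M f = sqrt (L2_inner M f f)"

definition Linfty :: "'a measure \<Rightarrow> ('a \<Rightarrow> 'b::euclidean_space) set" where
  "Linfty M = {f. f \<in> borel_measurable M \<and> (\<exists>K. AE x in M. norm (f x) \<le> K)}"

definition ae_eq :: "(real ^ 'n::finite) set \<Rightarrow> 'n vfield \<Rightarrow> 'n vfield \<Rightarrow> bool" where
  "ae_eq \<Omega> u v \<longleftrightarrow> (AE x in lebesgue_on \<Omega>. u x = v x)"

fun k_times_diff :: "nat \<Rightarrow> ('a::euclidean_space \<Rightarrow> 'b::real_normed_vector) \<Rightarrow> bool" where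
  "k_times_diff 0 f \<longleftrightarrow> continuous_on UNIV f"
| "k_times_diff (Suc k) f \<longleftrightarrow>
     f differentiable_on UNIV \<and>
     (\<forall>b\<in>Basis. k_times_diff k (\<lambda>x. frechet_derivative f (at x) b))"

definition smooth :: "('a::euclidean_space \<Rightarrow> 'b::real_normed_vector) \<Rightarrow> bool" where
  "smooth f \<longleftrightarrow> (\<forall>k. k_times_diff k f)"

definition test_functions :: "(real ^ 'n::finite) set \<Rightarrow> (real ^ 'n \<Rightarrow> real) set" where
  "test_functions \<Omega> =
     {\<phi>. smooth \<phi> \<and> compact (closure {x. \<phi> x \<noteq> 0}) \<and> closure {x. \<phi> x \<noteq> 0} \<subseteq> \<Omega>}"

section \<open>The Sobolev space of vector fields\<close>

text \<open>The entry \<open>G x $ i $ j\<close> is the weak partial derivative of the component \<open>i\<close> in direction \<open>j\<close>.\<close>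

definition is_weak_grad :: "(real ^ 'n::finite) set \<Rightarrow> 'n vfield \<Rightarrow> 'n mfield \<Rightarrow> bool" where
  "is_weak_grad \<Omega> v G \<longleftrightarrow>
     (\<forall>\<phi>\<in>test_functions \<Omega>. \<forall>i j.
        (\<integral>x. v x $ i * frechet_derivative \<phi> (at x) (axis j 1) \<partial>lebesgue_on \<Omega>)
        = - (\<integral>x. G x $ i $ j * \<phi> x \<partial>lebesgue_on \<Omega>))"

definition H1 :: "(real ^ 'n::finite) set \<Rightarrow> 'n vfield set" where
  "H1 \<Omega> = {v \<in> L2 (lebesgue_on \<Omega>). \<exists>G \<in> L2 (lebesgue_on \<Omega>). is_weak_grad \<Omega> v G}"

definition weak_grad :: "(real ^ 'n::finite) set \<Rightarrow> 'n vfield \<Rightarrow> 'n mfield" where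
  "weak_grad \<Omega> v = (SOME G. G \<in> L2 (lebesgue_on \<Omega>) \<and> is_weak_grad \<Omega> v G)"

definition H1_norm :: "(real ^ 'n::finite) set \<Rightarrow> 'n vfield \<Rightarrow> real" where
  "H1_norm \<Omega> v =
     sqrt ((L2_norm (lebesgue_on \<Omega>) v)\<^sup>2 + (L2_norm (lebesgue_on \<Omega>) (weak_grad \<Omega> v))\<^sup>2)"

definition strain :: "(real ^ 'n::finite) set \<Rightarrow> 'n vfield \<Rightarrow> 'n mfield" where
  "strain \<Omega> v x = (1 / 2) *\<^sub>R (weak_grad \<Omega> v x + transpose (weak_grad \<Omega> v x))"

section \<open>Surface measure and traces\<close>

text \<open>
  The \<open>d\<close>-dimensional Hausdorff outer measure, normalised to agree with the usual surface measure
  (for \<open>d = 0\<close>: counting measure).  Covering sets are required to be bounded because \<open>diameter\<close>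
  is unspecified on unbounded sets; the empty set is singled out because of \<open>0 ^ 0 = 1\<close>.
\<close>

definition hausdorff_content :: "nat \<Rightarrow> 'a::euclidean_space set \<Rightarrow> ennreal" where
  "hausdorff_content d C =
     (if C = {} then 0 else ennreal (unit_ball_vol (real d) * (diameter C / 2) ^ d))"

definition hausdorff_outer :: "nat \<Rightarrow> 'a::euclidean_space set \<Rightarrow> ennreal" where
  "hausdorff_outer d A =
     (SUP \<delta>\<in>{0<..}. INF C \<in> {C :: nat \<Rightarrow> 'a set. A \<subseteq> (\<Union>i. C i) \<and>
                                 (\<forall>i. bounded (C i) \<and> diameter (C i) \<le> \<delta>)}.
        (\<Sum>i. hausdorff_content d (C i)))"

text \<open>A metric outer measure, hence countably additive on the Borel sets.\<close>

definition hausdorff_measure :: "nat \<Rightarrow> 'a::euclidean_space measure" where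
  "hausdorff_measure d = measure_of UNIV (sets borel) (hausdorff_outer d)"

definition surface_measure :: "(real ^ 'n::finite) set \<Rightarrow> (real ^ 'n) measure" where
  "surface_measure \<Omega> = restrict_space (hausdorff_measure (CARD('n) - 1)) (frontier \<Omega>)"

text \<open>
  The trace operator is the continuous extension of the restriction of smooth functions to the
  boundary, given here by its graph.
\<close>

definition has_trace :: "(real ^ 'n::finite) set \<Rightarrow> 'n vfield \<Rightarrow> 'n vfield \<Rightarrow> bool" where
  "has_trace \<Omega> v g \<longleftrightarrow>
     v \<in> H1 \<Omega> \<and> g \<in> L2 (surface_measure \<Omega>) \<and>
     (\<exists>\<phi> :: nat \<Rightarrow> 'n vfield. (\<forall>k. smooth (\<phi> k)) \<and>
        (\<lambda>k. H1_norm \<Omega> (\<lambda>x. \<phi> k x - v x)) \<longlonglongrightarrow> 0 \<and>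
        (\<lambda>k. \<integral>\<^sup>+x. ennreal ((norm (\<phi> k x - g x))\<^sup>2) \<partial>surface_measure \<Omega>) \<longlonglongrightarrow> 0)"

definition vanishes_on :: "(real ^ 'n::finite) set \<Rightarrow> (real ^ 'n) set \<Rightarrow> 'n vfield \<Rightarrow> bool" where
  "vanishes_on \<Omega> S v \<longleftrightarrow>
     (\<exists>g. has_trace \<Omega> v g \<and> (AE x in surface_measure \<Omega>. x \<in> S \<longrightarrow> g x = 0))"

definition H1_zero :: "(real ^ 'n::finite) set \<Rightarrow> (real ^ 'n) set \<Rightarrow> 'n vfield set" where
  "H1_zero \<Omega> S = {v \<in> H1 \<Omega>. vanishes_on \<Omega> S v}"

section \<open>Regularity of the domain\<close>

text \<open>
  ``Boundary regular enough'' means that the usual theorems on the Sobolev space hold (all of them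
  do on bounded connected Lipschitz domains).  The trace theorem is stated as: smooth
  fields have their restriction as trace, every field has a trace, and the trace depends
  boundedly (in particular uniquely) on the field.
\<close>

definition trace_theorem :: "(real ^ 'n::finite) set \<Rightarrow> bool" where
  "trace_theorem \<Omega> \<longleftrightarrow>
     (\<forall>\<phi>. smooth \<phi> \<longrightarrow> has_trace \<Omega> \<phi> \<phi>) \<and>
     (\<forall>v\<in>H1 \<Omega>. \<exists>g. has_trace \<Omega> v g) \<and>
     (\<exists>K. \<forall>v g. has_trace \<Omega> v g \<longrightarrow> L2_norm (surface_measure \<Omega>) g \<le> K * H1_norm \<Omega> v)"

definition korn_inequality :: "(real ^ 'n::finite) set \<Rightarrow> bool" where
  "korn_inequality \<Omega> \<longleftrightarrow>
     (\<exists>K. \<forall>v\<in>H1 \<Omega>. (H1_norm \<Omega> v)\<^sup>2 \<le>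
        K * ((L2_norm (lebesgue_on \<Omega>) v)\<^sup>2 + (L2_norm (lebesgue_on \<Omega>) (strain \<Omega> v))\<^sup>2))"

text \<open>Korn's inequality for fields that vanish on a part of the boundary of positive measure.\<close>

definition korn_boundary_inequality :: "(real ^ 'n::finite) set \<Rightarrow> bool" where
  "korn_boundary_inequality \<Omega> \<longleftrightarrow>
     (\<forall>S \<subseteq> frontier \<Omega>. emeasure (surface_measure \<Omega>) S > 0 \<longrightarrow>
        (\<exists>K. \<forall>v\<in>H1_zero \<Omega> S. H1_norm \<Omega> v \<le> K * L2_norm (lebesgue_on \<Omega>) (strain \<Omega> v)))"

definition compact_embedding :: "(real ^ 'n::finite) set \<Rightarrow> bool" where
  "compact_embedding \<Omega> \<longleftrightarrow>
     (\<forall>v :: nat \<Rightarrow> 'n vfield. (\<forall>k. v k \<in> H1 \<Omega>) \<and> (\<exists>K. \<forall>k. H1_norm \<Omega> (v k) \<le> K) \<longrightarrow>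
        (\<exists>r u. strict_mono (r :: nat \<Rightarrow> nat) \<and> u \<in> L2 (lebesgue_on \<Omega>) \<and>
           (\<lambda>k. L2_norm (lebesgue_on \<Omega>) (\<lambda>x. v (r k) x - u x)) \<longlonglongrightarrow> 0))"

definition regular_domain :: "(real ^ 'n::finite) set \<Rightarrow> bool" where
  "regular_domain \<Omega> \<longleftrightarrow>
     open \<Omega> \<and> connected \<Omega> \<and> bounded \<Omega> \<and> \<Omega> \<noteq> {} \<and>
     trace_theorem \<Omega> \<and> korn_inequality \<Omega> \<and> korn_boundary_inequality \<Omega> \<and> compact_embedding \<Omega>"

section \<open>Elasticity tensors and bilinear forms\<close>

definition elasticity_tensors :: "('n::finite) tensor4 set" where
  "elasticity_tensors =
     {c. \<forall>i j k l. c $ i $ j $ k $ l = c $ k $ l $ i $ j \<and> c $ i $ j $ k $ l = c $ j $ i $ k $ l}"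

definition ddot :: "('n::finite) tensor4 \<Rightarrow> real ^ 'n ^ 'n \<Rightarrow> real ^ 'n ^ 'n" where
  "ddot c e = (\<chi> i j. \<Sum>k\<in>UNIV. \<Sum>l\<in>UNIV. c $ i $ j $ k $ l * e $ k $ l)"

definition elasticity_field ::
  "(real ^ 'n::finite) set \<Rightarrow> (real ^ 'n \<Rightarrow> 'n tensor4) \<Rightarrow> bool" where
  "elasticity_field \<Omega> \<C> \<longleftrightarrow>
     \<C> \<in> Linfty (lebesgue_on \<Omega>) \<and>
     (AE x in lebesgue_on \<Omega>. \<C> x \<in> elasticity_tensors) \<and>
     (\<exists>c\<^sub>0>0. AE x in lebesgue_on \<Omega>. \<forall>e. transpose e = e \<longrightarrow> e \<bullet> ddot (\<C> x) e \<ge> c\<^sub>0 * (e \<bullet> e))"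

definition density_field :: "(real ^ 'n::finite) set \<Rightarrow> (real ^ 'n \<Rightarrow> real) \<Rightarrow> bool" where
  "density_field \<Omega> \<rho> \<longleftrightarrow>
     \<rho> \<in> Linfty (lebesgue_on \<Omega>) \<and> (\<exists>\<rho>\<^sub>0>0. AE x in lebesgue_on \<Omega>. \<rho> x \<ge> \<rho>\<^sub>0)"

definition form_A ::
  "(real ^ 'n::finite) set \<Rightarrow> (real ^ 'n \<Rightarrow> 'n tensor4) \<Rightarrow> 'n vfield \<Rightarrow> 'n vfield \<Rightarrow> real" where
  "form_A \<Omega> \<C> v v' =
     L2_inner (lebesgue_on \<Omega>) (strain \<Omega> v) (\<lambda>x. ddot (\<C> x) (strain \<Omega> v' x))"

definition form_mass ::
  "(real ^ 'n::finite) set \<Rightarrow> (real ^ 'n \<Rightarrow> real) \<Rightarrow> 'n vfield \<Rightarrow> 'n vfield \<Rightarrow> real" where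
  "form_mass \<Omega> \<rho> v v' = L2_inner (lebesgue_on \<Omega>) (\<lambda>x. \<rho> x *\<^sub>R v x) v'"

definition form_B ::
  "(real ^ 'n::finite) set \<Rightarrow> (real ^ 'n \<Rightarrow> 'n tensor4) \<Rightarrow> (real ^ 'n \<Rightarrow> real) \<Rightarrow> real
     \<Rightarrow> 'n vfield \<Rightarrow> 'n vfield \<Rightarrow> real" where
  "form_B \<Omega> \<C> \<rho> \<omega> v v' = form_A \<Omega> \<C> v v' - \<omega>\<^sup>2 * form_mass \<Omega> \<rho> v v'"

definition inner_omega ::
  "(real ^ 'n::finite) set \<Rightarrow> (real ^ 'n \<Rightarrow> 'n tensor4) \<Rightarrow> (real ^ 'n \<Rightarrow> real) \<Rightarrow> real
     \<Rightarrow> 'n vfield \<Rightarrow> 'n vfield \<Rightarrow> real" where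
  "inner_omega \<Omega> \<C> \<rho> \<omega> v v' = form_A \<Omega> \<C> v v' + \<omega>\<^sup>2 * form_mass \<Omega> \<rho> v v'"

definition norm_omega ::
  "(real ^ 'n::finite) set \<Rightarrow> (real ^ 'n \<Rightarrow> 'n tensor4) \<Rightarrow> (real ^ 'n \<Rightarrow> real) \<Rightarrow> real
     \<Rightarrow> 'n vfield \<Rightarrow> real" where
  "norm_omega \<Omega> \<C> \<rho> \<omega> v = sqrt (inner_omega \<Omega> \<C> \<rho> \<omega> v v)"

section \<open>Functionals, kernels and variational problems\<close>

definition linear_on_fields :: "('n::finite) vfield set \<Rightarrow> ('n vfield \<Rightarrow> real) \<Rightarrow> bool" where
  "linear_on_fields V f \<longleftrightarrow>
     (\<forall>u\<in>V. \<forall>v\<in>V. f (\<lambda>x. u x + v x) = f u + f v) \<and>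
     (\<forall>c. \<forall>v\<in>V. f (\<lambda>x. c *\<^sub>R v x) = c * f v)"

text \<open>In the following, \<open>N\<close> is the norm of the space of fields \<open>V\<close>.\<close>

definition dual_space ::
  "(('n::finite) vfield \<Rightarrow> real) \<Rightarrow> 'n vfield set \<Rightarrow> ('n vfield \<Rightarrow> real) set" where
  "dual_space N V = {f. linear_on_fields V f \<and> (\<exists>K. \<forall>v\<in>V. \<bar>f v\<bar> \<le> K * N v)}"

definition dual_norm ::
  "(('n::finite) vfield \<Rightarrow> real) \<Rightarrow> 'n vfield set \<Rightarrow> ('n vfield \<Rightarrow> real) \<Rightarrow> real" where
  "dual_norm N V f = Inf {K. K \<ge> 0 \<and> (\<forall>v\<in>V. \<bar>f v\<bar> \<le> K * N v)}"

definition continuous_bilinear_form ::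
  "(('n::finite) vfield \<Rightarrow> real) \<Rightarrow> 'n vfield set \<Rightarrow> ('n vfield \<Rightarrow> 'n vfield \<Rightarrow> real) \<Rightarrow> bool" where
  "continuous_bilinear_form N V D \<longleftrightarrow>
     (\<forall>u\<in>V. linear_on_fields V (\<lambda>v. D u v)) \<and>
     (\<forall>v\<in>V. linear_on_fields V (\<lambda>u. D u v)) \<and>
     (\<exists>K. \<forall>u\<in>V. \<forall>v\<in>V. \<bar>D u v\<bar> \<le> K * N u * N v)"

text \<open>
  Null spaces of the operator \<open>U \<rightarrow> W'\<close> associated with a form \<open>b\<close> on \<open>U \<times> W\<close>, and of its transpose
  \<open>W \<rightarrow> U'\<close>.
\<close>

definition null_space ::
  "(('n::finite) vfield \<Rightarrow> 'n vfield \<Rightarrow> real) \<Rightarrow> 'n vfield set \<Rightarrow> 'n vfield set \<Rightarrow> 'n vfield set" where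
  "null_space b U W = {u \<in> U. \<forall>w\<in>W. b u w = 0}"

definition null_space_transpose ::
  "(('n::finite) vfield \<Rightarrow> 'n vfield \<Rightarrow> real) \<Rightarrow> 'n vfield set \<Rightarrow> 'n vfield set \<Rightarrow> 'n vfield set" where
  "null_space_transpose b U W = {w \<in> W. \<forall>u\<in>U. b u w = 0}"

definition orth_complement ::
  "(('n::finite) vfield \<Rightarrow> 'n vfield \<Rightarrow> real) \<Rightarrow> 'n vfield set \<Rightarrow> 'n vfield set \<Rightarrow> 'n vfield set" where
  "orth_complement ip U H = {u \<in> U. \<forall>h\<in>H. ip u h = 0}"

definition stationarity ::
  "(('n::finite) vfield \<Rightarrow> 'n vfield \<Rightarrow> real) \<Rightarrow> ('n vfield \<Rightarrow> 'n vfield \<Rightarrow> real) \<Rightarrow>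
   ('n vfield \<Rightarrow> 'n vfield \<Rightarrow> real) \<Rightarrow> 'n vfield set \<Rightarrow> 'n vfield set \<Rightarrow>
   ('n vfield \<Rightarrow> real) \<Rightarrow> ('n vfield \<Rightarrow> real) \<Rightarrow> real \<Rightarrow> 'n vfield \<Rightarrow> 'n vfield \<Rightarrow> bool" where
  "stationarity a b D W U f d \<kappa> w u \<longleftrightarrow>
     w \<in> W \<and> u \<in> U \<and>
     (\<forall>w'\<in>W. a w w' + b u w' = f w') \<and>
     (\<forall>u'\<in>U. b u' w - \<kappa> * D u u' = - \<kappa> * d u')"

text \<open>\<open>A w + B u\<^sub>1 = f\<close> in \<open>W'\<close> and \<open>B\<^sup>t w = 0\<close> in \<open>(H\<^sup>\<bottom>)'\<close>, where \<open>Hp\<close> stands for \<open>H\<^sup>\<bottom>\<close>.\<close>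

definition limit_mixed_problem ::
  "(('n::finite) vfield \<Rightarrow> 'n vfield \<Rightarrow> real) \<Rightarrow> ('n vfield \<Rightarrow> 'n vfield \<Rightarrow> real) \<Rightarrow>
   'n vfield set \<Rightarrow> 'n vfield set \<Rightarrow> ('n vfield \<Rightarrow> real) \<Rightarrow> 'n vfield \<Rightarrow> 'n vfield \<Rightarrow> bool" where
  "limit_mixed_problem a b W Hp f w u\<^sub>1 \<longleftrightarrow>
     w \<in> W \<and> u\<^sub>1 \<in> Hp \<and>
     (\<forall>w'\<in>W. a w w' + b u\<^sub>1 w' = f w') \<and>
     (\<forall>u'\<in>Hp. b u' w = 0)"

text \<open>\<open>D\<^sub>0\<^sub>0 u\<^sub>0 = g\<close> in \<open>H'\<close>.\<close>

definition limit_kernel_problem ::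
  "(('n::finite) vfield \<Rightarrow> 'n vfield \<Rightarrow> real) \<Rightarrow>
   'n vfield set \<Rightarrow> ('n vfield \<Rightarrow> real) \<Rightarrow> 'n vfield \<Rightarrow> bool" where
  "limit_kernel_problem D H g u\<^sub>0 \<longleftrightarrow> u\<^sub>0 \<in> H \<and> (\<forall>h\<in>H. D u\<^sub>0 h = g h)"

end

theory Submission
  imports Defs "HOL-Library.Function_Algebras"
begin

text \<open>
  Eliminating the first unknown turns both problems into problems for the Schur complement
  \<open>Q = B\<^sup>t A\<^sup>-\<^sup>1 B\<close> on \<open>\<U>\<close>: the stationarity problem has the form \<open>Q + \<kappa> \<D>\<close>, the mixed limit
  problem the form \<open>Q\<close> on \<open>\<H>\<^sup>\<bottom>\<close>.  All well-posedness statements are instances of the Riesz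
  representation theorem once \<open>Q\<close> is coercive on \<open>\<H>\<^sup>\<bottom>\<close>.  Since \<open>\<W> \<subseteq> \<U>\<close> and \<open>\<B>\<close> is a compact
  perturbation of the inner product, \<open>B\<^sup>t\<close> is bounded below on the orthogonal complement of \<open>\<K>\<close>;
  hence its range is closed and equals \<open>\<H>\<^sup>\<bottom>\<close>, which gives the coercivity.

  The error \<open>e = e\<^sub>0 + e\<^sub>1\<close> of the expansion solves the penalised equation with right-hand side
  \<open>\<kappa>\<close> times a functional that vanishes on \<open>\<H>\<close>; testing with \<open>e\<close> bounds \<open>e\<^sub>1\<close>, testing with \<open>e\<^sub>0\<close>
  bounds \<open>e\<^sub>0\<close> by \<open>e\<^sub>1\<close>.
\<close>

text \<open>Fields are functions, not classes modulo null sets, so the energy inner product is only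
  semidefinite. The abstract part therefore works with semi-inner products on subspaces: limits,
  projections and representers are chosen rather than unique, uniqueness reads
  \<open>N (u - u') = 0\<close>, and only the last step turns it into equality almost everywhere.
  Operators made of such choices are not known to be linear; linearity is read off the bilinear
  forms.

  Likewise \<open>weak_grad\<close> is a choice, so bilinearity of the forms rests on uniqueness of
  weak gradients, hence on the fundamental lemma of the calculus of variations.

  \<B> is indefinite and both its kernels may be nontrivial, so no inf-sup condition is available on
  the full spaces. On the complements a closed range remains to be proved, and only there does the
  compact embedding enter. Coercivity of the penalised form degenerates as \<kappa> tends to 0: it
  gives solvability for each \<kappa> but no rate, which has to come from constants free of
  \<kappa>.\<close>

instantiation "fun" :: (type, scaleR) scaleR
begin

definition scaleR_fun_def: "c *\<^sub>R f = (\<lambda>x. c *\<^sub>R f x)"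

instance ..

end

instance "fun" :: (type, real_vector) real_vector
  by standard (simp_all add: scaleR_fun_def fun_eq_iff scaleR_add_right scaleR_add_left)

section \<open>Complete semi-inner product spaces on subspaces\<close>

text \<open>Linearity is relative to \<open>V\<close> because the forms are total functions about
  which nothing is known outside their spaces.\<close>

definition lin_on :: "'a::real_vector set \<Rightarrow> ('a \<Rightarrow> real) \<Rightarrow> bool" where
  "lin_on V f \<longleftrightarrow>
     (\<forall>u\<in>V. \<forall>v\<in>V. f (u + v) = f u + f v) \<and> (\<forall>c. \<forall>v\<in>V. f (c *\<^sub>R v) = c * f v)"

lemma lin_on_add: "lin_on V f \<Longrightarrow> u \<in> V \<Longrightarrow> v \<in> V \<Longrightarrow> f (u + v) = f u + f v"
  and lin_on_scale: "lin_on V f \<Longrightarrow> v \<in> V \<Longrightarrow> f (c *\<^sub>R v) = c * f v"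
  by (auto simp: lin_on_def)

lemma lin_on_diff:
  assumes "subspace V" "lin_on V f" "u \<in> V" "v \<in> V"
  shows "f (u - v) = f u - f v"
proof -
  have "f (u - v) = f (u + (-1) *\<^sub>R v)" by simp
  also have "\<dots> = f u + (-1) * f v"
    using assms subspace_scale by (metis lin_on_add lin_on_scale)
  finally show ?thesis by simp
qed

lemma lin_on_zero: "subspace V \<Longrightarrow> lin_on V f \<Longrightarrow> f 0 = 0"
  using lin_on_scale[of V f 0 0] subspace_0 by auto

lemma lin_on_subset: "lin_on V f \<Longrightarrow> V' \<subseteq> V \<Longrightarrow> lin_on V' f"
  unfolding lin_on_def by blast

definition bilin_on ::
  "'a::real_vector set \<Rightarrow> 'b::real_vector set \<Rightarrow> ('a \<Rightarrow> 'b \<Rightarrow> real) \<Rightarrow> bool" where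
  "bilin_on V W g \<longleftrightarrow> (\<forall>v\<in>V. lin_on W (g v)) \<and> (\<forall>w\<in>W. lin_on V (\<lambda>v. g v w))"

lemma bilin_on_left: "bilin_on V W g \<Longrightarrow> w \<in> W \<Longrightarrow> lin_on V (\<lambda>v. g v w)"
  and bilin_on_right: "bilin_on V W g \<Longrightarrow> v \<in> V \<Longrightarrow> lin_on W (g v)"
  by (auto simp: bilin_on_def)

lemma bilin_on_subset: "bilin_on V W g \<Longrightarrow> V' \<subseteq> V \<Longrightarrow> W' \<subseteq> W \<Longrightarrow> bilin_on V' W' g"
  by (auto simp: bilin_on_def intro: lin_on_subset)

lemma bilin_on_sum:
  "bilin_on V W g \<Longrightarrow> bilin_on V W h \<Longrightarrow> bilin_on V W (\<lambda>v w. g v w + c * h v w)"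
  by (auto simp: bilin_on_def lin_on_def algebra_simps)

definition nrm :: "('a \<Rightarrow> 'a \<Rightarrow> real) \<Rightarrow> 'a \<Rightarrow> real" where
  "nrm g v = sqrt (g v v)"

lemma null_comparison:
  fixes f g :: "nat \<Rightarrow> real"
  shows "g \<longlonglongrightarrow> 0 \<Longrightarrow> (\<And>k. \<bar>f k\<bar> \<le> g k) \<Longrightarrow> f \<longlonglongrightarrow> 0"
  by (rule Lim_null_comparison[of f g]) auto

text \<open>In the applications \<open>n\<close> is a seminorm, so the limit is determined only up
  to elements of size zero; hence a formulation by sequences instead of a metric.\<close>

definition seq_complete :: "'a::real_vector set \<Rightarrow> ('a \<Rightarrow> real) \<Rightarrow> bool" where
  "seq_complete V n \<longleftrightarrow>
     (\<forall>X. (\<forall>k. X k \<in> V) \<and> (\<forall>e>0. \<exists>M. \<forall>i\<ge>M. \<forall>j\<ge>M. n (X i - X j) \<le> e) \<longrightarrow>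
        (\<exists>x\<in>V. (\<lambda>k. n (X k - x)) \<longlonglongrightarrow> 0))"

lemma seq_completeE:
  assumes "seq_complete V n" "\<And>k. X k \<in> V"
    and "\<And>e. e > 0 \<Longrightarrow> \<exists>M. \<forall>i\<ge>M. \<forall>j\<ge>M. n (X i - X j) \<le> e"
  obtains x where "x \<in> V" "(\<lambda>k. n (X k - x)) \<longlonglongrightarrow> 0"
  using assms unfolding seq_complete_def by blast

lemma seq_complete_equiv:
  fixes V :: "'a::real_vector set"
  assumes V: "subspace V" and c: "seq_complete V n" and nn: "\<And>v. v \<in> V \<Longrightarrow> 0 \<le> n' v"
    and le: "\<And>v. v \<in> V \<Longrightarrow> n v \<le> C * n' v" "\<And>v. v \<in> V \<Longrightarrow> n' v \<le> C' * n v"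
  shows "seq_complete V n'"
  unfolding seq_complete_def
proof (intro allI impI, elim conjE)
  fix X :: "nat \<Rightarrow> 'a"
  assume X: "\<forall>k. X k \<in> V" and Cau: "\<forall>e>0. \<exists>M. \<forall>i\<ge>M. \<forall>j\<ge>M. n' (X i - X j) \<le> e"
  have dV: "X i - x \<in> V" if "x \<in> V" for i x using V X that by (simp add: subspace_diff)
  have "\<exists>M. \<forall>i\<ge>M. \<forall>j\<ge>M. n (X i - X j) \<le> e" if e: "e > 0" for e
  proof -
    \<comment> \<open>The sign of \<open>C\<close> is unknown; \<open>\<bar>C\<bar> + 1\<close> is a
      positive constant that dominates it.\<close>
    have "e / (\<bar>C\<bar> + 1) > 0" using e by (simp add: add_nonneg_pos)
    from Cau[rule_format, OF this]
    obtain M where M: "\<forall>i\<ge>M. \<forall>j\<ge>M. n' (X i - X j) \<le> e / (\<bar>C\<bar> + 1)" ..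
    have "n (X i - X j) \<le> e" if ij: "i \<ge> M" "j \<ge> M" for i j
    proof -
      have "n (X i - X j) \<le> C * n' (X i - X j)" using le(1)[OF dV] X by simp
      also have "\<dots> \<le> (\<bar>C\<bar> + 1) * n' (X i - X j)"
        using nn[OF dV] X by (intro mult_right_mono) auto
      also have "\<dots> \<le> (\<bar>C\<bar> + 1) * (e / (\<bar>C\<bar> + 1))"
        using M ij by (intro mult_left_mono) auto
      also have "\<dots> = e" by simp
      finally show ?thesis .
    qed
    then show ?thesis by blast
  qed
  with c X obtain x where x: "x \<in> V" "(\<lambda>k. n (X k - x)) \<longlonglongrightarrow> 0"
    by (metis seq_completeE)
  have "(\<lambda>k. C' * n (X k - x)) \<longlonglongrightarrow> 0" using tendsto_mult_right_zero[OF x(2)] by simp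
  then have "(\<lambda>k. n' (X k - x)) \<longlonglongrightarrow> 0"
    by (rule null_comparison) (use nn[OF dV] le(2)[OF dV] x in simp)
  with x show "\<exists>x\<in>V. (\<lambda>k. n' (X k - x)) \<longlonglongrightarrow> 0" by blast
qed

section \<open>Semi-inner products and their seminorm\<close>

locale semi_inner =
  fixes V :: "'a::real_vector set" and ip :: "'a \<Rightarrow> 'a \<Rightarrow> real"
  assumes subsp: "subspace V"
    and bilin: "bilin_on V V ip"
    and sym: "\<And>u v. u \<in> V \<Longrightarrow> v \<in> V \<Longrightarrow> ip u v = ip v u"
    and pos: "\<And>v. v \<in> V \<Longrightarrow> 0 \<le> ip v v"
begin

abbreviation "N \<equiv> nrm ip"

lemmas add_left = lin_on_add[OF bilin_on_left[OF bilin]]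
  and add_right = lin_on_add[OF bilin_on_right[OF bilin]]
  and diff_left = lin_on_diff[OF subsp bilin_on_left[OF bilin]]
  and diff_right = lin_on_diff[OF subsp bilin_on_right[OF bilin]]
  and scale_left = lin_on_scale[OF bilin_on_left[OF bilin]]
  and scale_right = lin_on_scale[OF bilin_on_right[OF bilin]]

lemmas closed = subspace_add[OF subsp] subspace_diff[OF subsp] subspace_scale[OF subsp]
  subspace_0[OF subsp]

lemma N_nonneg: "v \<in> V \<Longrightarrow> 0 \<le> N v"
  by (simp add: nrm_def pos)

lemma N_sq: "v \<in> V \<Longrightarrow> (N v)\<^sup>2 = ip v v"
  by (simp add: nrm_def pos)

lemma N_scale: "v \<in> V \<Longrightarrow> N (c *\<^sub>R v) = \<bar>c\<bar> * N v"
  by (simp add: nrm_def scale_left scale_right closed real_sqrt_mult power2_eq_square[symmetric]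
      flip: mult.assoc)

lemma Cauchy_Schwarz:
  assumes u: "u \<in> V" and v: "v \<in> V"
  shows "\<bar>ip u v\<bar> \<le> N u * N v"
proof -
  have q: "0 \<le> ip u u - 2 * t * ip u v + t\<^sup>2 * ip v v" for t
  proof -
    have "0 \<le> ip (u - t *\<^sub>R v) (u - t *\<^sub>R v)" using u v by (intro pos closed)
    also have "\<dots> = ip u u - 2 * t * ip u v + t\<^sup>2 * ip v v"
      using u v by (simp add: diff_left diff_right scale_left scale_right closed sym[of v u]
          power2_eq_square algebra_simps)
    finally show ?thesis .
  qed
  have "(ip u v)\<^sup>2 \<le> ip u u * ip v v"
  proof (cases "ip v v = 0")
    case True
    have "ip u v = 0"
    proof (rule ccontr)
      assume "ip u v \<noteq> 0"
      \<comment> \<open>A null vector \<open>v\<close> may be nonzero. The quadratic in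
        \<open>t\<close> is then affine, and this \<open>t\<close> gives it the value
        \<open>-1\<close>.\<close>
      then show False using q[of "(ip u u + 1) / (2 * ip u v)"] True by simp
    qed
    then show ?thesis using True by simp
  next
    case False
    then have "ip v v > 0" using pos[OF v] by simp
    then show ?thesis using q[of "ip u v / ip v v"]
      by (simp add: field_simps power2_eq_square)
  qed
  then have "sqrt ((ip u v)\<^sup>2) \<le> sqrt (ip u u * ip v v)" by (rule real_sqrt_le_mono)
  then show ?thesis by (simp add: nrm_def real_sqrt_mult)
qed

lemma N_triangle:
  assumes u: "u \<in> V" and v: "v \<in> V"
  shows "N (u + v) \<le> N u + N v"
proof -
  have "(N (u + v))\<^sup>2 = ip u u + 2 * ip u v + ip v v"
    using u v by (simp add: N_sq closed add_left add_right sym[of v u])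
  also have "\<dots> \<le> (N u)\<^sup>2 + 2 * (N u * N v) + (N v)\<^sup>2"
    using Cauchy_Schwarz[OF u v] u v by (simp add: N_sq)
  also have "\<dots> = (N u + N v)\<^sup>2" by (simp add: power2_sum)
  finally show ?thesis using N_nonneg u v by (meson add_nonneg_nonneg power2_le_imp_le)
qed

lemma N_minus: "v \<in> V \<Longrightarrow> N (- v) = N v"
  using N_scale[of v "-1"] by simp

lemma N_diff_commute: "u \<in> V \<Longrightarrow> v \<in> V \<Longrightarrow> N (u - v) = N (v - u)"
  using N_minus[of "u - v"] closed by simp

lemma N_triangle_diff: "u \<in> V \<Longrightarrow> v \<in> V \<Longrightarrow> N (u - v) \<le> N u + N v"
  using N_triangle[of u "- v"] N_minus[of v] subspace_neg[OF subsp] by simp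

lemma N_triangle_via: "u \<in> V \<Longrightarrow> v \<in> V \<Longrightarrow> w \<in> V \<Longrightarrow> N (u - v) \<le> N (u - w) + N (w - v)"
  using N_triangle[of "u - w" "w - v"] closed by simp

lemma N_zero_left: "N v = 0 \<Longrightarrow> u \<in> V \<Longrightarrow> v \<in> V \<Longrightarrow> ip v u = 0"
  using Cauchy_Schwarz[of v u] by simp

lemma N_zero_iff: "v \<in> V \<Longrightarrow> N v = 0 \<longleftrightarrow> ip v v = 0"
  by (simp add: nrm_def)

lemma tendsto_N:
  assumes "\<And>k. X k \<in> V" "x \<in> V" and lim: "(\<lambda>k. N (X k - x)) \<longlonglongrightarrow> 0"
  shows "(\<lambda>k. N (X k)) \<longlonglongrightarrow> N x"
proof -
  have "\<bar>N (X k) - N x\<bar> \<le> N (X k - x)" for k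
  proof -
    have "N (X k) \<le> N (X k - x) + N x" "N x \<le> N (X k - x) + N (X k)"
      using N_triangle[of "X k - x" x] N_triangle_diff[of "X k" "X k - x"] assms(1)[of k] assms(2) closed
      by (simp_all add: add.commute)
    then show ?thesis by simp
  qed
  then have "(\<lambda>k. N (X k) - N x) \<longlonglongrightarrow> 0"
    by (rule null_comparison[OF lim])
  then show ?thesis by (rule LIM_zero_cancel)
qed

lemma tendsto_bounded_functional:
  assumes "\<And>k. X k \<in> V" "x \<in> V" and lim: "(\<lambda>k. N (X k - x)) \<longlonglongrightarrow> 0"
    and f: "lin_on V f" "\<And>v. v \<in> V \<Longrightarrow> \<bar>f v\<bar> \<le> C * N v"
  shows "(\<lambda>k. f (X k)) \<longlonglongrightarrow> f x"
proof -
  have "(\<lambda>k. C * N (X k - x)) \<longlonglongrightarrow> 0" using tendsto_mult_right_zero[OF lim] by simp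
  then have "(\<lambda>k. f (X k) - f x) \<longlonglongrightarrow> 0"
  proof (rule null_comparison)
    show "\<bar>f (X k) - f x\<bar> \<le> C * N (X k - x)" for k
      using f(2)[of "X k - x"] assms(1,2) lin_on_diff[OF subsp f(1)] closed by simp
  qed
  then show ?thesis by (rule LIM_zero_cancel)
qed

lemma tendsto_ip_left:
  assumes "\<And>k. X k \<in> V" "x \<in> V" "(\<lambda>k. N (X k - x)) \<longlonglongrightarrow> 0" and y: "y \<in> V"
  shows "(\<lambda>k. ip (X k) y) \<longlonglongrightarrow> ip x y"
  by (rule tendsto_bounded_functional[OF assms(1-3) bilin_on_left[OF bilin y], of "N y"])
    (use Cauchy_Schwarz[OF _ y] in \<open>simp add: mult.commute\<close>)

lemma semi_inner_subspace: "subspace V' \<Longrightarrow> V' \<subseteq> V \<Longrightarrow> semi_inner V' ip"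
  using bilin_on_subset[OF bilin] sym pos by (simp add: semi_inner_def subset_iff)

end

section \<open>Completeness, Riesz representation and the symmetric Lax-Milgram lemma\<close>

locale semi_hilbert = semi_inner +
  assumes complete: "seq_complete V N"
begin

lemma semi_hilbert_closed:
  assumes V': "subspace V'" "V' \<subseteq> V"
    and closed: "\<And>X x. (\<And>k. X k \<in> V') \<Longrightarrow> x \<in> V \<Longrightarrow> (\<lambda>k. N (X k - x)) \<longlonglongrightarrow> 0 \<Longrightarrow> x \<in> V'"
  shows "semi_hilbert V' ip"
proof -
  interpret s: semi_inner V' ip using V' by (rule semi_inner_subspace)
  show ?thesis
  proof
    show "seq_complete V' N"
      using complete closed V'(2) unfolding seq_complete_def by (metis subsetD)
  qed
qed

text \<open>Null spaces and orthogonal complements alike are cut out by families of bounded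
  functionals, so this one closedness argument serves all four subspaces of the saddle-point
  problem. The bound may vary with \<open>i\<close>.\<close>

lemma semi_hilbert_annihilator:
  assumes lin: "\<And>i. i \<in> I \<Longrightarrow> lin_on V (F i)"
    and bd: "\<And>i. i \<in> I \<Longrightarrow> \<exists>C. \<forall>v\<in>V. \<bar>F i v\<bar> \<le> C * N v"
  shows "semi_hilbert {v\<in>V. \<forall>i\<in>I. F i v = 0} ip"
proof (rule semi_hilbert_closed)
  show "subspace {v\<in>V. \<forall>i\<in>I. F i v = 0}"
    by (auto simp: subspace_def closed lin_on_zero[OF subsp lin] lin_on_add[OF lin]
        lin_on_scale[OF lin])
  show "x \<in> {v\<in>V. \<forall>i\<in>I. F i v = 0}"
    if X: "\<And>k. X k \<in> {v\<in>V. \<forall>i\<in>I. F i v = 0}" and x: "x \<in> V"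
      and lim: "(\<lambda>k. N (X k - x)) \<longlonglongrightarrow> 0" for X x
  proof -
    have "F i x = 0" if i: "i \<in> I" for i
    proof -
      obtain C where C: "\<forall>v\<in>V. \<bar>F i v\<bar> \<le> C * N v" using bd[OF i] ..
      have "(\<lambda>k. F i (X k)) \<longlonglongrightarrow> F i x"
        using X x lim C lin[OF i] by (intro tendsto_bounded_functional[where C=C]) auto
      moreover have "F i (X k) = 0" for k using X i by blast
      ultimately show ?thesis by (simp add: LIMSEQ_const_iff)
    qed
    then show ?thesis using x by blast
  qed
qed auto

text \<open>The representer minimises \<open>ip v v - 2 * f v\<close>; minimising sequences are Cauchy by the
  parallelogram identity.\<close>

lemma riesz:
  assumes f: "lin_on V f" and bd: "\<And>v. v \<in> V \<Longrightarrow> \<bar>f v\<bar> \<le> C * N v"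
  shows "\<exists>r\<in>V. \<forall>v\<in>V. ip r v = f v"
proof -
  define J where "J v = ip v v - 2 * f v" for v
  have f0: "f 0 = 0" using lin_on_zero[OF subsp f] .
  have low: "- C\<^sup>2 \<le> J v" if v: "v \<in> V" for v
  proof -
    have "0 \<le> (N v - C)\<^sup>2" by simp
    also have "\<dots> = ip v v - 2 * (C * N v) + C\<^sup>2"
      using v by (simp add: power2_diff N_sq)
    also have "\<dots> \<le> J v + C\<^sup>2" using bd[OF v] by (simp add: J_def)
    finally show ?thesis by simp
  qed
  define m where "m = Inf (J ` V)"
  have bb: "bdd_below (J ` V)" using low by (auto simp: bdd_below_def)
  have ne: "J ` V \<noteq> {}" using closed by auto
  have mle: "m \<le> J v" if "v \<in> V" for v unfolding m_def using bb that by (simp add: cInf_lower)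
  have "\<exists>v\<in>V. J v < m + 1 / Suc k" for k
    using cInf_lessD[OF ne, of "m + 1 / Suc k"] by (auto simp: m_def)
  then obtain X where X: "\<And>k. X k \<in> V" "\<And>k. J (X k) < m + 1 / Suc k" by metis
  have par: "ip (X i - X j) (X i - X j) \<le> 2 / Suc i + 2 / Suc j" for i j
  proof -
    define h where "h = (1/2) *\<^sub>R (X i + X j)"
    have hV: "h \<in> V" using X closed by (simp add: h_def)
    have "ip (X i - X j) (X i - X j) = 2 * J (X i) + 2 * J (X j) - 4 * J h"
      using X by (simp add: J_def h_def scale_left scale_right closed add_left add_right
          diff_left diff_right sym[of "X j" "X i"] lin_on_add[OF f] lin_on_scale[OF f]
          add_divide_distrib)
    then show ?thesis using mle[OF hV] X(2)[of i] X(2)[of j] by simp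
  qed
  have Cau: "\<exists>M. \<forall>i\<ge>M. \<forall>j\<ge>M. N (X i - X j) \<le> e" if e: "e > 0" for e
  proof -
    obtain M where M: "4 / e\<^sup>2 < real M" using reals_Archimedean2 by blast
    have "N (X i - X j) \<le> e" if ij: "i \<ge> M" "j \<ge> M" for i j
    proof -
      have Mp: "real M > 0" using M e by (meson divide_pos_pos less_trans zero_less_numeral zero_less_power)
      have "2 / real (Suc i) \<le> 2 / M" "2 / real (Suc j) \<le> 2 / M"
        using ij Mp by (auto intro!: divide_left_mono)
      then have "ip (X i - X j) (X i - X j) \<le> 4 / M" using par[of i j] by simp
      also have "\<dots> \<le> e\<^sup>2" using M e Mp by (simp add: field_simps)
      finally have "(N (X i - X j))\<^sup>2 \<le> e\<^sup>2" using X closed by (simp add: N_sq)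
      then show ?thesis by (rule power2_le_imp_le) (use e in simp)
    qed
    then show ?thesis by blast
  qed
  obtain r where r: "r \<in> V" "(\<lambda>k. N (X k - r)) \<longlonglongrightarrow> 0"
    using seq_completeE[OF complete X(1) Cau] by blast
  have "(\<lambda>k. (N (X k))\<^sup>2 - 2 * f (X k)) \<longlonglongrightarrow> (N r)\<^sup>2 - 2 * f r"
    using X r f bd by (intro tendsto_intros tendsto_N tendsto_bounded_functional[where C=C]) auto
  then have "(\<lambda>k. J (X k)) \<longlonglongrightarrow> J r" using X r by (simp add: J_def N_sq)
  moreover have "(\<lambda>k. m + 1 / Suc k) \<longlonglongrightarrow> m + 0"
    by (intro tendsto_intros LIMSEQ_inverse_real_of_nat[unfolded inverse_eq_divide])
  ultimately have Jr: "J r \<le> m"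
    by (metis (no_types, lifting) LIMSEQ_le X(2) add.right_neutral less_imp_le)
  have "ip r v = f v" if v: "v \<in> V" for v
  proof -
    define s where "s = ip r v - f v"
    have q: "0 \<le> t\<^sup>2 * ip v v + 2 * t * s" for t
    proof -
      have "J r \<le> J (r + t *\<^sub>R v)" using Jr mle r v closed by (meson order_trans)
      also have "J (r + t *\<^sub>R v) = J r + (t\<^sup>2 * ip v v + 2 * t * s)"
        using r v by (simp add: J_def s_def add_left add_right scale_left scale_right closed
            sym[of v r] lin_on_add[OF f] lin_on_scale[OF f] power2_eq_square algebra_simps)
      finally show ?thesis by simp
    qed
    have "s = 0"
    proof (rule ccontr)
      assume s: "s \<noteq> 0"
      \<comment> \<open>The contradiction comes from the step \<open>t = - s / c\<close>. The
        summand 1 keeps \<open>c\<close> positive when \<open>v\<close> is a null vector.\<close>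
      define c where "c = ip v v + 1"
      have c: "c > 0" using pos[OF v] by (simp add: c_def)
      have "(s / c)\<^sup>2 * ip v v - 2 * s\<^sup>2 / c \<le> (s/c)\<^sup>2 * c - 2 * s\<^sup>2 / c"
        by (simp add: c_def mult_left_mono)
      also have "\<dots> = - (s\<^sup>2 / c)" using c by (simp add: field_simps power2_eq_square)
      also have "\<dots> < 0" using s c by simp
      finally show False using q[of "- s / c"] c by (simp add: power2_eq_square)
    qed
    then show ?thesis by (simp add: s_def)
  qed
  with r show ?thesis by blast
qed

text \<open>Because \<open>g\<close> is symmetric, it is itself a semi-inner product whose seminorm
  is equivalent to \<open>N\<close>. Completeness carries over, and the Riesz theorem for
  \<open>g\<close> solves the equation.\<close>

lemma lax_milgram:
  assumes g: "bilin_on V V g" and gsym: "\<And>u v. u \<in> V \<Longrightarrow> v \<in> V \<Longrightarrow> g u v = g v u"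
    and bd: "\<And>v. v \<in> V \<Longrightarrow> g v v \<le> C * ip v v"
    and coer: "c > 0" "\<And>v. v \<in> V \<Longrightarrow> c * ip v v \<le> g v v"
    and f: "lin_on V f" "\<And>v. v \<in> V \<Longrightarrow> \<bar>f v\<bar> \<le> K * N v"
  shows "\<exists>r\<in>V. \<forall>v\<in>V. g r v = f v"
proof -
  have gpos: "0 \<le> g v v" if "v \<in> V" for v
    using coer pos that by (meson mult_nonneg_nonneg less_imp_le order_trans)
  interpret g: semi_inner V g by unfold_locales (use subsp g gsym gpos in auto)
  have le: "N v \<le> (1 / sqrt c) * nrm g v" if "v \<in> V" for v
    using coer(2)[OF that] coer(1) real_sqrt_le_mono[of "c * ip v v" "g v v"]
    by (simp add: nrm_def real_sqrt_mult field_simps)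
  have ge: "nrm g v \<le> sqrt C * N v" if "v \<in> V" for v
    using real_sqrt_le_mono[OF bd[OF that]] by (simp add: nrm_def real_sqrt_mult)
  interpret g: semi_hilbert V g
    by unfold_locales (rule seq_complete_equiv[OF subsp complete g.N_nonneg le ge])
  have "\<bar>f v\<bar> \<le> (\<bar>K\<bar> / sqrt c) * nrm g v" if v: "v \<in> V" for v
  proof -
    have "\<bar>f v\<bar> \<le> \<bar>K\<bar> * N v"
      using f(2)[OF v] N_nonneg[OF v] by (meson abs_ge_self mult_right_mono order_trans)
    also have "\<dots> \<le> \<bar>K\<bar> * ((1 / sqrt c) * nrm g v)" using le[OF v] by (rule mult_left_mono) simp
    finally show ?thesis by simp
  qed
  then show ?thesis by (rule g.riesz[OF f(1)])
qed

end

section \<open>A penalised saddle-point problem\<close>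

text \<open>A priori bounds arise by testing an equation with its own solution, as a square bounded
  by a multiple of the norm; this cancels one factor even when it is zero.\<close>

lemma le_of_sq_le:
  fixes x k :: real
  shows "0 \<le> x \<Longrightarrow> 0 \<le> k \<Longrightarrow> x * x \<le> k * x \<Longrightarrow> x \<le> k"
  by (metis mult_right_le_imp_le order_le_less)

text \<open>\<open>b_compact\<close> is the only trace of compactness: along a subsequence,
  differences \<open>y\<close> satisfy \<open>(N y)\<^sup>2 \<le> b y y\<close> up to an arbitrarily
  small error. It makes sense because \<open>W \<subseteq> U\<close> lets \<open>y\<close> occupy
  both slots of \<open>b\<close>, and it spares the abstract part a second, weaker norm. In
  \<open>D_coercive\<close> the kernel \<open>H\<close> is written out, as it is not yet
  defined.\<close>

locale saddle_point = semi_hilbert U ip for U :: "'a::real_vector set" and ip +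
  fixes W :: "'a set" and a b D :: "'a \<Rightarrow> 'a \<Rightarrow> real" and \<alpha> \<delta> Ca Cb Cd :: real
  assumes WU: "W \<subseteq> U"
    and hilbert_W: "semi_hilbert W ip"
    and a_bilin: "bilin_on W W a" and b_bilin: "bilin_on U W b" and D_bilin: "bilin_on U U D"
    and C_nonneg: "0 \<le> Ca" "0 \<le> Cb" "0 \<le> Cd"
    and a_bound: "\<And>v w. v \<in> W \<Longrightarrow> w \<in> W \<Longrightarrow> \<bar>a v w\<bar> \<le> Ca * N v * N w"
    and b_bound: "\<And>u w. u \<in> U \<Longrightarrow> w \<in> W \<Longrightarrow> \<bar>b u w\<bar> \<le> Cb * N u * N w"
    and D_bound: "\<And>u v. u \<in> U \<Longrightarrow> v \<in> U \<Longrightarrow> \<bar>D u v\<bar> \<le> Cd * N u * N v"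
    and a_sym: "\<And>v w. v \<in> W \<Longrightarrow> w \<in> W \<Longrightarrow> a v w = a w v"
    and a_coercive: "\<alpha> > 0" "\<And>w. w \<in> W \<Longrightarrow> \<alpha> * (N w)\<^sup>2 \<le> a w w"
    and b_compact: "\<And>X. (\<And>k. X k \<in> W) \<Longrightarrow> (\<And>k. N (X k) \<le> 1) \<Longrightarrow>
      \<exists>r :: nat \<Rightarrow> nat. strict_mono r \<and> (\<forall>e>0. \<exists>M. \<forall>i\<ge>M. \<forall>j\<ge>M.
        (N (X (r i) - X (r j)))\<^sup>2 \<le> b (X (r i) - X (r j)) (X (r i) - X (r j)) + e)"
    and D_sym: "\<And>u v. u \<in> U \<Longrightarrow> v \<in> U \<Longrightarrow> D u v = D v u"
    and D_pos: "\<And>u. u \<in> U \<Longrightarrow> 0 \<le> D u u"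
    and D_coercive: "\<delta> > 0"
      "\<And>u. u \<in> U \<Longrightarrow> (\<And>w. w \<in> W \<Longrightarrow> b u w = 0) \<Longrightarrow> \<delta> * (N u)\<^sup>2 \<le> D u u"
begin

sublocale W: semi_hilbert W ip by (rule hilbert_W)

section \<open>Kernels, their complements and the orthogonal splittings\<close>

definition H where "H = {u \<in> U. \<forall>w\<in>W. b u w = 0}"
definition Hp where "Hp = {u \<in> U. \<forall>h\<in>H. ip u h = 0}"
definition K where "K = {w \<in> W. \<forall>u\<in>U. b u w = 0}"
definition Kp where "Kp = {w \<in> W. \<forall>k\<in>K. ip w k = 0}"

lemma in_U: "w \<in> W \<Longrightarrow> w \<in> U" "h \<in> H \<Longrightarrow> h \<in> U" "h \<in> Hp \<Longrightarrow> h \<in> U"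
  "k \<in> K \<Longrightarrow> k \<in> U" "k \<in> Kp \<Longrightarrow> k \<in> U"
  and in_W: "k \<in> K \<Longrightarrow> k \<in> W" "k \<in> Kp \<Longrightarrow> k \<in> W"
  using WU by (auto simp: H_def Hp_def K_def Kp_def)

lemma b_bound_left: "w \<in> W \<Longrightarrow> \<exists>C. \<forall>u\<in>U. \<bar>b u w\<bar> \<le> C * N u"
  and b_bound_right: "u \<in> U \<Longrightarrow> \<exists>C. \<forall>w\<in>W. \<bar>b u w\<bar> \<le> C * N w"
  using b_bound by (force intro!: exI[of _ "Cb * N w"] simp: mult_ac, force intro!: exI[of _ "Cb * N u"])

lemma ip_bound: "u \<in> U \<Longrightarrow> \<exists>C. \<forall>v\<in>U. \<bar>ip v u\<bar> \<le> C * N v"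
  using Cauchy_Schwarz[of _ u] by (metis mult.commute)

lemma hilbert_H: "semi_hilbert H ip"
  unfolding H_def by (rule semi_hilbert_annihilator) (rule bilin_on_left[OF b_bilin] b_bound_left, assumption)+

lemma hilbert_Hp: "semi_hilbert Hp ip"
  unfolding Hp_def
  by (rule semi_hilbert_annihilator)
    (rule bilin_on_left[OF bilin] ip_bound, rule in_U(2), assumption)+

lemma hilbert_K: "semi_hilbert K ip"
  unfolding K_def
  by (rule W.semi_hilbert_annihilator) (rule bilin_on_right[OF b_bilin] b_bound_right, assumption)+

lemma hilbert_Kp: "semi_hilbert Kp ip"
  unfolding Kp_def
proof (rule W.semi_hilbert_annihilator)
  show "lin_on W (\<lambda>w. ip w k)" if "k \<in> K" for k
    using bilin_on_left[OF W.bilin in_W(1)[OF that]] .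
  show "\<exists>C. \<forall>w\<in>W. \<bar>ip w k\<bar> \<le> C * N w" if "k \<in> K" for k
    using ip_bound[OF in_U(4)[OF that]] WU by blast
qed

sublocale H: semi_hilbert H ip by (rule hilbert_H)
sublocale Hp: semi_hilbert Hp ip by (rule hilbert_Hp)
sublocale K: semi_hilbert K ip by (rule hilbert_K)
sublocale Kp: semi_hilbert Kp ip by (rule hilbert_Kp)

lemma ip_H_Hp: "u \<in> Hp \<Longrightarrow> h \<in> H \<Longrightarrow> ip u h = 0" "u \<in> Hp \<Longrightarrow> h \<in> H \<Longrightarrow> ip h u = 0"
  unfolding Hp_def using sym[of h u] in_U(2)[of h] by auto

text \<open>Orthogonal projection: \<open>u0\<close> is the Riesz representer in \<open>H\<close> of
  the restriction of \<open>ip u\<close>.\<close>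

lemma split_U:
  assumes u: "u \<in> U"
  obtains u0 u1 where "u0 \<in> H" "u1 \<in> Hp" "u = u0 + u1"
proof -
  have lin: "lin_on H (ip u)" using bilin_on_right[OF bilin u] in_U by (auto intro: lin_on_subset)
  have bd: "\<bar>ip u h\<bar> \<le> N u * N h" if "h \<in> H" for h using Cauchy_Schwarz u that in_U by blast
  obtain u0 where u0: "u0 \<in> H" "\<forall>h\<in>H. ip u0 h = ip u h"
    using H.riesz[OF lin bd] by blast
  have uU: "u0 \<in> U" using u0(1) by (rule in_U)
  have "u - u0 \<in> Hp"
    unfolding Hp_def using u u0(2) in_U(2) closed(2)[OF u uU] diff_left[OF _ u uU] by simp
  with u0 that[of u0 "u - u0"] show ?thesis by simp
qed

lemma split_W:
  assumes w: "w \<in> W"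
  obtains k w' where "k \<in> K" "w' \<in> Kp" "w = k + w'"
proof -
  have lin: "lin_on K (ip w)" using bilin_on_right[OF W.bilin w] in_W by (auto intro: lin_on_subset)
  have bd: "\<bar>ip w h\<bar> \<le> N w * N h" if "h \<in> K" for h using W.Cauchy_Schwarz w that in_W by blast
  obtain u0 where u0: "u0 \<in> K" "\<forall>h\<in>K. ip u0 h = ip w h"
    using K.riesz[OF lin bd] by blast
  have uW: "u0 \<in> W" using u0(1) by (rule in_W)
  have "w - u0 \<in> Kp"
    unfolding Kp_def using w u0(2) in_W(1) W.closed(2)[OF w uW] W.diff_left[OF _ w uW] by simp
  with u0 that[of u0 "w - u0"] show ?thesis by simp
qed

text \<open>\<open>B\<^sup>t w\<close> moved from the dual space into \<open>U\<close> by the Riesz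
  map. Representers differ by null elements, so \<open>S\<close> is not known to be linear; it is
  used only through \<open>ip (S w) v = b v w\<close>.\<close>

definition S where "S w = (SOME u. u \<in> U \<and> (\<forall>v\<in>U. ip u v = b v w))"

lemma S:
  assumes w: "w \<in> W"
  shows "S w \<in> U" "v \<in> U \<Longrightarrow> ip (S w) v = b v w"
proof -
  obtain C where "\<forall>u\<in>U. \<bar>b u w\<bar> \<le> C * N u" using b_bound_left[OF w] ..
  then have "\<bar>b u w\<bar> \<le> C * N u" if "u \<in> U" for u using that by blast
  from riesz[OF bilin_on_left[OF b_bilin w] this]
  obtain u where "u \<in> U" "\<forall>v\<in>U. ip u v = b v w" by blast
  then have "u \<in> U \<and> (\<forall>v\<in>U. ip u v = b v w)" by blast
  then have "S w \<in> U \<and> (\<forall>v\<in>U. ip (S w) v = b v w)" unfolding S_def by (rule someI)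
  then show "S w \<in> U" "v \<in> U \<Longrightarrow> ip (S w) v = b v w" by auto
qed

text \<open>Otherwise there is a sequence \<open>X\<close> in \<open>Kp\<close> of norm one with
  \<open>S (X k)\<close> tending to zero. Then \<open>b\<close> tends to zero on the differences of
  \<open>X\<close>, so \<open>b_compact\<close> makes a subsequence Cauchy. Its limit has norm one
  but is annihilated by all of \<open>U\<close>, so it lies in \<open>K\<close> as well as in
  \<open>Kp\<close> and is orthogonal to itself.\<close>

lemma S_bounded_below:
  obtains \<beta> where "\<beta> > 0" "\<And>w. w \<in> Kp \<Longrightarrow> \<beta> * N w \<le> N (S w)"
proof -
  have "\<exists>\<beta>>0. \<forall>w\<in>Kp. \<beta> * N w \<le> N (S w)"
  proof (rule ccontr)
    assume neg: "\<not> ?thesis"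
    have "\<exists>w\<in>Kp. N w = 1 \<and> N (S w) \<le> 1 / Suc k" for k
    proof -
      have "1 / real (Suc k) > 0" by simp
      then obtain w where w: "w \<in> Kp" "N (S w) < 1 / Suc k * N w" using neg not_le by metis
      have wW: "w \<in> W" using w in_W by blast
      \<comment> \<open>The strict inequality in the choice of \<open>w\<close> already excludes
        \<open>N w = 0\<close>, so \<open>w\<close> can be normalised.\<close>
      have "0 \<le> N (S w)" using S(1)[OF wW] N_nonneg by blast
      then have "0 < N w / real (Suc k)" using w(2) by simp
      then have Nw: "N w > 0" by (simp add: zero_less_divide_iff)
      define v where "v = (1 / N w) *\<^sub>R w"
      have v: "v \<in> Kp" "v \<in> W" using w Kp.closed in_W by (auto simp: v_def)
      have N1: "N v = 1" using Nw wW in_U by (simp add: v_def N_scale)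
      \<comment> \<open>\<open>S v\<close> need not be the corresponding multiple of
        \<open>S w\<close>, so the two norms are compared through \<open>b\<close>, which is
        linear.\<close>
      have "(N (S v))\<^sup>2 = ip (S v) (S v)" using S(1)[OF v(2)] by (rule N_sq)
      also have "\<dots> = b (S v) v" using S v by blast
      also have "\<dots> = (1 / N w) * b (S v) w" unfolding v_def
        using lin_on_scale[OF bilin_on_right[OF b_bilin S(1)[OF v(2)]] wW] by (simp add: v_def)
      also have "b (S v) w = ip (S w) (S v)" using S v wW by simp
      also have "(1 / N w) * ip (S w) (S v) \<le> (1 / N w) * (N (S w) * N (S v))"
        using Nw Cauchy_Schwarz[of "S w" "S v"] S wW v by (intro mult_left_mono) auto
      finally have "N (S v) * N (S v) \<le> (N (S w) / N w) * N (S v)"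
        by (simp add: power2_eq_square)
      moreover have "0 \<le> N (S v)" using S(1) v N_nonneg by blast
      ultimately have "N (S v) \<le> N (S w) / N w \<or> N (S v) = 0"
        by (metis mult_right_le_imp_le order_le_less)
      moreover have "N (S w) / N w \<le> 1 / Suc k" using w(2) Nw by (simp add: field_simps)
      moreover have "0 \<le> 1 / real (Suc k)" by simp
      ultimately have "N (S v) \<le> 1 / Suc k" by (metis order_trans)
      with v N1 show ?thesis by blast
    qed
    then obtain X where X: "\<And>k. X k \<in> Kp" "\<And>k. N (X k) = 1" "\<And>k. N (S (X k)) \<le> 1 / Suc k"
      by metis
    have XW: "X k \<in> W" "X k \<in> U" for k using X in_W in_U by auto
    obtain r :: "nat \<Rightarrow> nat" where r: "strict_mono r" and
      rc: "\<And>e. e > 0 \<Longrightarrow> \<exists>M. \<forall>i\<ge>M. \<forall>j\<ge>M.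
        (N (X (r i) - X (r j)))\<^sup>2 \<le> b (X (r i) - X (r j)) (X (r i) - X (r j)) + e"
      using b_compact[of X] XW X(2) by (metis order_refl)
    have diff: "b (X i - X j) (X i - X j) \<le> 2 * (1 / Suc i + 1 / Suc j)" for i j
    proof -
      define y where "y = X i - X j"
      have y: "y \<in> W" "y \<in> U" using XW W.closed closed by (auto simp: y_def)
      have Ny: "N y \<le> 2" using N_triangle_diff[of "X i" "X j"] XW X(2) by (simp add: y_def)
      \<comment> \<open>Here \<open>W \<subseteq> U\<close> is essential: the difference
        \<open>y\<close> itself serves as test element for both transposes.\<close>
      have "b y y = b y (X i) - b y (X j)"
        unfolding y_def by (rule lin_on_diff[OF W.subsp bilin_on_right[OF b_bilin]])
          (use XW closed in auto)
      also have "\<dots> = ip (S (X i)) y - ip (S (X j)) y" using S XW y by simp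
      also have "\<dots> \<le> N (S (X i)) * N y + N (S (X j)) * N y"
        using Cauchy_Schwarz[of "S (X i)" y] Cauchy_Schwarz[of "S (X j)" y] S XW y by auto
      also have "\<dots> \<le> (1 / Suc i) * 2 + (1 / Suc j) * 2"
        using X Ny N_nonneg y by (intro add_mono mult_mono) auto
      finally show ?thesis by (simp add: y_def)
    qed
    have Cau: "\<exists>M. \<forall>i\<ge>M. \<forall>j\<ge>M. N (X (r i) - X (r j)) \<le> e" if e: "e > 0" for e
    proof -
      have "e\<^sup>2 / 2 > 0" using e by simp
      from rc[OF this] obtain M1 where M1: "\<forall>i\<ge>M1. \<forall>j\<ge>M1. (N (X (r i) - X (r j)))\<^sup>2 \<le>
          b (X (r i) - X (r j)) (X (r i) - X (r j)) + e\<^sup>2 / 2" ..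
      \<comment> \<open>Beyond \<open>M2\<close> the \<open>b\<close>-term is at most
        \<open>4 / M2\<close>, hence at most half of \<open>e\<^sup>2\<close>; the other half is the
        error allowed by \<open>M1\<close>.\<close>
      obtain M2 where M2: "8 / e\<^sup>2 < real M2" using reals_Archimedean2 by blast
      have M2p: "real M2 > 0" using M2 e by (meson divide_pos_pos less_trans zero_less_numeral zero_less_power)
      have "N (X (r i) - X (r j)) \<le> e" if ij: "i \<ge> max M1 M2" "j \<ge> max M1 M2" for i j
      proof -
        have rij: "r i \<ge> M2" "r j \<ge> M2"
          using ij seq_suble[OF r, of i] seq_suble[OF r, of j] by simp_all
        have "1 / real (Suc (r i)) \<le> 1 / M2" "1 / real (Suc (r j)) \<le> 1 / M2"
          using rij M2p by (auto intro!: divide_left_mono)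
        then have "b (X (r i) - X (r j)) (X (r i) - X (r j)) \<le> 4 / M2"
          using diff[of "r i" "r j"] by simp
        also have "\<dots> \<le> e\<^sup>2 / 2" using M2 M2p e by (simp add: field_simps)
        finally have "(N (X (r i) - X (r j)))\<^sup>2 \<le> e\<^sup>2 / 2 + e\<^sup>2 / 2"
          using M1 ij by (smt (verit) max.boundedE)
        then have "(N (X (r i) - X (r j)))\<^sup>2 \<le> e\<^sup>2" by simp
        then show ?thesis by (rule power2_le_imp_le) (use e in simp)
      qed
      then show ?thesis by blast
    qed
    obtain w where w: "w \<in> Kp" "(\<lambda>k. N (X (r k) - w)) \<longlonglongrightarrow> 0"
      using seq_completeE[OF Kp.complete, of "\<lambda>k. X (r k)"] X(1) Cau by blast
    have wW: "w \<in> W" "w \<in> U" using w in_W in_U by auto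
    have "b v w = 0" if v: "v \<in> U" for v
    proof -
      obtain C where C: "\<forall>w\<in>W. \<bar>b v w\<bar> \<le> C * N w" using b_bound_right[OF v] by blast
      have l: "(\<lambda>k. b v (X (r k))) \<longlonglongrightarrow> b v w"
        using XW wW w(2) bilin_on_right[OF b_bilin v] C
        by (intro W.tendsto_bounded_functional[where C=C]) auto
      have "(\<lambda>k. b v (X (r k))) \<longlonglongrightarrow> 0"
      proof (rule null_comparison)
        show "\<bar>b v (X (r k))\<bar> \<le> N v * (1 / real (Suc (r k)))" for k
        proof -
          have "\<bar>b v (X (r k))\<bar> = \<bar>ip (S (X (r k))) v\<bar>" using S XW v by simp
          also have "\<dots> \<le> N (S (X (r k))) * N v" using Cauchy_Schwarz[OF S(1)[OF XW(1)] v] .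
          also have "\<dots> \<le> (1 / real (Suc (r k))) * N v"
            using X(3) N_nonneg[OF v] by (rule mult_right_mono)
          finally show ?thesis by (simp add: mult.commute)
        qed
        have "(\<lambda>k. 1 / real (Suc (r k))) \<longlonglongrightarrow> 0"
          using LIMSEQ_subseq_LIMSEQ[OF LIMSEQ_inverse_real_of_nat r]
          by (simp add: o_def inverse_eq_divide)
        then show "(\<lambda>k. N v * (1 / real (Suc (r k)))) \<longlonglongrightarrow> 0"
          by (rule tendsto_mult_right_zero)
      qed
      with l show ?thesis by (rule LIMSEQ_unique)
    qed
    then have "w \<in> K" using wW by (simp add: K_def)
    then have "N w = 0" using w by (simp add: Kp_def nrm_def)
    moreover have "N w = 1"
      using tendsto_N[of "\<lambda>k. X (r k)" w] XW wW w(2) X(2) by (simp add: LIMSEQ_const_iff)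
    ultimately show False by simp
  qed
  then show ?thesis using that by blast
qed

text \<open>Every element of \<open>Hp\<close> is the representer of some \<open>B\<^sup>t w\<close>, so \<open>w\<close> is found by minimising the
  distance of \<open>S w\<close> to it over \<open>Kp\<close>.\<close>

lemma Hp_range:
  obtains \<beta> where "\<beta> > 0" "\<And>u. u \<in> Hp \<Longrightarrow> \<exists>w\<in>W. b u w = (N u)\<^sup>2 \<and> \<beta> * N w \<le> N u"
proof -
  obtain \<beta> where \<beta>: "\<beta> > 0" "\<And>w. w \<in> Kp \<Longrightarrow> \<beta> * N w \<le> N (S w)" using S_bounded_below by blast
  note Cb = C_nonneg(2) b_bound
  have SU: "S w \<in> U" if "w \<in> Kp" for w using S in_W that by blast
  have bS: "b (S v) w = ip (S w) (S v)" if "v \<in> Kp" "w \<in> Kp" for v w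
    using S in_W that by simp
  have bSsym: "b (S v) w = b (S w) v" if "v \<in> Kp" "w \<in> Kp" for v w
    using bS[OF that] bS[OF that(2,1)] sym[of "S v" "S w"] SU that by simp
  have linq: "lin_on Kp (b (S v))" if "v \<in> Kp" for v
    using bilin_on_right[OF b_bilin SU[OF that]] in_W by (auto intro: lin_on_subset)
  \<comment> \<open>With \<open>S\<close> not known to be linear, linearity in the first slot is
    borrowed from the second by symmetry.\<close>
  have "lin_on Kp (\<lambda>v. b (S v) w)" if "w \<in> Kp" for w
    using linq[OF that] bSsym that Kp.closed by (simp add: lin_on_def)
  then have q: "bilin_on Kp Kp (\<lambda>v w. b (S v) w)" using linq by (simp add: bilin_on_def)
  have NS: "N (S w) \<le> Cb * N w" if w: "w \<in> Kp" for w
  proof -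
    have "N (S w) * N (S w) = b (S w) w" using bS[OF w w] N_sq[OF SU[OF w]] by (simp add: power2_eq_square)
    also have "\<dots> \<le> Cb * N (S w) * N w" using Cb(2)[OF SU[OF w] in_W(2)[OF w]] by simp
    finally have "N (S w) * N (S w) \<le> (Cb * N w) * N (S w)" by (simp add: mult_ac)
    then show ?thesis using N_nonneg[OF SU[OF w]] Cb(1) Kp.N_nonneg[OF w]
      by (metis mult_nonneg_nonneg mult_right_le_imp_le order_le_less)
  qed
  have qle: "b (S w) w \<le> Cb\<^sup>2 * ip w w" if w: "w \<in> Kp" for w
    using power_mono[OF NS[OF w] N_nonneg[OF SU[OF w]], of 2] bS[OF w w] N_sq[OF SU[OF w]] Kp.N_sq[OF w]
    by (simp add: power_mult_distrib)
  have qge: "\<beta>\<^sup>2 * ip w w \<le> b (S w) w" if w: "w \<in> Kp" for w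
    using power_mono[OF \<beta>(2)[OF w], of 2] bS[OF w w] N_sq[OF SU[OF w]] Kp.N_sq[OF w] \<beta>(1)
      Kp.N_nonneg[OF w] by (simp add: power_mult_distrib)
  have "\<exists>w\<in>W. b u w = (N u)\<^sup>2 \<and> \<beta> * N w \<le> N u" if u: "u \<in> Hp" for u
  proof -
    have uU: "u \<in> U" using u in_U by blast
    have lin: "lin_on Kp (b u)" using bilin_on_right[OF b_bilin uU] in_W by (auto intro: lin_on_subset)
    have bd: "\<bar>b u w\<bar> \<le> (Cb * N u) * N w" if "w \<in> Kp" for w using Cb(2)[OF uU in_W(2)[OF that]] .
    have "\<beta>\<^sup>2 > 0" using \<beta>(1) by simp
    \<comment> \<open>\<open>b (S w) v = b u v\<close> is the normal equation of the minimisation: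
      it says that \<open>u - S w\<close> is orthogonal to every \<open>S v\<close> with
      \<open>v\<close> in \<open>Kp\<close>.\<close>
    from Kp.lax_milgram[OF q bSsym qle this qge lin bd]
    obtain w where w: "w \<in> Kp" and eq: "\<forall>v\<in>Kp. b (S w) v = b u v" by blast
    have wW: "w \<in> W" using w in_W by blast
    have SwU: "S w \<in> U" using SU w .
    \<comment> \<open>On the \<open>K\<close>-part of \<open>v\<close> every \<open>b\<close>-value
      vanishes, so the normal equations on \<open>Kp\<close> extend to \<open>W\<close> and the
      residual lies in \<open>H\<close>.\<close>
    have "b (u - S w) v = 0" if v: "v \<in> W" for v
    proof -
      obtain k v' where kv: "k \<in> K" "v' \<in> Kp" "v = k + v'" using split_W[OF v] .
      have dU: "u - S w \<in> U" using uU SwU closed by blast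
      have "b (u - S w) v = b (u - S w) k + b (u - S w) v'"
        unfolding kv(3) using kv in_W by (intro lin_on_add[OF bilin_on_right[OF b_bilin dU]]) auto
      also have "b (u - S w) k = 0" using kv(1) dU by (simp add: K_def)
      also have "b (u - S w) v' = b u v' - b (S w) v'"
        using kv in_W uU SwU by (intro lin_on_diff[OF subsp bilin_on_left[OF b_bilin]]) auto
      finally show ?thesis using eq kv by simp
    qed
    then have dH: "u - S w \<in> H" using uU SwU closed by (simp add: H_def)
    \<comment> \<open>The residual is also orthogonal to \<open>H\<close>, hence to itself:
      \<open>u\<close> is so by assumption, and \<open>S w\<close> because \<open>b h w = 0\<close>
      for \<open>h\<close> in \<open>H\<close>.\<close>
    have "ip (u - S w) (u - S w) = ip u (u - S w) - ip (S w) (u - S w)"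
      using uU SwU closed by (simp add: diff_left)
    also have "ip u (u - S w) = 0" using u dH by (simp add: Hp_def)
    also have "ip (S w) (u - S w) = b (u - S w) w" using S wW uU SwU closed by simp
    also have "\<dots> = 0" using dH wW by (simp add: H_def)
    finally have N0: "N (u - S w) = 0" by (simp add: nrm_def)
    have "b u w = ip (S w) u" using S wW uU by simp
    also have "\<dots> = ip u u - ip (u - S w) u" using uU SwU by (simp add: diff_left)
    also have "ip (u - S w) u = 0" using N_zero_left[OF N0] uU SwU closed by blast
    finally have 1: "b u w = (N u)\<^sup>2" using uU by (simp add: N_sq)
    have "N (S w) \<le> N (S w - u) + N u" using N_triangle[of "S w - u" u] uU SwU closed by simp
    also have "N (S w - u) = 0" using N0 N_diff_commute uU SwU by simp
    finally have "\<beta> * N w \<le> N u" using \<beta>(2)[OF w] by simp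
    with 1 wW show ?thesis by blast
  qed
  with \<beta>(1) that show ?thesis by blast
qed


section \<open>Elimination of the first unknown\<close>

lemma solve_a:
  assumes f: "lin_on W f" "\<And>v. v \<in> W \<Longrightarrow> \<bar>f v\<bar> \<le> C * N v"
  shows "\<exists>w\<in>W. \<forall>v\<in>W. a w v = f v"
proof -
  note Ca = a_bound
  have "a v v \<le> Ca * ip v v" if "v \<in> W" for v
    using Ca[OF that that] W.N_sq[OF that] by (simp add: power2_eq_square mult.assoc)
  moreover have "\<alpha> * ip v v \<le> a v v" if "v \<in> W" for v
    using a_coercive(2)[OF that] W.N_sq[OF that] by simp
  ultimately show ?thesis using W.lax_milgram[OF a_bilin a_sym _ a_coercive(1) _ f] by blast
qed

text \<open>A version of the operator \<open>A\<^sup>-\<^sup>1 B\<close>, determined up to null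
  elements.\<close>

definition T where "T u = (SOME w. w \<in> W \<and> (\<forall>v\<in>W. a w v = b u v))"

lemma T:
  assumes u: "u \<in> U"
  shows "T u \<in> W" "v \<in> W \<Longrightarrow> a (T u) v = b u v"
proof -
  obtain C where "\<forall>w\<in>W. \<bar>b u w\<bar> \<le> C * N w" using b_bound_right[OF u] ..
  then have "\<bar>b u w\<bar> \<le> C * N w" if "w \<in> W" for w using that by blast
  from solve_a[OF bilin_on_right[OF b_bilin u] this]
  have "\<exists>w. w \<in> W \<and> (\<forall>v\<in>W. a w v = b u v)" by blast
  then have "T u \<in> W \<and> (\<forall>v\<in>W. a (T u) v = b u v)" unfolding T_def by (rule someI_ex)
  then show "T u \<in> W" "v \<in> W \<Longrightarrow> a (T u) v = b u v" by auto
qed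

text \<open>The Schur complement obtained by eliminating the first unknown.\<close>

definition Q where "Q u v = b v (T u)"

lemma Q_eq: "u \<in> U \<Longrightarrow> v \<in> U \<Longrightarrow> Q u v = a (T u) (T v)"
  unfolding Q_def using T(2)[of v "T u"] T(1) a_sym[of "T v" "T u"] by simp

lemma Q_sym: "u \<in> U \<Longrightarrow> v \<in> U \<Longrightarrow> Q u v = Q v u"
  using Q_eq a_sym T(1) by simp

text \<open>Linearity in the second argument is that of \<open>b\<close>; in the first it comes by
  symmetry, since \<open>T\<close> is a mere choice.\<close>

lemma Q_bilin: "bilin_on U U Q"
proof -
  have 1: "lin_on U (Q u)" if "u \<in> U" for u
    using bilin_on_left[OF b_bilin T(1)[OF that]] by (simp add: Q_def[abs_def])
  have "lin_on U (\<lambda>u. Q u v)" if v: "v \<in> U" for v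
    using 1[OF v] Q_sym[OF v] closed unfolding lin_on_def by metis
  with 1 show ?thesis by (simp add: bilin_on_def)
qed

lemma Q_H: "h \<in> H \<Longrightarrow> u \<in> U \<Longrightarrow> Q u h = 0"
  using T(1) by (simp add: Q_def H_def)

definition Ct where "Ct = Cb / \<alpha>"

lemma Ct: "Ct \<ge> 0" "u \<in> U \<Longrightarrow> N (T u) \<le> Ct * N u"
proof -
  show 0: "Ct \<ge> 0" using C_nonneg(2) a_coercive(1) by (simp add: Ct_def)
  assume u: "u \<in> U"
  show "N (T u) \<le> Ct * N u"
  proof (rule le_of_sq_le)
    have "\<alpha> * (N (T u))\<^sup>2 \<le> b u (T u)" using a_coercive(2)[OF T(1)[OF u]] T[OF u] by simp
    also have "\<dots> \<le> Cb * N u * N (T u)" using b_bound[OF u T(1)[OF u]] by simp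
    finally show "N (T u) * N (T u) \<le> Ct * N u * N (T u)"
      using a_coercive(1) by (simp add: Ct_def field_simps power2_eq_square)
  qed (use 0 W.N_nonneg T(1)[OF u] N_nonneg[OF u] in auto)
qed

lemma Q_bound:
  assumes u: "u \<in> U" and v: "v \<in> U"
  shows "\<bar>Q u v\<bar> \<le> Cb * Ct * N u * N v"
proof -
  have "\<bar>Q u v\<bar> \<le> Cb * N v * N (T u)" using b_bound[OF v T(1)[OF u]] by (simp add: Q_def)
  also have "\<dots> \<le> Cb * N v * (Ct * N u)"
    using Ct(2)[OF u] N_nonneg[OF v] C_nonneg(2) by (intro mult_left_mono) auto
  finally show ?thesis by (simp add: mult_ac)
qed

text \<open>An inf-sup argument. The \<open>w\<close> from \<open>Hp_range\<close> gives
  \<open>(N u)\<^sup>2 = b u w = a (T u) w\<close>, where \<open>N w\<close> is bounded by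
  \<open>N u\<close>; so \<open>N (T u)\<close> dominates a multiple of \<open>N u\<close>, and
  coercivity of \<open>a\<close> at \<open>T u\<close> carries this over to
  \<open>Q u u = a (T u) (T u)\<close>.\<close>

lemma Q_coercive: obtains m where "m > 0" "\<And>u. u \<in> Hp \<Longrightarrow> m * (N u)\<^sup>2 \<le> Q u u"
proof -
  obtain \<beta> where \<beta>: "\<beta> > 0" "\<And>u. u \<in> Hp \<Longrightarrow> \<exists>w\<in>W. b u w = (N u)\<^sup>2 \<and> \<beta> * N w \<le> N u"
    by (rule Hp_range) blast
  note Ca = C_nonneg(1) a_bound
  \<comment> \<open>The summand 1 avoids a division by zero, as \<open>Ca\<close> is only known to
    be nonnegative.\<close>
  define c where "c = \<beta> / (Ca + 1)"
  have c: "c > 0" using \<beta>(1) Ca(1) by (simp add: c_def)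
  have "\<alpha> * c\<^sup>2 * (N u)\<^sup>2 \<le> Q u u" if u: "u \<in> Hp" for u
  proof -
    have uU: "u \<in> U" using u by (rule in_U)
    obtain w where w: "w \<in> W" "b u w = (N u)\<^sup>2" "\<beta> * N w \<le> N u" using \<beta>(2)[OF u] by blast
    have NT: "0 \<le> N (T u)" using W.N_nonneg T(1)[OF uU] by blast
    have "N u \<le> (Ca / \<beta>) * N (T u)"
    proof (rule le_of_sq_le)
      have "N u * N u = a (T u) w" using w T[OF uU] by (simp add: power2_eq_square)
      also have "\<dots> \<le> Ca * N (T u) * N w" using Ca(2)[OF T(1)[OF uU] w(1)] by simp
      also have "\<dots> \<le> Ca * N (T u) * (N u / \<beta>)"
        using w(3) \<beta>(1) Ca(1) NT by (intro mult_left_mono) (auto simp: field_simps)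
      finally show "N u * N u \<le> Ca / \<beta> * N (T u) * N u" by simp
    qed (use N_nonneg uU NT Ca \<beta> in auto)
    also have "\<dots> \<le> (1 / c) * N (T u)"
      using NT \<beta>(1) by (intro mult_right_mono) (auto simp: c_def divide_right_mono)
    finally have "c * N u \<le> N (T u)" using c by (simp add: field_simps)
    then have "(c * N u)\<^sup>2 \<le> (N (T u))\<^sup>2" using c N_nonneg[OF uU] by (intro power_mono) auto
    then have "\<alpha> * (c * N u)\<^sup>2 \<le> \<alpha> * (N (T u))\<^sup>2" using a_coercive(1) by simp
    also have "\<dots> \<le> Q u u" using a_coercive(2)[OF T(1)[OF uU]] Q_eq[OF uU uU] by simp
    finally show ?thesis by (simp add: power_mult_distrib)
  qed
  then show ?thesis using that[of "\<alpha> * c\<^sup>2"] c a_coercive(1) by simp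
qed

lemma Q_split: "u0 \<in> H \<Longrightarrow> u1 \<in> Hp \<Longrightarrow> v \<in> U \<Longrightarrow> Q (u0 + u1) v = Q u1 v"
  using lin_on_add[OF bilin_on_left[OF Q_bilin], of v u0 u1] Q_H[of u0 v] Q_sym[of u0 v] in_U by simp

text \<open>\<open>Q\<close> controls the part \<open>u1\<close>, while \<open>D\<close> is coercive
  only on \<open>H\<close>; the part \<open>u0\<close> is therefore recovered from
  \<open>D u u\<close> at the price of \<open>D u1 u1\<close>, which \<open>Q\<close> absorbs. The
  constant decays linearly with \<kappa>, so it is good for solvability at fixed \<kappa>
  only.\<close>

lemma penalised_coercive:
  assumes \<kappa>: "\<kappa> > 0"
  obtains c where "c > 0" "\<And>u. u \<in> U \<Longrightarrow> c * (N u)\<^sup>2 \<le> Q u u + \<kappa> * D u u"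
proof -
  obtain m where m: "m > 0" "\<And>u. u \<in> Hp \<Longrightarrow> m * (N u)\<^sup>2 \<le> Q u u" by (rule Q_coercive) blast
  note Cd = C_nonneg(3) D_bound
  \<comment> \<open>The first term is the coefficient of \<open>\<kappa> * D u u\<close>, the
    bracket that of \<open>Q u u\<close>. Each 4 combines the factor 2 of splitting
    \<open>(N u)\<^sup>2\<close> with the factor 2 of splitting \<open>D u0 u0\<close>; the term
    \<open>2 / m\<close> accounts for \<open>u1\<close> itself.\<close>
  define L where "L = 4 / (\<kappa> * \<delta>) + (4 * Cd / (m * \<delta>) + 2 / m)"
  have L: "L > 0" using \<kappa> D_coercive(1) m(1) Cd(1) by (auto simp: L_def intro!: add_pos_nonneg)
  have "(1 / L) * (N u)\<^sup>2 \<le> Q u u + \<kappa> * D u u" if u: "u \<in> U" for u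
  proof -
    obtain u0 u1 where s: "u0 \<in> H" "u1 \<in> Hp" "u = u0 + u1" using split_U[OF u] by blast
    have sU: "u0 \<in> U" "u1 \<in> U" using s in_U by auto
    have Nu: "(N u)\<^sup>2 \<le> 2 * (N u0)\<^sup>2 + 2 * (N u1)\<^sup>2"
    proof -
      have "(N u)\<^sup>2 \<le> (N u0 + N u1)\<^sup>2"
        using N_triangle[OF sU] N_nonneg[OF u] s(3) by (intro power_mono) auto
      also have "\<dots> \<le> 2 * (N u0)\<^sup>2 + 2 * (N u1)\<^sup>2"
        using sum_squares_bound[of "N u0" "N u1"] by (simp add: power2_sum)
      finally show ?thesis .
    qed
    have Quu: "Q u u = Q u1 u1"
      using Q_split[OF s(1,2) u] Q_split[OF s(1,2) sU(2)] Q_sym[OF sU(2) u] s(3) by simp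
    have x1: "(N u1)\<^sup>2 \<le> Q u u / m" using m(2)[OF s(2)] m(1) Quu by (simp add: field_simps)
    have "\<delta> * (N u0)\<^sup>2 \<le> D u0 u0" using D_coercive(2) s(1) by (simp add: H_def)
    also have "\<dots> \<le> 2 * D u u + 2 * D u1 u1"
    proof -
      \<comment> \<open>Half of the parallelogram identity: adding this nonnegative value to
        \<open>D (u - u1) (u - u1)\<close> removes the cross terms.\<close>
      have "0 \<le> D (u + u1) (u + u1)" using u sU closed by (intro D_pos) auto
      also have "\<dots> = D u u + 2 * D u u1 + D u1 u1"
        using lin_on_add[OF bilin_on_left[OF D_bilin]] lin_on_add[OF bilin_on_right[OF D_bilin]]
          u sU closed(1)[OF u sU(2)] D_sym[OF u sU(2)] by simp
      finally have 1: "0 \<le> D u u + 2 * D u u1 + D u1 u1" .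
      have "u0 = u - u1" using s(3) by simp
      then have "D u0 u0 = D (u - u1) (u - u1)" by simp
      also have "\<dots> = D u u - 2 * D u u1 + D u1 u1"
        using lin_on_diff[OF subsp bilin_on_left[OF D_bilin]] lin_on_diff[OF subsp bilin_on_right[OF D_bilin]]
          u sU closed(2)[OF u sU(2)] D_sym[OF u sU(2)] by simp
      finally show ?thesis using 1 by simp
    qed
    also have "D u1 u1 \<le> Cd * (N u1)\<^sup>2"
      using Cd(2)[OF sU(2) sU(2)] by (simp add: power2_eq_square mult.assoc)
    also have "\<dots> \<le> Cd * (Q u u / m)" using x1 Cd(1) by (rule mult_left_mono)
    finally have "\<delta> * (N u0)\<^sup>2 \<le> 2 * D u u + 2 * (Cd * (Q u u / m))" by simp
    then have x0: "(N u0)\<^sup>2 \<le> 2 * D u u / \<delta> + 2 * (Cd * (Q u u / m)) / \<delta>"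
      using D_coercive(1) by (simp add: field_simps)
    have Q0: "0 \<le> Q u u" using x1 m(1) zero_le_power2[of "N u1"]
      by (meson order_trans zero_le_divide_iff not_less)
    have D0: "0 \<le> \<kappa> * D u u" using D_pos[OF u] \<kappa> by simp
    have "(N u)\<^sup>2 \<le> 2 * (2 * D u u / \<delta> + 2 * (Cd * (Q u u / m)) / \<delta>) + 2 * (Q u u / m)"
      using Nu x0 x1 by simp
    also have "\<dots> = 4 / (\<kappa> * \<delta>) * (\<kappa> * D u u) + (4 * Cd / (m * \<delta>) + 2 / m) * Q u u"
      using \<kappa> D_coercive(1) m(1) by (simp add: field_simps)
    also have "\<dots> \<le> L * (\<kappa> * D u u) + L * Q u u"
      using Q0 D0 \<kappa> D_coercive(1) m(1) Cd(1)
      by (intro add_mono mult_right_mono) (auto simp: L_def)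
    finally have "(N u)\<^sup>2 \<le> L * (Q u u + \<kappa> * D u u)" by (simp add: algebra_simps)
    then show ?thesis using L by (simp add: field_simps)
  qed
  then show ?thesis using that[of "1 / L"] L by simp
qed

section \<open>Solvability and uniqueness of the penalised problem\<close>

definition penalised where
  "penalised f d \<kappa> w u \<longleftrightarrow> w \<in> W \<and> u \<in> U \<and> (\<forall>v\<in>W. a w v + b u v = f v) \<and>
     (\<forall>v\<in>U. b v w - \<kappa> * D u v = - \<kappa> * d v)"

definition mixed where
  "mixed f w u \<longleftrightarrow> w \<in> W \<and> u \<in> Hp \<and> (\<forall>v\<in>W. a w v + b u v = f v) \<and> (\<forall>v\<in>Hp. b v w = 0)"

text \<open>Converts every condition on \<open>b v w\<close> into one on \<open>u\<close> alone,
  with \<open>F\<close> solving the first equation for \<open>u = 0\<close>. Testing with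
  \<open>T v\<close> avoids the substitution \<open>w = F - T u\<close>, which is true only up to
  null elements.\<close>

lemma eliminate:
  assumes "w \<in> W" "u \<in> U" "\<forall>v\<in>W. a w v + b u v = f v" and F: "F \<in> W" "\<forall>v\<in>W. a F v = f v"
    and v: "v \<in> U"
  shows "b v w = b v F - Q u v"
proof -
  have Tv: "T v \<in> W" using T(1)[OF v] .
  have "b v w = a w (T v)" using T(2)[OF v assms(1)] a_sym[OF assms(1) Tv] by simp
  also have "\<dots> = a F (T v) - b u (T v)" using assms(3) F(2) Tv by (simp add: eq_diff_eq)
  also have "\<dots> = b v F - Q v u" using T(2)[OF v F(1)] a_sym[OF F(1) Tv] by (simp add: Q_def)
  finally show ?thesis using Q_sym[OF v assms(2)] by simp
qed

lemma eliminate_back: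
  assumes u: "u \<in> U" and F: "F \<in> W" "\<forall>v\<in>W. a F v = f v"
  shows "F - T u \<in> W" "\<forall>v\<in>W. a (F - T u) v + b u v = f v" "v \<in> U \<Longrightarrow> b v (F - T u) = b v F - Q u v"
proof -
  show 1: "F - T u \<in> W" using W.closed(2)[OF F(1) T(1)[OF u]] .
  show 2: "\<forall>v\<in>W. a (F - T u) v + b u v = f v"
    using lin_on_diff[OF W.subsp bilin_on_left[OF a_bilin] F(1) T(1)[OF u]] F(2) T(2)[OF u] by simp
  show "v \<in> U \<Longrightarrow> b v (F - T u) = b v F - Q u v" by (rule eliminate[OF 1 u 2 F])
qed

lemma penalised_exists:
  assumes \<kappa>: "\<kappa> > 0" and f: "lin_on W f" "\<And>v. v \<in> W \<Longrightarrow> \<bar>f v\<bar> \<le> Cf * N v"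
    and d: "lin_on U d" "\<And>v. v \<in> U \<Longrightarrow> \<bar>d v\<bar> \<le> Cg * N v"
  shows "\<exists>w u. penalised f d \<kappa> w u"
proof -
  obtain F where F: "F \<in> W" "\<forall>v\<in>W. a F v = f v" using solve_a[OF f] by blast
  obtain c where c: "c > 0" "\<And>u. u \<in> U \<Longrightarrow> c * (N u)\<^sup>2 \<le> Q u u + \<kappa> * D u u"
    by (rule penalised_coercive[OF \<kappa>]) blast
  note Cd = D_bound
  obtain Cl where Cl: "\<forall>u\<in>U. \<bar>b u F\<bar> \<le> Cl * N u" using b_bound_left[OF F(1)] ..
  have "\<exists>u\<in>U. \<forall>v\<in>U. Q u v + \<kappa> * D u v = b v F + \<kappa> * d v"
  proof (rule lax_milgram)
    show "bilin_on U U (\<lambda>u v. Q u v + \<kappa> * D u v)" by (rule bilin_on_sum[OF Q_bilin D_bilin])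
    show "Q u v + \<kappa> * D u v = Q v u + \<kappa> * D v u" if "u \<in> U" "v \<in> U" for u v
      using Q_sym[OF that] D_sym[OF that] by simp
    show "Q v v + \<kappa> * D v v \<le> (Cb * Ct + \<kappa> * Cd) * ip v v" if v: "v \<in> U" for v
    proof -
      have "\<kappa> * D v v \<le> \<kappa> * (Cd * N v * N v)" using Cd[OF v v] \<kappa> by (intro mult_left_mono) auto
      then have "Q v v + \<kappa> * D v v \<le> Cb * Ct * N v * N v + \<kappa> * (Cd * N v * N v)"
        by (rule add_mono[OF abs_le_D1[OF Q_bound[OF v v]]])
      also have "\<dots> = (Cb * Ct + \<kappa> * Cd) * (N v)\<^sup>2" by (simp add: algebra_simps power2_eq_square)
      finally show ?thesis using N_sq[OF v] by simp
    qed
    show "c * ip v v \<le> Q v v + \<kappa> * D v v" if "v \<in> U" for v using c(2)[OF that] N_sq[OF that] by simp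
    show "lin_on U (\<lambda>v. b v F + \<kappa> * d v)"
      using bilin_on_left[OF b_bilin F(1)] d(1) by (simp add: lin_on_def algebra_simps)
    show "\<bar>b v F + \<kappa> * d v\<bar> \<le> (Cl + \<kappa> * Cg) * N v" if v: "v \<in> U" for v
    proof -
      have "\<bar>b v F + \<kappa> * d v\<bar> \<le> \<bar>b v F\<bar> + \<kappa> * \<bar>d v\<bar>"
        using abs_triangle_ineq[of "b v F" "\<kappa> * d v"] \<kappa> by (simp add: abs_mult)
      also have "\<dots> \<le> Cl * N v + \<kappa> * (Cg * N v)"
        using Cl v d(2)[OF v] \<kappa> by (intro add_mono mult_left_mono) auto
      finally show ?thesis by (simp add: algebra_simps)
    qed
  qed (use c in simp)
  then obtain u where u: "u \<in> U" "\<forall>v\<in>U. Q u v + \<kappa> * D u v = b v F + \<kappa> * d v" by blast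
  have "b v (F - T u) - \<kappa> * D u v = - \<kappa> * d v" if v: "v \<in> U" for v
    using eliminate_back(3)[OF u(1) F v] u(2)[rule_format, OF v] by simp
  then have "penalised f d \<kappa> (F - T u) u"
    unfolding penalised_def using eliminate_back(1,2)[OF u(1) F] u(1) by simp
  then show ?thesis by blast
qed

text \<open>Subtracting the two first equations cancels \<open>f\<close>, so \<open>w\<close>
  depends on \<open>u\<close> in a Lipschitz way. Uniqueness and the error estimate need to be
  proved for the second component only.\<close>

lemma first_component_le:
  assumes w: "w \<in> W" "w' \<in> W" and u: "u \<in> U" "u' \<in> U"
    and eq: "\<forall>v\<in>W. a w v + b u v = f v" "\<forall>v\<in>W. a w' v + b u' v = f v"
  shows "N (w - w') \<le> Ct * N (u - u')"
proof (rule le_of_sq_le)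
  have wW: "w - w' \<in> W" using W.closed(2)[OF w] .
  have uU: "u - u' \<in> U" using closed(2)[OF u] .
  have "\<alpha> * (N (w - w'))\<^sup>2 \<le> a (w - w') (w - w')" using a_coercive(2)[OF wW] .
  also have "\<dots> = a w (w - w') - a w' (w - w')"
    using lin_on_diff[OF W.subsp bilin_on_left[OF a_bilin wW] w] .
  also have "\<dots> = - (b u (w - w') - b u' (w - w'))" using eq[rule_format, OF wW] by simp
  also have "\<dots> = - b (u - u') (w - w')"
    using lin_on_diff[OF subsp bilin_on_left[OF b_bilin wW] u] by simp
  also have "\<dots> \<le> Cb * N (u - u') * N (w - w')" using b_bound[OF uU wW] by simp
  finally show "N (w - w') * N (w - w') \<le> Ct * N (u - u') * N (w - w')"
    using a_coercive(1) by (simp add: Ct_def field_simps power2_eq_square)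
  show "0 \<le> N (w - w')" using W.N_nonneg[OF wW] .
  show "0 \<le> Ct * N (u - u')" using Ct(1) N_nonneg[OF uU] by simp
qed

lemma penalised_unique:
  assumes \<kappa>: "\<kappa> > 0" and f: "lin_on W f" "\<And>v. v \<in> W \<Longrightarrow> \<bar>f v\<bar> \<le> Cf * N v"
    and p: "penalised f d \<kappa> w u" "penalised f d \<kappa> w' u'"
  shows "N (w - w') = 0" "N (u - u') = 0"
proof -
  obtain F where F: "F \<in> W" "\<forall>v\<in>W. a F v = f v" using solve_a[OF f] by blast
  have wu: "w \<in> W" "w' \<in> W" "u \<in> U" "u' \<in> U" "\<forall>v\<in>W. a w v + b u v = f v"
     "\<forall>v\<in>W. a w' v + b u' v = f v" using p by (auto simp: penalised_def)
  have e: "u - u' \<in> U" using closed(2) wu by blast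
  have "Q u v + \<kappa> * D u v = b v F + \<kappa> * d v" "Q u' v + \<kappa> * D u' v = b v F + \<kappa> * d v" if v: "v \<in> U" for v
  proof -
    have "b v w - \<kappa> * D u v = - \<kappa> * d v" "b v w' - \<kappa> * D u' v = - \<kappa> * d v"
      using p v by (auto simp: penalised_def)
    then show "Q u v + \<kappa> * D u v = b v F + \<kappa> * d v" "Q u' v + \<kappa> * D u' v = b v F + \<kappa> * d v"
      using eliminate[OF wu(1,3,5) F v] eliminate[OF wu(2,4,6) F v] by linarith+
  qed
  from this[OF e] have "Q (u - u') (u - u') + \<kappa> * D (u - u') (u - u') = 0"
    unfolding lin_on_diff[OF subsp bilin_on_left[OF Q_bilin e] wu(3,4)]
      lin_on_diff[OF subsp bilin_on_left[OF D_bilin e] wu(3,4)] right_diff_distrib by linarith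
  moreover obtain c where c: "c > 0" "\<And>u. u \<in> U \<Longrightarrow> c * (N u)\<^sup>2 \<le> Q u u + \<kappa> * D u u"
    by (rule penalised_coercive[OF \<kappa>]) blast
  ultimately have "c * (N (u - u'))\<^sup>2 \<le> 0" using e by metis
  then show 0: "N (u - u') = 0" using c(1) by (simp add: mult_le_0_iff)
  show "N (w - w') = 0"
    using first_component_le[OF wu] 0 W.N_nonneg[OF W.closed(2)[OF wu(1,2)]] by simp
qed

text \<open>Pythagoras: the two parts are orthogonal, so a sum of two nonnegative squares vanishes.
  This carries uniqueness of \<open>u\<close> over to its components in \<open>H\<close> and
  \<open>Hp\<close>.\<close>

lemma N_split_zero:
  assumes "u0 \<in> H" "u0' \<in> H" "u1 \<in> Hp" "u1' \<in> Hp" and 0: "N ((u0 + u1) - (u0' + u1')) = 0"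
  shows "N (u0 - u0') = 0" "N (u1 - u1') = 0"
proof -
  define e0 e1 where "e0 = u0 - u0'" and "e1 = u1 - u1'"
  have e: "e0 \<in> H" "e1 \<in> Hp" using H.closed(2) Hp.closed(2) assms by (auto simp: e0_def e1_def)
  have eU: "e0 \<in> U" "e1 \<in> U" using e in_U by auto
  have "(u0 + u1) - (u0' + u1') = e0 + e1" by (simp add: e0_def e1_def)
  then have "ip (e0 + e1) (e0 + e1) = 0" using 0 by (simp add: nrm_def)
  then have "ip e0 e0 + ip e1 e1 = 0"
    using ip_H_Hp[OF e(2,1)] eU closed(1)[OF eU] add_left[OF _ eU] add_right[OF _ eU] by simp
  then have "ip e0 e0 = 0" "ip e1 e1 = 0" using pos[OF eU(1)] pos[OF eU(2)] by auto
  then show "N (u0 - u0') = 0" "N (u1 - u1') = 0" by (simp_all add: nrm_def e0_def e1_def)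
qed

section \<open>Well-posedness of the two limit problems\<close>

lemma mixed_exists:
  obtains C where "C \<ge> 0" "\<And>f Cf. lin_on W f \<Longrightarrow> Cf \<ge> 0 \<Longrightarrow> \<forall>v\<in>W. \<bar>f v\<bar> \<le> Cf * N v \<Longrightarrow>
    \<exists>w u. mixed f w u \<and> N w + N u \<le> C * Cf"
proof -
  obtain m where m: "m > 0" "\<And>u. u \<in> Hp \<Longrightarrow> m * (N u)\<^sup>2 \<le> Q u u" by (rule Q_coercive) blast
  note Cb = C_nonneg(2) b_bound
  \<comment> \<open>Fixed before \<open>f\<close>, so that the bound is uniform in the data.
    \<open>1 / \<alpha>\<close> bounds \<open>F\<close>, \<open>Cb / (m * \<alpha>)\<close> bounds
    \<open>u\<close>, and the factor \<open>1 + Ct\<close> counts \<open>u\<close> together with its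
    contribution \<open>T u\<close> to the first component.\<close>
  define C where "C = 1 / \<alpha> + (1 + Ct) * (Cb / (m * \<alpha>))"
  have C: "C \<ge> 0" using a_coercive(1) Ct(1) Cb(1) m(1) by (simp add: C_def)
  have "\<exists>w u. mixed f w u \<and> N w + N u \<le> C * Cf"
    if f: "lin_on W f" and Cf: "Cf \<ge> 0" "\<forall>v\<in>W. \<bar>f v\<bar> \<le> Cf * N v" for f Cf
  proof -
    obtain F where F: "F \<in> W" "\<forall>v\<in>W. a F v = f v" using solve_a[OF f] Cf by blast
    have NF: "N F \<le> Cf / \<alpha>"
    proof (rule le_of_sq_le)
      have "\<alpha> * (N F)\<^sup>2 \<le> f F" using a_coercive(2) F by metis
      also have "\<dots> \<le> Cf * N F" using Cf F by (auto simp: abs_le_iff)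
      finally show "N F * N F \<le> Cf / \<alpha> * N F"
        using a_coercive(1) by (simp add: field_simps power2_eq_square)
    qed (use W.N_nonneg F Cf a_coercive in auto)
    have FU: "\<bar>b v F\<bar> \<le> (Cb * N F) * N v" if "v \<in> Hp" for v
      using Cb(2)[OF in_U(3)[OF that] F(1)] by (simp add: mult_ac)
    have HpU: "Hp \<subseteq> U" using in_U by blast
    have "\<exists>u\<in>Hp. \<forall>v\<in>Hp. Q u v = b v F"
    proof (rule Hp.lax_milgram)
      show "bilin_on Hp Hp Q" using bilin_on_subset[OF Q_bilin HpU HpU] .
      show "Q u v = Q v u" if "u \<in> Hp" "v \<in> Hp" for u v using Q_sym[OF in_U(3) in_U(3)] that .
      show "Q v v \<le> Cb * Ct * ip v v" if "v \<in> Hp" for v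
        using Q_bound[OF in_U(3) in_U(3), OF that that] Hp.N_sq[OF that] by (simp add: power2_eq_square mult.assoc)
      show "m * ip v v \<le> Q v v" if "v \<in> Hp" for v using m(2)[OF that] Hp.N_sq[OF that] by simp
      show "lin_on Hp (\<lambda>v. b v F)" using lin_on_subset[OF bilin_on_left[OF b_bilin F(1)] HpU] .
    qed (use m(1) FU in auto)
    then obtain u where u: "u \<in> Hp" "\<forall>v\<in>Hp. Q u v = b v F" by blast
    have uU: "u \<in> U" using u(1) by (rule in_U)
    have Nu: "N u \<le> Cb / m * N F"
    proof (rule le_of_sq_le)
      have "m * (N u)\<^sup>2 \<le> b u F" using m(2) u by metis
      also have "\<dots> \<le> Cb * N F * N u" using FU[OF u(1)] by simp
      finally show "N u * N u \<le> Cb / m * N F * N u" using m(1) by (simp add: field_simps power2_eq_square)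
    qed (use N_nonneg W.N_nonneg uU F Cb m in auto)
    have "mixed f (F - T u) u"
      unfolding mixed_def using eliminate_back[OF uU F] u in_U(3) by auto
    moreover have "N (F - T u) + N u \<le> C * Cf"
    proof -
      have "N (F - T u) + N u \<le> N F + (1 + Ct) * N u"
        using W.N_triangle_diff[OF F(1) T(1)[OF uU]] Ct(2)[OF uU] by (simp add: algebra_simps)
      also have "\<dots> \<le> N F + (1 + Ct) * (Cb / m * N F)"
        using Nu Ct(1) by (intro add_left_mono mult_left_mono) auto
      also have "\<dots> = (1 + (1 + Ct) * (Cb / m)) * N F" by (simp add: algebra_simps add_divide_distrib)
      also have "\<dots> \<le> (1 + (1 + Ct) * (Cb / m)) * (Cf / \<alpha>)"
        using NF Ct(1) Cb(1) m(1) by (intro mult_left_mono) auto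
      also have "\<dots> = C * Cf" using m(1) a_coercive(1) by (simp add: C_def field_simps)
      finally show ?thesis .
    qed
    ultimately show ?thesis by blast
  qed
  with C that show ?thesis by blast
qed

lemma mixed_unique:
  assumes f: "lin_on W f" "\<And>v. v \<in> W \<Longrightarrow> \<bar>f v\<bar> \<le> Cf * N v" and p: "mixed f w u" "mixed f w' u'"
  shows "N (w - w') = 0" "N (u - u') = 0"
proof -
  obtain F where F: "F \<in> W" "\<forall>v\<in>W. a F v = f v" using solve_a[OF f] by blast
  have wu: "w \<in> W" "w' \<in> W" "u \<in> U" "u' \<in> U" "\<forall>v\<in>W. a w v + b u v = f v"
     "\<forall>v\<in>W. a w' v + b u' v = f v" using p in_U(3) by (auto simp: mixed_def)
  have e: "u - u' \<in> Hp" using Hp.closed(2) p by (auto simp: mixed_def)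
  have eU: "u - u' \<in> U" using e by (rule in_U)
  have "Q u (u - u') = b (u - u') F" "Q u' (u - u') = b (u - u') F"
    using p e eliminate[OF wu(1,3,5) F eU] eliminate[OF wu(2,4,6) F eU]
    by (auto simp: mixed_def)
  then have "Q (u - u') (u - u') = 0"
    using lin_on_diff[OF subsp bilin_on_left[OF Q_bilin eU] wu(3,4)] by simp
  moreover obtain m where m: "m > 0" "\<And>u. u \<in> Hp \<Longrightarrow> m * (N u)\<^sup>2 \<le> Q u u" by (rule Q_coercive) blast
  ultimately have "m * (N (u - u'))\<^sup>2 \<le> 0" using e by metis
  then show 0: "N (u - u') = 0" using m(1) by (simp add: mult_le_0_iff)
  show "N (w - w') = 0"
    using first_component_le[OF wu] 0 W.N_nonneg[OF W.closed(2)[OF wu(1,2)]] by simp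
qed

text \<open>The mixed problem tests only with \<open>Hp\<close>, but elements of \<open>H\<close>
  pair to zero with all of \<open>W\<close> by definition. The second equation therefore holds on
  \<open>U\<close>, which is why a trivial \<open>K\<close> forces \<open>w\<close> to
  vanish.\<close>

lemma mixed_in_K:
  assumes "mixed f w u"
  shows "w \<in> K"
proof -
  have w: "w \<in> W" using assms by (simp add: mixed_def)
  have "b v w = 0" if v: "v \<in> U" for v
  proof -
    obtain v0 v1 where s: "v0 \<in> H" "v1 \<in> Hp" "v = v0 + v1" using split_U[OF v] by blast
    have "b v w = b v0 w + b v1 w"
      unfolding s(3) using lin_on_add[OF bilin_on_left[OF b_bilin w]] s in_U by simp
    then show ?thesis using s w assms by (simp add: mixed_def H_def)
  qed
  with w show ?thesis by (simp add: K_def)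
qed

lemma kernel_exists:
  assumes g: "lin_on H g" "Cg \<ge> 0" "\<forall>h\<in>H. \<bar>g h\<bar> \<le> Cg * N h"
  shows "\<exists>u\<in>H. (\<forall>h\<in>H. D u h = g h) \<and> N u \<le> 1 / \<delta> * Cg"
proof -
  note Cd = C_nonneg(3) D_bound
  have HU: "H \<subseteq> U" using in_U by blast
  have Dc: "\<delta> * (N v)\<^sup>2 \<le> D v v" if "v \<in> H" for v using D_coercive(2) that by (simp add: H_def)
  have "\<exists>u\<in>H. \<forall>h\<in>H. D u h = g h"
  proof (rule H.lax_milgram)
    show "bilin_on H H D" using bilin_on_subset[OF D_bilin HU HU] .
    show "D u v = D v u" if "u \<in> H" "v \<in> H" for u v using D_sym[OF in_U(2) in_U(2)] that .
    show "D v v \<le> Cd * ip v v" if "v \<in> H" for v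
      using Cd(2)[OF in_U(2) in_U(2), OF that that] H.N_sq[OF that] by (simp add: power2_eq_square mult.assoc)
    show "\<delta> * ip v v \<le> D v v" if "v \<in> H" for v using Dc[OF that] H.N_sq[OF that] by simp
    show "\<bar>g v\<bar> \<le> Cg * N v" if "v \<in> H" for v using g(3) that by blast
  qed (use D_coercive(1) g in auto)
  then obtain u where u: "u \<in> H" "\<forall>h\<in>H. D u h = g h" by blast
  have "N u \<le> 1 / \<delta> * Cg"
  proof (rule le_of_sq_le)
    have "\<delta> * (N u)\<^sup>2 \<le> g u" using Dc u by metis
    also have "\<dots> \<le> Cg * N u" using g u by (auto simp: abs_le_iff)
    finally show "N u * N u \<le> 1 / \<delta> * Cg * N u"
      using D_coercive(1) by (simp add: field_simps power2_eq_square)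
  qed (use H.N_nonneg u g D_coercive in auto)
  with u show ?thesis by blast
qed

lemma kernel_unique:
  assumes u: "u \<in> H" "u' \<in> H" and eq: "\<forall>h\<in>H. D u h = g h" "\<forall>h\<in>H. D u' h = g h"
  shows "N (u - u') = 0"
proof -
  have e: "u - u' \<in> H" using H.closed(2)[OF u] .
  have "\<delta> * (N (u - u'))\<^sup>2 \<le> D (u - u') (u - u')" using D_coercive(2) e by (simp add: H_def)
  also have "\<dots> = 0"
    using lin_on_diff[OF subsp bilin_on_left[OF D_bilin in_U(2)[OF e]] in_U(2)[OF u(1)] in_U(2)[OF u(2)]]
      eq e by simp
  finally show ?thesis using D_coercive(1) by (simp add: mult_le_0_iff)
qed

text \<open>The residual \<open>d - D u\<close> of the limit vanishes on \<open>H\<close>.  Testing the equation for the error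
  \<open>e\<close> with \<open>e\<close> itself therefore bounds \<open>e\<^sub>1\<close> by \<open>O(\<kappa>)\<close>, but \<open>e\<^sub>0\<close> only by \<open>O(\<surd>\<kappa>)\<close>; testing with
  \<open>e\<^sub>0\<close> shows that \<open>e\<^sub>0\<close> is bounded by \<open>e\<^sub>1\<close>.\<close>

lemma expansion:
  assumes f: "lin_on W f" "\<And>v. v \<in> W \<Longrightarrow> \<bar>f v\<bar> \<le> Cf * N v"
    and d: "lin_on U d" "\<And>v. v \<in> U \<Longrightarrow> \<bar>d v\<bar> \<le> Cg * N v"
    and m: "mixed f w u1" and u0: "u0 \<in> H" "\<forall>h\<in>H. D u0 h = d h - D u1 h"
  shows "\<exists>C. \<forall>\<kappa>>0. \<forall>w' u'. penalised f d \<kappa> w' u' \<longrightarrow>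
    N (w' - w) \<le> C * \<kappa> \<and> N (u' - (u0 + u1)) \<le> C * \<kappa>"
proof -
  obtain m where m0: "m > 0" "\<And>u. u \<in> Hp \<Longrightarrow> m * (N u)\<^sup>2 \<le> Q u u" by (rule Q_coercive) blast
  note Cd = C_nonneg(3) D_bound
  obtain F where F: "F \<in> W" "\<forall>v\<in>W. a F v = f v" using solve_a[OF f] by blast
  define u where "u = u0 + u1"
  have u1: "u1 \<in> Hp" "w \<in> W" using m by (auto simp: mixed_def)
  have u01: "u0 \<in> U" "u1 \<in> U" using u1 u0 in_U by auto
  have uU: "u \<in> U" using closed(1)[OF u01] by (simp add: u_def)
  have wu: "\<forall>v\<in>W. a w v + b u v = f v"
    using m u0(1) lin_on_add[OF bilin_on_left[OF b_bilin] u01] by (simp add: mixed_def u_def H_def)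
  \<comment> \<open>Since \<open>w\<close> lies in \<open>K\<close>, the limit solves the eliminated
    equation on all of \<open>U\<close>, not just on \<open>Hp\<close>.\<close>
  have Qu: "Q u v = b v F" if v: "v \<in> U" for v
    using eliminate[OF u1(2) uU wu F v] mixed_in_K[OF m] v by (simp add: K_def)
  have DuH: "D u h = d h" if h: "h \<in> H" for h
    using lin_on_add[OF bilin_on_left[OF D_bilin in_U(2)[OF h]] u01] u0(2) h by (simp add: u_def)
  define R where "R = \<bar>Cg\<bar> + Cd * N u"
  have R: "R \<ge> 0" "\<And>v. v \<in> U \<Longrightarrow> \<bar>d v - D u v\<bar> \<le> R * N v"
  proof -
    show "R \<ge> 0" using Cd(1) N_nonneg[OF uU] by (simp add: R_def)
    fix v assume v: "v \<in> U"
    have "\<bar>d v - D u v\<bar> \<le> \<bar>d v\<bar> + \<bar>D u v\<bar>" by (rule abs_triangle_ineq4)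
    also have "\<dots> \<le> \<bar>Cg\<bar> * N v + Cd * N u * N v"
      using d(2)[OF v] Cd(2)[OF uU v] mult_right_mono[OF abs_ge_self[of Cg] N_nonneg[OF v]] by simp
    finally show "\<bar>d v - D u v\<bar> \<le> R * N v" by (simp add: R_def algebra_simps)
  qed
  define C1 where "C1 = R / m"
  \<comment> \<open>\<open>C1\<close> is the rate for \<open>e1\<close>; the factor adds
    \<open>e0\<close>, which is at most \<open>Cd / \<delta>\<close> times \<open>e1\<close>.
    Neither constant contains \<kappa>.\<close>
  define C2 where "C2 = (Cd / \<delta> + 1) * C1"
  have C12: "C1 \<ge> 0" "C2 \<ge> 0" using R(1) m0(1) Cd(1) D_coercive(1) by (auto simp: C1_def C2_def)
  have main: "N (w' - w) \<le> Ct * (C2 * \<kappa>) \<and> N (u' - u) \<le> C2 * \<kappa>"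
    if \<kappa>: "\<kappa> > 0" and p: "penalised f d \<kappa> w' u'" for \<kappa> w' u'
  proof -
    have wu': "w' \<in> W" "u' \<in> U" "\<forall>v\<in>W. a w' v + b u' v = f v" using p by (auto simp: penalised_def)
    define e where "e = u' - u"
    have eU: "e \<in> U" using closed(2)[OF wu'(2) uU] by (simp add: e_def)
    \<comment> \<open>Subtracting \<open>Q u v = b v F\<close> from the penalised equation and
      moving \<open>\<kappa> * D u v\<close> to the right leaves the residual of the limit as
      data.\<close>
    have eq: "Q e v + \<kappa> * D e v = \<kappa> * (d v - D u v)" if v: "v \<in> U" for v
    proof -
      have "Q u' v + \<kappa> * D u' v = b v F + \<kappa> * d v"
      proof -
        have "b v w' - \<kappa> * D u' v = - \<kappa> * d v" using p v by (auto simp: penalised_def)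
        then show ?thesis using eliminate[OF wu' F v] by linarith
      qed
      then show ?thesis
        using Qu[OF v]
        unfolding e_def lin_on_diff[OF subsp bilin_on_left[OF Q_bilin v] wu'(2) uU]
          lin_on_diff[OF subsp bilin_on_left[OF D_bilin v] wu'(2) uU] right_diff_distrib
        by linarith
    qed
    obtain e0 e1 where s: "e0 \<in> H" "e1 \<in> Hp" "e = e0 + e1" using split_U[OF eU] by blast
    have sU: "e0 \<in> U" "e1 \<in> U" using s in_U by auto
    have N1: "N e1 \<le> C1 * \<kappa>"
    proof (rule le_of_sq_le)
      have "m * (N e1)\<^sup>2 \<le> Q e1 e1" using m0(2)[OF s(2)] .
      also have "\<dots> = Q e e"
        using Q_split[OF s(1,2) eU] Q_split[OF s(1,2) sU(2)] Q_sym[OF sU(2) eU] s(3) by simp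
      also have "\<dots> \<le> Q e e + \<kappa> * D e e" using \<kappa> D_pos[OF eU] by simp
      also have "\<dots> = \<kappa> * (d e - D u e)" using eq[OF eU] .
      also have "d e - D u e = d e1 - D u e1"
        using DuH[OF s(1)] lin_on_add[OF d(1) sU] lin_on_add[OF bilin_on_right[OF D_bilin uU] sU] s(3)
        by simp
      also have "\<kappa> * (d e1 - D u e1) \<le> \<kappa> * (R * N e1)"
        using R(2)[OF sU(2)] \<kappa> by (intro mult_left_mono) auto
      finally show "N e1 * N e1 \<le> C1 * \<kappa> * N e1"
        using m0(1) by (simp add: C1_def field_simps power2_eq_square)
    qed (use N_nonneg sU C12 \<kappa> in auto)
    have N0: "N e0 \<le> Cd / \<delta> * N e1"
    proof (rule le_of_sq_le)
      \<comment> \<open>\<open>Q\<close> annihilates \<open>e0\<close> and the residual vanishes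
        there, so \<kappa> cancels exactly and a relation between \<open>e0\<close> and
        \<open>e1\<close> free of \<kappa> remains.\<close>
      have "\<kappa> * D e e0 = 0" using eq[OF sU(1)] Q_H[OF s(1) eU] DuH[OF s(1)] by simp
      then have "D e e0 = 0" using \<kappa> by simp
      then have "D e0 e0 = - D e1 e0"
        using lin_on_add[OF bilin_on_left[OF D_bilin sU(1)] sU] s(3) by simp
      then have "D e0 e0 \<le> Cd * N e1 * N e0" using Cd(2)[OF sU(2,1)] by simp
      moreover have "\<delta> * (N e0)\<^sup>2 \<le> D e0 e0" using D_coercive(2) s(1) by (simp add: H_def)
      ultimately have "\<delta> * (N e0)\<^sup>2 \<le> Cd * N e1 * N e0" by simp
      then show "N e0 * N e0 \<le> Cd / \<delta> * N e1 * N e0"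
        using D_coercive(1) by (simp add: field_simps power2_eq_square)
    qed (use N_nonneg sU Cd D_coercive in auto)
    have "N e \<le> N e0 + N e1" using N_triangle[OF sU] s(3) by simp
    also have "\<dots> \<le> (Cd / \<delta> + 1) * N e1" using N0 by (simp add: algebra_simps)
    also have "\<dots> \<le> (Cd / \<delta> + 1) * (C1 * \<kappa>)"
      using N1 Cd(1) D_coercive(1) by (intro mult_left_mono) auto
    finally have Ne: "N e \<le> C2 * \<kappa>" by (simp add: C2_def mult.assoc)
    have "N (w' - w) \<le> Ct * N e" using first_component_le[OF wu'(1) u1(2) wu'(2) uU wu'(3) wu] by (simp add: e_def)
    also have "\<dots> \<le> Ct * (C2 * \<kappa>)" using Ne Ct(1) by (rule mult_left_mono)
    finally show ?thesis using Ne by (simp add: e_def)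
  qed
  have "N (w' - w) \<le> (Ct * C2 + C2) * \<kappa> \<and> N (u' - (u0 + u1)) \<le> (Ct * C2 + C2) * \<kappa>"
    if "\<kappa> > 0" "penalised f d \<kappa> w' u'" for \<kappa> w' u'
  proof -
    have "0 \<le> C2 * \<kappa>" "0 \<le> Ct * C2 * \<kappa>" using C12 Ct(1) that(1) by auto
    then show ?thesis using main[OF that] by (simp add: algebra_simps u_def)
  qed
  then show ?thesis by blast
qed

end

section \<open>Completeness of \<open>L\<^sup>2\<close>\<close>

lemma L2_measurable: "f \<in> L2 M \<Longrightarrow> f \<in> borel_measurable M"
  and L2_integrable_sq: "f \<in> L2 M \<Longrightarrow> integrable M (\<lambda>x. (norm (f x))\<^sup>2)"
  by (auto simp: L2_def)

lemma L2_bound: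
  fixes f :: "'a \<Rightarrow> 'b::euclidean_space" and g :: "'a \<Rightarrow> real"
  assumes "f \<in> borel_measurable M" "integrable M g" "AE x in M. (norm (f x))\<^sup>2 \<le> g x"
  shows "f \<in> L2 M"
proof -
  note assms(1)[measurable]
  have "integrable M (\<lambda>x. (norm (f x))\<^sup>2)"
    by (rule Bochner_Integration.integrable_bound[OF assms(2)]) (use assms(3) in auto)
  then show ?thesis using assms(1) by (simp add: L2_def)
qed

lemma norm_add_sq_le: "(norm (u + v))\<^sup>2 \<le> 2 * (norm u)\<^sup>2 + 2 * (norm v)\<^sup>2"
  for u v :: "'a::real_normed_vector"
proof -
  have "(norm (u + v))\<^sup>2 \<le> (norm u + norm v)\<^sup>2" by (intro power_mono norm_triangle_ineq norm_ge_zero)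
  also have "\<dots> \<le> 2 * (norm u)\<^sup>2 + 2 * (norm v)\<^sup>2"
    using sum_squares_bound[of "norm u" "norm v"] by (simp add: power2_sum)
  finally show ?thesis .
qed

lemma L2_subspace: "subspace (L2 M)"
  unfolding subspace_def
proof (intro conjI ballI allI)
  show "0 \<in> L2 M" by (simp add: L2_def zero_fun_def)
  show "f + g \<in> L2 M" if "f \<in> L2 M" "g \<in> L2 M" for f g
    by (rule L2_bound[where g="\<lambda>x. 2 * (norm (f x))\<^sup>2 + 2 * (norm (g x))\<^sup>2"])
      (use that in \<open>auto simp: L2_def plus_fun_def norm_add_sq_le\<close>)
  show "c *\<^sub>R f \<in> L2 M" if "f \<in> L2 M" for c f
    using that by (auto simp: L2_def scaleR_fun_def power_mult_distrib)
qed

lemma L2_inner_integrable: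
  assumes f: "f \<in> L2 M" and g: "g \<in> L2 M"
  shows "integrable M (\<lambda>x. f x \<bullet> g x)"
proof (rule Bochner_Integration.integrable_bound)
  show "integrable M (\<lambda>x. (norm (f x))\<^sup>2 + (norm (g x))\<^sup>2)" using f g by (auto simp: L2_def)
  show "(\<lambda>x. f x \<bullet> g x) \<in> borel_measurable M"
    using f g L2_measurable by (intro borel_measurable_inner) auto
  have "norm (f x \<bullet> g x) \<le> norm ((norm (f x))\<^sup>2 + (norm (g x))\<^sup>2)" for x
  proof -
    have "\<bar>f x \<bullet> g x\<bar> \<le> norm (f x) * norm (g x)" by (rule Cauchy_Schwarz_ineq2)
    also have "\<dots> \<le> (norm (f x))\<^sup>2 + (norm (g x))\<^sup>2"
      using sum_squares_bound[of "norm (f x)" "norm (g x)"]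
        mult_nonneg_nonneg[OF norm_ge_zero[of "f x"] norm_ge_zero[of "g x"]] by linarith
    finally show ?thesis by simp
  qed
  then show "AE x in M. norm (f x \<bullet> g x) \<le> norm ((norm (f x))\<^sup>2 + (norm (g x))\<^sup>2)" by simp
qed

lemma L2_semi_inner: "semi_inner (L2 M :: ('a \<Rightarrow> 'b::euclidean_space) set) (L2_inner M)"
proof
  have lin: "lin_on (L2 M) (L2_inner M f)" if f: "f \<in> L2 M" for f :: "'a \<Rightarrow> 'b"
    unfolding lin_on_def L2_inner_def plus_fun_def scaleR_fun_def
    using L2_inner_integrable[OF f] by (simp add: inner_add_right)
  moreover have "(\<lambda>f. L2_inner M f g) = L2_inner M g" for g :: "'a \<Rightarrow> 'b"
    by (rule ext) (simp add: L2_inner_def inner_commute)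
  ultimately show "bilin_on (L2 M :: ('a \<Rightarrow> 'b) set) (L2 M) (L2_inner M)"
    by (simp add: bilin_on_def)
qed (auto simp: L2_subspace L2_inner_def inner_commute)

lemma L2_norm_nrm: "L2_norm M = nrm (L2_inner M)"
  by (simp add: L2_norm_def nrm_def fun_eq_iff)

lemma L2_norm_sq: "(L2_norm M f)\<^sup>2 = (\<integral>x. (norm (f x))\<^sup>2 \<partial>M)"
  by (simp add: L2_norm_def L2_inner_def dot_square_norm)

lemma L2_norm_nonneg: "0 \<le> L2_norm M f"
  by (simp add: L2_norm_def L2_inner_def)

lemma L2_norm_nn_integral:
  "f \<in> L2 M \<Longrightarrow> (\<integral>\<^sup>+x. ennreal ((norm (f x))\<^sup>2) \<partial>M) = ennreal ((L2_norm M f)\<^sup>2)"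
  unfolding L2_norm_sq by (intro nn_integral_eq_integral L2_integrable_sq) auto

lemma L2_I_nn_integral:
  assumes "f \<in> borel_measurable M" and le: "(\<integral>\<^sup>+x. ennreal ((norm (f x))\<^sup>2) \<partial>M) \<le> ennreal (c\<^sup>2)" and c: "0 \<le> c"
  shows "f \<in> L2 M" "L2_norm M f \<le> c"
proof -
  note assms(1)[measurable]
  have "integrable M (\<lambda>x. (norm (f x))\<^sup>2)"
    using le by (intro integrableI_bounded) (auto simp: le_less_trans)
  then show f: "f \<in> L2 M" by (simp add: L2_def)
  have "ennreal ((L2_norm M f)\<^sup>2) \<le> ennreal (c\<^sup>2)" using le L2_norm_nn_integral[OF f] by simp
  then have "(L2_norm M f)\<^sup>2 \<le> c\<^sup>2" by (simp add: ennreal_le_iff)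
  then show "L2_norm M f \<le> c" using c by (rule power2_le_imp_le)
qed

lemma L2_norm_zero_AE:
  assumes f: "f \<in> L2 M" and 0: "L2_norm M f = 0"
  shows "AE x in M. f x = 0"
proof -
  have "(\<integral>x. (norm (f x))\<^sup>2 \<partial>M) = 0" using 0 L2_norm_sq[of M f] by simp
  then have "AE x in M. (norm (f x))\<^sup>2 = 0"
    using integral_nonneg_eq_0_iff_AE[OF L2_integrable_sq[OF f]] by simp
  then show ?thesis by simp
qed

lemma L2_norm_cong_AE:
  assumes "f \<in> borel_measurable M" "g \<in> borel_measurable M" "AE x in M. f x = g x"
  shows "L2_norm M f = L2_norm M g"
proof -
  note assms(1,2)[measurable]
  show ?thesis unfolding L2_norm_def L2_inner_def
    by (intro arg_cong[where f=sqrt] integral_cong_AE) (use assms(3) in auto)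
qed

text \<open>The series of \<open>4 ^ k * (norm (Y k x))\<^sup>2\<close> has integral at most the sum
  of \<open>(1/4) ^ k\<close>, hence is finite almost everywhere. Each of its terms is bounded by
  the sum \<open>C\<close>, which gives the factor \<open>sqrt C\<close>.\<close>

lemma L2_fast_decay_AE:
  fixes Y :: "nat \<Rightarrow> 'a \<Rightarrow> 'b::euclidean_space"
  assumes Y: "\<And>k. Y k \<in> L2 M" and le: "\<And>k. L2_norm M (Y k) \<le> (1/4) ^ k"
  shows "AE x in M. \<exists>C. \<forall>k. norm (Y k x) \<le> C * (1/2) ^ k"
proof -
  have [measurable]: "Y k \<in> borel_measurable M" for k using Y L2_measurable by blast
  define g where "g k x = ennreal (4 ^ k * (norm (Y k x))\<^sup>2)" for k x
  have [measurable]: "g k \<in> borel_measurable M" for k unfolding g_def by measurable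
  have gk: "(\<integral>\<^sup>+x. g k x \<partial>M) \<le> ennreal ((1/4) ^ k)" for k
  proof -
    have "(\<integral>\<^sup>+x. g k x \<partial>M) = ennreal (4 ^ k) * (\<integral>\<^sup>+x. ennreal ((norm (Y k x))\<^sup>2) \<partial>M)"
      unfolding g_def by (subst nn_integral_cmult[symmetric]) (auto simp: ennreal_mult)
    also have "\<dots> = ennreal (4 ^ k * (L2_norm M (Y k))\<^sup>2)"
      using L2_norm_nn_integral[OF Y[of k]] by (simp add: ennreal_mult)
    also have "\<dots> \<le> ennreal (4 ^ k * ((1/4) ^ k)\<^sup>2)"
      using power_mono[OF le[of k] L2_norm_nonneg, of 2] by (intro ennreal_leI mult_left_mono) auto
    also have "4 ^ k * ((1/4) ^ k)\<^sup>2 = ((1/4) ^ k :: real)"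
      by (simp add: power2_eq_square power_one_over)
    finally show ?thesis .
  qed
  have "(\<integral>\<^sup>+x. (\<Sum>k. g k x) \<partial>M) = (\<Sum>k. \<integral>\<^sup>+x. g k x \<partial>M)"
    by (rule nn_integral_suminf) simp
  also have "\<dots> \<le> (\<Sum>k. ennreal ((1/4) ^ k))"
    by (intro suminf_le gk) auto
  also have "\<dots> < \<infinity>"
    by (subst suminf_ennreal2) (auto simp: summable_geometric)
  finally have "(\<integral>\<^sup>+x. (\<Sum>k. g k x) \<partial>M) \<noteq> \<infinity>" by simp
  then have "AE x in M. (\<Sum>k. g k x) \<noteq> \<infinity>"
    by (intro nn_integral_PInf_AE) auto
  then show ?thesis
  proof (eventually_elim)
    case (elim x)
    then obtain C where C: "C \<ge> 0" "(\<Sum>k. g k x) = ennreal C" by (cases "\<Sum>k. g k x") auto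
    have "norm (Y k x) \<le> sqrt C * (1/2) ^ k" for k
    proof -
      have "g k x \<le> (\<Sum>k. g k x)"
        using sum_le_suminf[of "\<lambda>k. g k x" "{k}"] by simp
      then have "4 ^ k * (norm (Y k x))\<^sup>2 \<le> C" using C by (simp add: g_def)
      moreover have "4 ^ k * (norm (Y k x))\<^sup>2 = (2 ^ k * norm (Y k x))\<^sup>2"
      proof -
        have "((2::real) ^ k)\<^sup>2 = 4 ^ k" by (simp add: power2_eq_square flip: power_mult_distrib)
        then show ?thesis by (simp add: power_mult_distrib)
      qed
      ultimately have "2 ^ k * norm (Y k x) \<le> sqrt C" by (simp add: real_le_rsqrt)
      then show ?thesis by (simp add: field_simps power_one_over)
    qed
    then show ?case by blast
  qed
qed

text \<open>\<open>r k\<close> is any index with error at most \<open>(1/4) ^ k\<close>;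
  monotonicity of \<open>r\<close> is not asserted, as only the pointwise limit along it
  matters.\<close>

lemma L2_AE_subseq:
  fixes X :: "nat \<Rightarrow> 'a \<Rightarrow> 'b::euclidean_space"
  assumes X: "\<And>k. X k \<in> L2 M" and g: "g \<in> L2 M" and lim: "(\<lambda>k. L2_norm M (X k - g)) \<longlonglongrightarrow> 0"
  obtains r :: "nat \<Rightarrow> nat" where "AE x in M. (\<lambda>k. X (r k) x) \<longlonglongrightarrow> g x"
proof -
  have "\<exists>m. L2_norm M (X m - g) \<le> (1/4) ^ k" for k
  proof -
    have "eventually (\<lambda>m. L2_norm M (X m - g) < (1/4) ^ k) sequentially"
      using lim by (rule order_tendstoD) simp
    then show ?thesis by (auto simp: eventually_sequentially intro: less_imp_le)
  qed
  then obtain r :: "nat \<Rightarrow> nat" where r: "\<And>k. L2_norm M (X (r k) - g) \<le> (1/4) ^ k" by metis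
  have "AE x in M. \<exists>C. \<forall>k. norm ((X (r k) - g) x) \<le> C * (1/2) ^ k"
    by (rule L2_fast_decay_AE) (use X g r L2_subspace subspace_diff in blast)+
  then have "AE x in M. (\<lambda>k. X (r k) x) \<longlonglongrightarrow> g x"
  proof eventually_elim
    case (elim x)
    then obtain C where C: "\<And>k. norm (X (r k) x - g x) \<le> C * (1/2) ^ k" by (auto simp: fun_diff_def)
    have "(\<lambda>k. C * (1/2) ^ k :: real) \<longlonglongrightarrow> C * 0" by (intro tendsto_intros LIMSEQ_power_zero) simp
    then have "(\<lambda>k. C * (1/2) ^ k) \<longlonglongrightarrow> 0" by simp
    then have "(\<lambda>k. X (r k) x - g x) \<longlonglongrightarrow> 0"
      by (rule Lim_null_comparison[rotated]) (use C in simp)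
    then show ?case by (rule LIM_zero_cancel)
  qed
  then show ?thesis by (rule that)
qed

text \<open>Riesz-Fischer: a fast subsequence converges almost everywhere by telescoping, and
  Fatou's lemma transfers the Cauchy estimate to the pointwise limit.\<close>

lemma L2_complete: "seq_complete (L2 M) (L2_norm M)"
  unfolding seq_complete_def
proof (intro allI impI, elim conjE)
  fix X :: "nat \<Rightarrow> 'a \<Rightarrow> 'b::euclidean_space"
  assume X: "\<forall>k. X k \<in> L2 M" and Cau: "\<forall>e>0. \<exists>m. \<forall>i\<ge>m. \<forall>j\<ge>m. L2_norm M (X i - X j) \<le> e"
  interpret semi_inner "L2 M" "L2_inner M" by (rule L2_semi_inner)
  have [measurable]: "X k \<in> borel_measurable M" for k using X L2_measurable by blast
  have "\<exists>m. \<forall>i\<ge>m. \<forall>j\<ge>m. L2_norm M (X i - X j) \<le> (1/4) ^ k" for k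
    using Cau by simp
  then obtain m where m: "\<And>k i j. i \<ge> m k \<Longrightarrow> j \<ge> m k \<Longrightarrow> L2_norm M (X i - X j) \<le> (1/4) ^ k"
    by metis
  \<comment> \<open>Partial sums dominate all earlier thresholds at once, so \<open>r k'\<close>
    lies beyond \<open>m k\<close> for every \<open>k \<le> k'\<close>.\<close>
  define r where "r k = (\<Sum>l\<le>k. m l)" for k
  have r: "r k' \<ge> m k" if "k \<le> k'" for k k'
    unfolding r_def by (rule member_le_sum) (use that in auto)
  \<comment> \<open>\<open>lim\<close> is total, so \<open>g\<close> is measurable although the
    sequence may diverge on a null set.\<close>
  define g where "g x = lim (\<lambda>k. X (r k) x)" for x
  have [measurable]: "g \<in> borel_measurable M" unfolding g_def by measurable
  have "AE x in M. \<exists>C. \<forall>k. norm ((X (r (Suc k)) - X (r k)) x) \<le> C * (1/2) ^ k"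
  proof (rule L2_fast_decay_AE)
    show "X (r (Suc k)) - X (r k) \<in> L2 M" for k using X closed(2) by blast
    show "L2_norm M (X (r (Suc k)) - X (r k)) \<le> (1/4) ^ k" for k using m r by simp
  qed
  then have ae: "AE x in M. (\<lambda>k. X (r k) x) \<longlonglongrightarrow> g x"
  proof eventually_elim
    case (elim x)
    then obtain C where C: "\<And>k. norm (X (r (Suc k)) x - X (r k) x) \<le> C * (1/2) ^ k"
      by (auto simp: fun_diff_def)
    have "summable (\<lambda>k. C * (1/2) ^ k :: real)" by (intro summable_mult summable_geometric) simp
    then have "summable (\<lambda>k. X (r (Suc k)) x - X (r k) x)"
      by (rule summable_comparison_test'[of _ 0]) (rule C)
    then have "convergent (\<lambda>n. \<Sum>k<n. X (r (Suc k)) x - X (r k) x)" by (simp add: summable_iff_convergent)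
    moreover have "(\<lambda>n. \<Sum>k<n. X (r (Suc k)) x - X (r k) x) = (\<lambda>n. X (r n) x - X (r 0) x)"
      by (rule ext) (rule sum_lessThan_telescope)
    ultimately have "convergent (\<lambda>n. X (r n) x - X (r 0) x)" by simp
    then have "convergent (\<lambda>n. (X (r n) x - X (r 0) x) + X (r 0) x)"
      by (intro convergent_add convergent_const)
    then show ?case unfolding g_def by (simp add: convergent_LIMSEQ_iff)
  qed
  have tail: "X i - g \<in> L2 M \<and> L2_norm M (X i - g) \<le> (1/4) ^ k" if i: "i \<ge> m k" for i k
  proof -
    define h where "h l x = ennreal ((norm (X i x - X (r (l + k)) x))\<^sup>2)" for l x
    \<comment> \<open>The shift by \<open>k\<close> in \<open>h\<close> keeps every index beyond
      \<open>m k\<close>, so the Cauchy bound holds before the limit inferior is taken.\<close>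
    have "AE x in M. ennreal ((norm ((X i - g) x))\<^sup>2) = liminf (\<lambda>l. h l x)"
      using ae
    proof eventually_elim
      case (elim x)
      then have "(\<lambda>l. X (r (l + k)) x) \<longlonglongrightarrow> g x" by (rule LIMSEQ_ignore_initial_segment)
      then have "(\<lambda>l. h l x) \<longlonglongrightarrow> ennreal ((norm (X i x - g x))\<^sup>2)"
        unfolding h_def by (intro tendsto_ennrealI tendsto_intros)
      then show ?case by (simp add: lim_imp_Liminf fun_diff_def)
    qed
    then have "(\<integral>\<^sup>+x. ennreal ((norm ((X i - g) x))\<^sup>2) \<partial>M) = (\<integral>\<^sup>+x. liminf (\<lambda>l. h l x) \<partial>M)"
      by (rule nn_integral_cong_AE)
    also have "\<dots> \<le> liminf (\<lambda>l. \<integral>\<^sup>+x. h l x \<partial>M)"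
      by (rule nn_integral_liminf) (simp add: h_def)
    also have "\<dots> \<le> liminf (\<lambda>l. ennreal (((1/4) ^ k)\<^sup>2))"
    proof (intro Liminf_mono always_eventually allI)
      fix l
      have "(\<integral>\<^sup>+x. h l x \<partial>M) = ennreal ((L2_norm M (X i - X (r (l + k))))\<^sup>2)"
        unfolding h_def
        using L2_norm_nn_integral[OF closed(2)[OF X[rule_format] X[rule_format]], of i "r (l + k)"]
        by (simp add: fun_diff_def)
      also have "\<dots> \<le> ennreal (((1/4) ^ k)\<^sup>2)"
        using m[OF i r[of k "l + k"]] L2_norm_nonneg by (intro ennreal_leI power_mono) auto
      finally show "(\<integral>\<^sup>+x. h l x \<partial>M) \<le> ennreal (((1/4) ^ k)\<^sup>2)" .
    qed
    also have "\<dots> = ennreal (((1/4) ^ k)\<^sup>2)" by (simp add: Liminf_const)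
    finally show ?thesis using L2_I_nn_integral[of "X i - g" M "(1/4) ^ k"] by (simp add: fun_diff_def)
  qed
  have "X (m 0) - (X (m 0) - g) \<in> L2 M" using tail[of 0 "m 0"] X closed(2) by blast
  then have g: "g \<in> L2 M" by simp
  have "(\<lambda>k. L2_norm M (X k - g)) \<longlonglongrightarrow> 0"
  proof (rule LIMSEQ_I)
    fix e :: real assume "e > 0"
    then obtain k where "(1/4) ^ k < e" using real_arch_pow_inv[of e "1/4"] by auto
    then have "norm (L2_norm M (X n - g) - 0) < e" if "n \<ge> m k" for n
      using tail[OF that] L2_norm_nonneg[of M "X n - g"] by simp
    then show "\<exists>no. \<forall>n\<ge>no. norm (L2_norm M (X n - g) - 0) < e" by blast
  qed
  with g show "\<exists>g\<in>L2 M. (\<lambda>k. L2_norm M (X k - g)) \<longlonglongrightarrow> 0" by blast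
qed

lemma L2_bounded_finite_measure:
  fixes f :: "'a \<Rightarrow> 'b::euclidean_space"
  assumes "finite_measure M" "f \<in> borel_measurable M" "AE x in M. norm (f x) \<le> K"
  shows "f \<in> L2 M"
proof (rule L2_bound)
  interpret finite_measure M by fact
  show "integrable M (\<lambda>x. K\<^sup>2)" by simp
  show "AE x in M. (norm (f x))\<^sup>2 \<le> K\<^sup>2" using assms(3) by eventually_elim (simp add: power_mono)
qed fact

section \<open>Smooth functions and uniqueness of weak gradients\<close>

lemma k_times_diff_SucI:
  assumes "\<And>x. (f has_derivative F x) (at x)" "\<And>b. b \<in> Basis \<Longrightarrow> k_times_diff k (\<lambda>x. F x b)"
  shows "k_times_diff (Suc k) f"
proof -
  have "frechet_derivative f (at x) = F x" for x
    using frechet_derivative_at[OF assms(1)] by simp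
  then show ?thesis
    using assms by (auto simp: differentiable_on_def differentiable_def)
qed

lemma k_times_diff_SucD:
  assumes "k_times_diff (Suc k) f"
  shows "(f has_derivative frechet_derivative f (at x)) (at x)"
    "b \<in> Basis \<Longrightarrow> k_times_diff k (\<lambda>x. frechet_derivative f (at x) b)"
  using assms by (auto simp: differentiable_on_def frechet_derivative_works)

lemma k_times_diff_Suc_imp: "k_times_diff (Suc k) f \<Longrightarrow> k_times_diff k f"
proof (induction k arbitrary: f)
  case 0
  then show ?case by (simp add: differentiable_imp_continuous_on)
next
  case (Suc k)
  then show ?case
    by (metis k_times_diff.simps(2))
qed

lemma k_times_diff_const: "k_times_diff k (\<lambda>x. c)"
  by (induction k arbitrary: c) (auto intro!: k_times_diff_SucI[where F="\<lambda>x b. 0"] simp del: k_times_diff.simps(2))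

lemma k_times_diff_bounded_linear:
  assumes "bounded_linear f"
  shows "k_times_diff k f"
proof (cases k)
  case 0
  then show ?thesis using assms by (simp add: linear_continuous_on)
next
  case (Suc l)
  show ?thesis unfolding Suc
    by (rule k_times_diff_SucI[where F="\<lambda>x. f"])
      (auto intro: assms bounded_linear_imp_has_derivative k_times_diff_const)
qed

lemma k_times_diff_add:
  "k_times_diff k f \<Longrightarrow> k_times_diff k g \<Longrightarrow> k_times_diff k (\<lambda>x. f x + g x)"
proof (induction k arbitrary: f g)
  case 0
  then show ?case by (auto intro: continuous_intros)
next
  case (Suc k)
  show ?case
  proof (rule k_times_diff_SucI)
    show "((\<lambda>x. f x + g x) has_derivative
        (\<lambda>b. frechet_derivative f (at x) b + frechet_derivative g (at x) b)) (at x)" for x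
      using Suc.prems[THEN k_times_diff_SucD(1)] by (rule has_derivative_add)
  qed (use Suc in simp)
qed

lemma k_times_diff_scaleR: "k_times_diff k f \<Longrightarrow> k_times_diff k (\<lambda>x. c *\<^sub>R f x)"
proof (induction k arbitrary: f)
  case 0
  then show ?case by (auto intro: continuous_intros)
next
  case (Suc k)
  show ?case
  proof (rule k_times_diff_SucI)
    show "((\<lambda>x. c *\<^sub>R f x) has_derivative (\<lambda>b. c *\<^sub>R frechet_derivative f (at x) b)) (at x)" for x
      using Suc.prems[THEN k_times_diff_SucD(1)] by (rule has_derivative_scaleR_right)
  qed (use Suc in simp)
qed

lemma k_times_diff_mult:
  fixes f g :: "'a::euclidean_space \<Rightarrow> real"
  shows "k_times_diff k f \<Longrightarrow> k_times_diff k g \<Longrightarrow> k_times_diff k (\<lambda>x. f x * g x)"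
proof (induction k arbitrary: f g)
  case 0
  then show ?case by (auto intro: continuous_intros)
next
  case (Suc k)
  show ?case
  proof (rule k_times_diff_SucI)
    show "((\<lambda>x. f x * g x) has_derivative
        (\<lambda>b. f x * frechet_derivative g (at x) b + frechet_derivative f (at x) b * g x)) (at x)" for x
      using Suc.prems[THEN k_times_diff_SucD(1)] by (rule has_derivative_mult)
    show "k_times_diff k (\<lambda>x. f x * frechet_derivative g (at x) b + frechet_derivative f (at x) b * g x)"
      if "b \<in> Basis" for b
      using k_times_diff_add[OF Suc.IH[OF k_times_diff_Suc_imp k_times_diff_SucD(2)]
          Suc.IH[OF k_times_diff_SucD(2) k_times_diff_Suc_imp]] Suc.prems that by blast
  qed
qed

text \<open>The outer function comes with all its derivatives \<open>h j\<close>; as the induction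
  is general in \<open>j\<close>, its hypothesis covers the factor \<open>h (Suc j) (f x)\<close> of
  the chain rule.\<close>

lemma k_times_diff_compose:
  fixes f :: "'a::euclidean_space \<Rightarrow> real" and h :: "nat \<Rightarrow> real \<Rightarrow> real"
  assumes h: "\<And>j t. (h j has_real_derivative h (Suc j) t) (at t)"
  shows "k_times_diff k f \<Longrightarrow> k_times_diff k (\<lambda>x. h j (f x))"
proof (induction k arbitrary: j)
  case 0
  have "continuous_on UNIV (h j)" using h DERIV_continuous_on by blast
  then show ?case using 0 continuous_on_compose2[of UNIV "h j" UNIV f] by auto
next
  case (Suc k)
  show ?case
  proof (rule k_times_diff_SucI)
    show "((\<lambda>x. h j (f x)) has_derivative
        (\<lambda>b. h (Suc j) (f x) * frechet_derivative f (at x) b)) (at x)" for x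
      using has_derivative_compose[OF k_times_diff_SucD(1)[OF Suc.prems]
          h[unfolded has_field_derivative_def]] .
    show "k_times_diff k (\<lambda>x. h (Suc j) (f x) * frechet_derivative f (at x) b)" if "b \<in> Basis" for b
      using k_times_diff_mult[OF Suc.IH[OF k_times_diff_Suc_imp] k_times_diff_SucD(2)] Suc.prems that
      by blast
  qed
qed

lemma k_times_diff_prod:
  fixes f :: "'i \<Rightarrow> 'a::euclidean_space \<Rightarrow> real"
  assumes "\<And>i. i \<in> I \<Longrightarrow> k_times_diff k (f i)"
  shows "k_times_diff k (\<lambda>x. \<Prod>i\<in>I. f i x)"
  using assms
proof (induction I rule: infinite_finite_induct)
  case (insert i I)
  then show ?case by (simp add: k_times_diff_mult)
qed (simp_all add: k_times_diff_const)

text \<open>For \<open>p = 1\<close> this is the standard smooth function that is flat at the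
  origin. The polynomial in \<open>1 / t\<close> makes the family closed under
  differentiation.\<close>

definition flat :: "real poly \<Rightarrow> real \<Rightarrow> real" where
  "flat p t = (if t > 0 then poly p (1 / t) * exp (- (1 / t)) else 0)"

lemma poly_exp_at_top: "((\<lambda>s. poly p s * exp (- s)) \<longlongrightarrow> (0::real)) at_top"
proof -
  have "((\<lambda>s. \<Sum>i\<le>degree p. coeff p i * (s ^ i / exp s)) \<longlongrightarrow> (\<Sum>i\<le>degree p. coeff p i * 0)) at_top"
    by (intro tendsto_sum tendsto_mult tendsto_const tendsto_power_div_exp_0)
  moreover have "(\<lambda>s. \<Sum>i\<le>degree p. coeff p i * (s ^ i / exp s)) = (\<lambda>s. poly p s * exp (- s))"
    by (simp add: fun_eq_iff poly_altdef exp_minus sum_distrib_right divide_inverse mult.assoc)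
  ultimately show ?thesis by simp
qed

lemma flat_at_right: "(flat p \<longlongrightarrow> 0) (at_right 0)"
proof -
  have "((\<lambda>t. poly p (inverse t) * exp (- inverse t)) \<longlongrightarrow> 0) (at_right 0)"
    by (rule filterlim_compose[OF poly_exp_at_top filterlim_inverse_at_top_right])
  then show ?thesis
    by (rule Lim_transform_eventually)
      (auto simp: flat_def eventually_at_filter inverse_eq_divide intro!: always_eventually)
qed

text \<open>With \<open>s = 1 / t\<close>, differentiating \<open>p(s) exp(-s)\<close> gives
  \<open>s\<^sup>2 (p(s) - p'(s)) exp(-s)\<close>, which explains the new polynomial. At the origin
  exponential decay beats every polynomial.\<close>

lemma flat_deriv: "(flat p has_real_derivative flat (monom 1 2 * (p - pderiv p)) t) (at t)"
proof -
  consider "t > 0" | "t < 0" | "t = 0" by linarith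
  then show ?thesis
  proof cases
    case 1
    have "((\<lambda>t. poly p (1 / t) * exp (- (1 / t))) has_real_derivative
        poly (monom 1 2 * (p - pderiv p)) (1 / t) * exp (- (1 / t))) (at t)"
      using 1 by (auto intro!: derivative_eq_intros poly_DERIV[THEN DERIV_chain2]
          simp: field_simps poly_monom power2_eq_square)
    moreover have "eventually (\<lambda>s. flat p s = poly p (1 / s) * exp (- (1 / s))) (nhds t)"
      using eventually_gt_at_top order_tendstoD(1)[OF tendsto_ident_at] 1
      by (intro eventually_nhds_in_open[of "{0<..}", THEN eventually_mono]) (auto simp: flat_def)
    ultimately show ?thesis
      using 1 by (subst DERIV_cong_ev[OF refl _ refl]) (auto simp: flat_def)
  next
    case 2
    have "eventually (\<lambda>s. flat p s = 0) (nhds t)"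
      using 2 by (intro eventually_nhds_in_open[of "{..<0}", THEN eventually_mono]) (auto simp: flat_def)
    then show ?thesis
      using 2 by (subst DERIV_cong_ev[OF refl _ refl]) (auto simp: flat_def)
  next
    case 3
    \<comment> \<open>Division by \<open>h\<close> multiplies the polynomial by its variable, so the
      difference quotient is the flat function of \<open>pCons 0 p\<close>.\<close>
    have "((\<lambda>h. flat p h / h) \<longlongrightarrow> 0) (at_right 0)"
      by (rule Lim_transform_eventually[OF flat_at_right[of "pCons 0 p"]])
        (auto simp: flat_def eventually_at_filter intro!: always_eventually)
    moreover have "((\<lambda>h. flat p h / h) \<longlongrightarrow> 0) (at_left 0)"
      by (rule Lim_transform_eventually[OF tendsto_const])
        (auto simp: flat_def eventually_at_filter intro!: always_eventually)
    ultimately have "((\<lambda>h. flat p h / h) \<longlongrightarrow> 0) (at 0)" by (simp add: filterlim_split_at)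
    then show ?thesis using 3 by (simp add: DERIV_def flat_def)
  qed
qed

text \<open>For a nonempty box this is a smooth approximation of its indicator: for
  \<open>m > 0\<close> each factor is positive exactly between the two faces in its coordinate, and
  there it tends to 1 as \<open>m\<close> grows.\<close>

definition box_bump :: "real ^ 'n::finite \<Rightarrow> real ^ 'n \<Rightarrow> nat \<Rightarrow> real ^ 'n \<Rightarrow> real" where
  "box_bump a b m x = (\<Prod>i\<in>UNIV. flat 1 (real m * ((x $ i - a $ i) * (b $ i - x $ i))))"

lemma smooth_box_bump: "smooth (box_bump a b m)"
  unfolding smooth_def
proof
  fix k
  \<comment> \<open>\<open>h j\<close> is the \<open>j\<close>-th derivative of
    \<open>flat 1\<close>.\<close>
  define h where "h j = flat (((\<lambda>p. monom 1 2 * (p - pderiv p)) ^^ j) 1)" for j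
  have h: "(h j has_real_derivative h (Suc j) t) (at t)" for j t
    unfolding h_def using flat_deriv by simp
  have aff: "k_times_diff k (\<lambda>x. c * x $ i + d)" for i :: 'a and c d :: real
    by (intro k_times_diff_add k_times_diff_mult k_times_diff_const
        k_times_diff_bounded_linear bounded_linear_vec_nth)
  have "k_times_diff k (\<lambda>x. real m * ((x $ i - a $ i) * (b $ i - x $ i)))" for i
    using aff[of 1 i "- (a $ i)"] aff[of "-1" i "b $ i"]
    by (intro k_times_diff_mult k_times_diff_const) (simp_all add: algebra_simps)
  from k_times_diff_compose[of h, OF h this, of 0] show "k_times_diff k (box_bump a b m)"
    unfolding box_bump_def[abs_def] by (intro k_times_diff_prod) (simp add: h_def)
qed

lemma flat_one_bounds: "0 \<le> flat 1 t" "flat 1 t \<le> 1"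
  by (auto simp: flat_def)

lemma box_bump_bounds: "0 \<le> box_bump a b m x" "box_bump a b m x \<le> 1"
  unfolding box_bump_def by (auto intro!: prod_nonneg prod_le_1 simp: flat_one_bounds)

text \<open>A product of two negative differences would be positive as well; it requires
  \<open>b $ i < a $ i\<close>, which the first assumption excludes.\<close>

lemma box_bump_outside:
  assumes "\<And>i. a $ i < b $ i" "x \<notin> box a b"
  shows "box_bump a b m x = 0"
proof -
  obtain i where i: "\<not> (a $ i < x $ i \<and> x $ i < b $ i)" using assms(2) by (auto simp: mem_box_cart)
  then have "(x $ i - a $ i) * (b $ i - x $ i) \<le> 0"
    using assms(1)[of i] by (auto simp: mult_le_0_iff)
  then have "real m * ((x $ i - a $ i) * (b $ i - x $ i)) \<le> 0" by (simp add: mult_nonneg_nonpos)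
  then have "flat 1 (real m * ((x $ i - a $ i) * (b $ i - x $ i))) = 0" by (simp add: flat_def)
  then show ?thesis unfolding box_bump_def by (intro prod_zero) auto
qed

lemma box_bump_inside:
  assumes x: "x \<in> box a b"
  shows "(\<lambda>m. box_bump a b m x) \<longlonglongrightarrow> 1"
proof -
  have "(\<lambda>m. flat 1 (real m * ((x $ i - a $ i) * (b $ i - x $ i)))) \<longlonglongrightarrow> 1" for i
  proof -
    define s where "s = (x $ i - a $ i) * (b $ i - x $ i)"
    have s: "s > 0" using x by (auto simp: s_def mem_box_cart)
    have "(\<lambda>m. exp (- (inverse (real m) * inverse s))) \<longlonglongrightarrow> exp (- (0 * inverse s))"
      by (intro tendsto_intros lim_inverse_n)
    then have "(\<lambda>m. exp (- (inverse (real m) * inverse s))) \<longlonglongrightarrow> 1" by simp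
    moreover have "eventually (\<lambda>m. exp (- (inverse (real m) * inverse s)) = flat 1 (real m * s)) sequentially"
      using eventually_gt_at_top[of 0] by eventually_elim (use s in \<open>auto simp: flat_def field_simps\<close>)
    ultimately show ?thesis unfolding s_def by (rule Lim_transform_eventually)
  qed
  then have "(\<lambda>m. box_bump a b m x) \<longlonglongrightarrow> (\<Prod>i\<in>(UNIV::'a set). 1)"
    unfolding box_bump_def by (intro tendsto_prod)
  then show ?thesis by simp
qed

lemma box_bump_test_function:
  assumes "\<And>i. a $ i < b $ i" "cbox a b \<subseteq> \<Omega>"
  shows "box_bump a b m \<in> test_functions \<Omega>"
proof -
  have s: "{x. box_bump a b m x \<noteq> 0} \<subseteq> cbox a b"
    using box_bump_outside[OF assms(1)] box_subset_cbox by blast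
  then have "closure {x. box_bump a b m x \<noteq> 0} \<subseteq> \<Omega>"
    using assms(2) closure_minimal[OF s closed_cbox] by blast
  moreover have "compact (closure {x. box_bump a b m x \<noteq> 0})"
    using bounded_subset[OF bounded_cbox s] by simp
  ultimately show ?thesis using smooth_box_bump by (simp add: test_functions_def)
qed

text \<open>Boxes are an intersection-stable generator of the Borel sets, so a Dynkin argument makes
  the integral of \<open>h\<close> over every Borel set vanish. Lebesgue sets differ from Borel sets
  by null sets, and the integrals over all of them determine \<open>h\<close> almost
  everywhere.\<close>

lemma zero_box_integrals_imp_AE_zero:
  fixes h :: "'a::euclidean_space \<Rightarrow> real"
  assumes h: "integrable lebesgue h"
    and 0: "\<And>a b. set_lebesgue_integral lebesgue (box a b) h = 0"
  shows "AE x in lebesgue. h x = 0"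
proof -
  let ?I = "set_lebesgue_integral lebesgue"
  have si: "set_integrable lebesgue A h" if "A \<in> sets lebesgue" for A
    unfolding set_integrable_def using h that by (intro integrable_mult_indicator)
  \<comment> \<open>The complement step of the Dynkin induction needs the integral over the whole
    space, obtained by exhausting it with boxes.\<close>
  have total: "integral\<^sup>L lebesgue h = 0"
  proof -
    let ?A = "\<lambda>n::nat. box (- (real n *\<^sub>R One)) (real n *\<^sub>R One) :: 'a set"
    have "(\<lambda>n. ?I (?A n) h) \<longlonglongrightarrow> integral\<^sup>L lebesgue h"
      unfolding set_lebesgue_integral_def
    proof (rule integral_dominated_convergence)
      show "AE x in lebesgue. (\<lambda>n. indicat_real (?A n) x *\<^sub>R h x) \<longlonglongrightarrow> h x"
      proof (rule AE_I2)
        fix x :: 'a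
        obtain n0 where n0: "x \<in> ?A n0" using UN_box_eq_UNIV by blast
        have "x \<in> ?A n" if "n \<ge> n0" for n
        proof -
          have "real n0 \<le> real n" using that by simp
          then show ?thesis using n0 by (force simp: mem_box)
        qed
        then have "eventually (\<lambda>n. h x = indicat_real (?A n) x *\<^sub>R h x) sequentially"
          by (auto simp: eventually_sequentially intro!: exI[of _ n0])
        then show "(\<lambda>n. indicat_real (?A n) x *\<^sub>R h x) \<longlonglongrightarrow> h x"
          by (rule Lim_transform_eventually[OF tendsto_const])
      qed
      show "integrable lebesgue (\<lambda>x. norm (h x))" using h by simp
      show "h \<in> borel_measurable lebesgue" using h by simp
      show "(\<lambda>x. indicat_real (?A n) x *\<^sub>R h x) \<in> borel_measurable lebesgue" for n
        using si[of "?A n"] unfolding set_integrable_def by simp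
    qed (auto simp: indicator_def)
    then show ?thesis using 0 by (simp add: LIMSEQ_const_iff)
  qed
  have borel0: "?I A h = 0" if "A \<in> sets borel" for A
  proof -
    let ?G = "range (\<lambda>(a, b). box a b :: 'a set)"
    have sb: "sets (borel :: 'a measure) = sigma_sets UNIV ?G" by (subst borel_eq_box) simp
    then have bl: "A \<in> sets lebesgue" if "A \<in> sigma_sets UNIV ?G" for A using that by simp
    have "A \<in> sigma_sets UNIV ?G" using that sb by simp
    then show ?thesis
    proof (rule sigma_sets_induct_disjoint[rotated 2])
      show "Int_stable ?G" by (auto simp: Int_stable_def box_Int_box)
    next
      show "?I A h = 0" if "A \<in> ?G" for A using that 0 by auto
      show "?I {} h = 0" by (simp add: set_lebesgue_integral_def)
      fix A assume A: "A \<in> sigma_sets UNIV ?G" "?I A h = 0"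
      have "?I (A \<union> (UNIV - A)) h
          = ?I A h + ?I (UNIV - A) h"
        using bl[OF A(1)] by (intro set_integral_Un si) auto
      moreover have "A \<union> (UNIV - A) = UNIV" by blast
      ultimately show "?I (UNIV - A) h = 0"
        using total A(2) by (simp add: set_lebesgue_integral_def)
    next
      fix A :: "nat \<Rightarrow> 'a set"
      assume A: "disjoint_family A" "range A \<subseteq> sigma_sets UNIV ?G"
        "\<And>i. ?I (A i) h = 0"
      have m: "A i \<in> sets lebesgue" for i using bl A(2) by blast
      then have "?I (\<Union>i. A i) h = (\<Sum>i. ?I (A i) h)"
        using A(1) by (intro lebesgue_integral_countable_add si) (auto simp: disjoint_family_on_def)
      then show "?I (\<Union>i. A i) h = 0" using A(3) by simp
    qed simp
  qed
  have "AE x in lebesgue. h x = (\<lambda>x. 0) x"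
  proof (rule density_unique_real)
    fix A :: "'a set" assume A: "A \<in> sets lebesgue"
    \<comment> \<open>A Lebesgue set is a Borel set up to a null set, and the integral does not see
      the difference.\<close>
    then obtain B N N' where B: "A = B \<union> N" "N \<subseteq> N'" "N' \<in> null_sets lborel" "B \<in> sets lborel"
      by (rule sets_completionE)
    have N: "N' \<in> null_sets lebesgue" using B(3) by (simp add: null_sets_completionI)
    have "AE x in lebesgue. x \<in> A \<longleftrightarrow> x \<in> B"
      using AE_not_in[OF N] by eventually_elim (use B in auto)
    then have "?I A h = ?I B h"
      using si[OF A] si[of B] B(4)
      by (intro set_integral_cong_set) (auto simp: set_borel_measurable_def set_integrable_def)
    then show "?I A h = ?I A (\<lambda>x. 0)"
      using borel0 B(4) by simp
  qed (use h in auto)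
  then show ?thesis by simp
qed

text \<open>Bump functions converge boundedly to indicators of boxes, so integrals over boxes whose
  closure lies in the domain vanish by dominated convergence. The conclusion is local, and countably
  many closed boxes fill an open set.\<close>

lemma du_Bois_Reymond:
  fixes g :: "real ^ 'n::finite \<Rightarrow> real"
  assumes \<Omega>: "open \<Omega>" and g: "integrable (lebesgue_on \<Omega>) g"
    and 0: "\<And>\<phi>. \<phi> \<in> test_functions \<Omega> \<Longrightarrow> (\<integral>x. g x * \<phi> x \<partial>lebesgue_on \<Omega>) = 0"
  shows "AE x in lebesgue_on \<Omega>. g x = 0"
proof -
  have \<Omega>m: "\<Omega> \<in> sets lebesgue" using \<Omega> by simp
  define G where "G x = indicat_real \<Omega> x *\<^sub>R g x" for x
  have G: "integrable lebesgue G"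
    unfolding G_def using integrable_restrict_space[of \<Omega> lebesgue g] g \<Omega>m by simp
  have int_eq: "(\<integral>x. g x * \<phi> x \<partial>lebesgue_on \<Omega>) = (\<integral>x. G x * \<phi> x \<partial>lebesgue)" for \<phi>
    by (subst integral_restrict_space) (use \<Omega>m in \<open>auto simp: G_def mult.assoc\<close>)
  have small: "set_lebesgue_integral lebesgue (box a b) G = 0" if sub: "cbox a b \<subseteq> \<Omega>" for a b
  proof (cases "box a b = {}")
    case True
    then show ?thesis by (simp add: set_lebesgue_integral_def)
  next
    case False
    then obtain y where "y \<in> box a b" by blast
    then have ab: "a $ i < b $ i" for i by (meson mem_box_cart(1) less_trans)
    have lim: "(\<lambda>m. \<integral>x. G x * box_bump a b m x \<partial>lebesgue) \<longlonglongrightarrow>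
        (\<integral>x. indicat_real (box a b) x *\<^sub>R G x \<partial>lebesgue)"
    proof (rule integral_dominated_convergence)
      have "continuous_on UNIV (box_bump a b m)" for m
        using smooth_box_bump[of a b m] unfolding smooth_def by (metis k_times_diff.simps(1))
      then have [measurable]: "box_bump a b m \<in> borel_measurable lebesgue" for m
        by (simp add: borel_measurable_continuous_onI measurable_completion)
      have [measurable]: "G \<in> borel_measurable lebesgue" using G by simp
      show "(\<lambda>x. G x * box_bump a b m x) \<in> borel_measurable lebesgue" for m by measurable
      show "(\<lambda>x. indicat_real (box a b) x *\<^sub>R G x) \<in> borel_measurable lebesgue"
        by (intro borel_measurable_scaleR borel_measurable_indicator) auto
      show "integrable lebesgue (\<lambda>x. norm (G x))" using G by simp
      show "AE x in lebesgue. (\<lambda>m. G x * box_bump a b m x) \<longlonglongrightarrow> indicat_real (box a b) x *\<^sub>R G x"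
      proof (rule AE_I2)
        fix x
        show "(\<lambda>m. G x * box_bump a b m x) \<longlonglongrightarrow> indicat_real (box a b) x *\<^sub>R G x"
        proof (cases "x \<in> box a b")
          case True
          have "(\<lambda>m. G x * box_bump a b m x) \<longlonglongrightarrow> G x * 1"
            by (intro tendsto_intros box_bump_inside True)
          then show ?thesis using True by simp
        next
          case False
          then show ?thesis using box_bump_outside[OF ab False] by simp
        qed
      qed
      show "AE x in lebesgue. norm (G x * box_bump a b m x) \<le> norm (G x)" for m
        using box_bump_bounds[of a b m] by (intro AE_I2) (simp add: abs_mult mult_left_le)
    qed
    have "(\<integral>x. G x * box_bump a b m x \<partial>lebesgue) = 0" for m
      using 0[OF box_bump_test_function[OF ab sub]] int_eq by simp
    with lim show ?thesis by (simp add: LIMSEQ_const_iff set_lebesgue_integral_def)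
  qed
  have cb: "AE x in lebesgue. x \<in> cbox c d \<longrightarrow> G x = 0" if sub: "cbox c d \<subseteq> \<Omega>" for c d
  proof -
    \<comment> \<open>Cutting off to \<open>box c d\<close> makes arbitrary boxes admissible:
      intersected with it they become boxes with closure inside the domain, or empty.\<close>
    define h where "h x = indicat_real (box c d) x *\<^sub>R G x" for x
    have "integrable lebesgue h"
      unfolding h_def using G by (intro integrable_mult_indicator) auto
    moreover have "set_lebesgue_integral lebesgue (box a b) h = 0" for a b
    proof -
      define a' b' :: "real ^ 'n" where "a' = (\<chi> i. max (a $ i) (c $ i))" and "b' = (\<chi> i. min (b $ i) (d $ i))"
      have eq: "box a b \<inter> box c d = box a' b'" by (auto simp: a'_def b'_def mem_box_cart)
      have "cbox a' b' \<subseteq> cbox c d" by (auto simp: a'_def b'_def mem_box_cart)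
      then have "set_lebesgue_integral lebesgue (box a' b') G = 0" using small sub by blast
      moreover have "set_lebesgue_integral lebesgue (box a b) h = set_lebesgue_integral lebesgue (box a' b') G"
        unfolding set_lebesgue_integral_def h_def eq[symmetric]
        by (intro Bochner_Integration.integral_cong) (auto simp: indicator_def)
      ultimately show ?thesis by simp
    qed
    ultimately have "AE x in lebesgue. h x = 0" by (rule zero_box_integrals_imp_AE_zero)
    moreover have "AE x in lebesgue. x \<notin> cbox c d - box c d"
      by (rule AE_not_in[OF negligible_frontier_interval[unfolded negligible_iff_null_sets]])
    ultimately show ?thesis by eventually_elim (auto simp: h_def)
  qed
  obtain \<D> where \<D>: "countable \<D>" "\<D> \<subseteq> Pow \<Omega>" "\<And>X. X \<in> \<D> \<Longrightarrow> \<exists>a b. X = cbox a b" "\<Union>\<D> = \<Omega>"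
    using open_countable_Union_open_cbox[OF \<Omega>] by metis
  have "AE x in lebesgue. x \<in> X \<longrightarrow> G x = 0" if "X \<in> \<D>" for X
    using cb \<D>(2,3) that by (metis PowD subsetD)
  then have "AE x in lebesgue. \<forall>X\<in>\<D>. x \<in> X \<longrightarrow> G x = 0"
    unfolding AE_ball_countable[OF \<D>(1)] by blast
  then have "AE x in lebesgue. x \<in> \<Omega> \<longrightarrow> g x = 0"
    by eventually_elim (use \<D>(4) in \<open>auto simp: G_def indicator_def split: if_splits\<close>)
  then show ?thesis using \<Omega>m by (simp add: AE_restrict_space_iff)
qed

section \<open>Almost everywhere linear maps into \<open>L\<^sup>2\<close>\<close>

text \<open>Weak gradients, and with them strains and stresses, respect sums and multiples only up
  to null sets; this suffices for bilinearity of integral forms.\<close>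

definition ae_linear ::
  "'m measure \<Rightarrow> 'a::real_vector set \<Rightarrow> ('a \<Rightarrow> 'm \<Rightarrow> 'b::euclidean_space) \<Rightarrow> bool" where
  "ae_linear M V T \<longleftrightarrow> (\<forall>u\<in>V. T u \<in> L2 M) \<and>
     (\<forall>u\<in>V. \<forall>v\<in>V. AE x in M. T (u + v) x = T u x + T v x) \<and>
     (\<forall>c. \<forall>v\<in>V. AE x in M. T (c *\<^sub>R v) x = c *\<^sub>R T v x)"

lemma ae_linear_L2: "ae_linear M V T \<Longrightarrow> u \<in> V \<Longrightarrow> T u \<in> L2 M"
  by (simp add: ae_linear_def)

lemma ae_linear_id: "ae_linear M (L2 M) (\<lambda>u. u)"
  by (simp add: ae_linear_def plus_fun_def scaleR_fun_def)

lemma ae_linear_subset: "ae_linear M V T \<Longrightarrow> V' \<subseteq> V \<Longrightarrow> ae_linear M V' T"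
  unfolding ae_linear_def by blast

lemma L2_inner_cong_AE:
  assumes "f \<in> L2 M" "f' \<in> L2 M" "g \<in> L2 M" "AE x in M. f x = f' x"
  shows "L2_inner M f g = L2_inner M f' g" "L2_inner M g f = L2_inner M g f'"
proof -
  have [measurable]: "f \<in> borel_measurable M" "f' \<in> borel_measurable M" "g \<in> borel_measurable M"
    using assms L2_measurable by auto
  show "L2_inner M f g = L2_inner M f' g" "L2_inner M g f = L2_inner M g f'"
    unfolding L2_inner_def by (intro integral_cong_AE; use assms(4) in auto)+
qed

lemma bilin_on_L2_inner:
  fixes T :: "'a::real_vector \<Rightarrow> 'm \<Rightarrow> 'b::euclidean_space"
  assumes V: "subspace V" and T: "ae_linear M V T" and S: "ae_linear M V S"
  shows "bilin_on V V (\<lambda>u v. L2_inner M (T u) (S v))"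
proof -
  interpret semi_inner "L2 M :: ('m \<Rightarrow> 'b) set" "L2_inner M" by (rule L2_semi_inner)
  have L: "T u \<in> L2 M" "S u \<in> L2 M" if "u \<in> V" for u using T S that by (auto simp: ae_linear_def)
  note VI = subspace_add[OF V] subspace_scale[OF V]
  have "L2_inner M (T (u + v)) (S w) = L2_inner M (T u) (S w) + L2_inner M (T v) (S w)"
    "L2_inner M (T w) (S (u + v)) = L2_inner M (T w) (S u) + L2_inner M (T w) (S v)"
    if u: "u \<in> V" and v: "v \<in> V" and w: "w \<in> V" for u v w
  proof -
    have "AE x in M. T (u + v) x = (T u + T v) x" "AE x in M. S (u + v) x = (S u + S v) x"
      using T S u v by (auto simp: ae_linear_def)
    then show "L2_inner M (T (u + v)) (S w) = L2_inner M (T u) (S w) + L2_inner M (T v) (S w)"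
      "L2_inner M (T w) (S (u + v)) = L2_inner M (T w) (S u) + L2_inner M (T w) (S v)"
      using L2_inner_cong_AE(1)[of "T (u + v)" M "T u + T v" "S w"]
        L2_inner_cong_AE(2)[of "S (u + v)" M "S u + S v" "T w"] L VI closed u v w
      by (simp_all add: add_left add_right)
  qed
  moreover have "L2_inner M (T (c *\<^sub>R v)) (S w) = c * L2_inner M (T v) (S w)"
    "L2_inner M (T w) (S (c *\<^sub>R v)) = c * L2_inner M (T w) (S v)"
    if v: "v \<in> V" and w: "w \<in> V" for c v w
  proof -
    have "AE x in M. T (c *\<^sub>R v) x = (c *\<^sub>R T v) x" "AE x in M. S (c *\<^sub>R v) x = (c *\<^sub>R S v) x"
      using T S v by (auto simp: ae_linear_def scaleR_fun_def)
    then show "L2_inner M (T (c *\<^sub>R v)) (S w) = c * L2_inner M (T v) (S w)"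
      "L2_inner M (T w) (S (c *\<^sub>R v)) = c * L2_inner M (T w) (S v)"
      using L2_inner_cong_AE(1)[of "T (c *\<^sub>R v)" M "c *\<^sub>R T v" "S w"]
        L2_inner_cong_AE(2)[of "S (c *\<^sub>R v)" M "c *\<^sub>R S v" "T w"] L VI closed v w
      by (simp_all add: scale_left scale_right)
  qed
  ultimately show ?thesis by (simp add: bilin_on_def lin_on_def)
qed

lemma L2_compose:
  fixes f :: "'m \<Rightarrow> 'b::euclidean_space" and L :: "'m \<Rightarrow> 'b \<Rightarrow> 'c::euclidean_space"
  assumes f: "f \<in> L2 M" and meas: "(\<lambda>x. L x (f x)) \<in> borel_measurable M" and K: "K \<ge> 0"
    and bd: "AE x in M. \<forall>y. norm (L x y) \<le> K * norm y"
  shows "(\<lambda>x. L x (f x)) \<in> L2 M" "L2_norm M (\<lambda>x. L x (f x)) \<le> K * L2_norm M f"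
proof -
  have ae: "AE x in M. (norm (L x (f x)))\<^sup>2 \<le> K\<^sup>2 * (norm (f x))\<^sup>2"
    using bd
  proof eventually_elim
    case (elim x)
    have "(norm (L x (f x)))\<^sup>2 \<le> (K * norm (f x))\<^sup>2" using elim by (intro power_mono) auto
    then show ?case by (simp add: power_mult_distrib)
  qed
  show 1: "(\<lambda>x. L x (f x)) \<in> L2 M"
    by (rule L2_bound[OF meas _ ae]) (use L2_integrable_sq[OF f] in simp)
  have "(L2_norm M (\<lambda>x. L x (f x)))\<^sup>2 \<le> (\<integral>x. K\<^sup>2 * (norm (f x))\<^sup>2 \<partial>M)"
    unfolding L2_norm_sq using L2_integrable_sq[OF f] L2_integrable_sq[OF 1] ae
    by (intro integral_mono_AE) auto
  also have "\<dots> = (K * L2_norm M f)\<^sup>2" by (simp add: power_mult_distrib L2_norm_sq)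
  finally show "L2_norm M (\<lambda>x. L x (f x)) \<le> K * L2_norm M f"
    by (rule power2_le_imp_le) (simp add: K L2_norm_nonneg)
qed

text \<open>The linear map may depend on the point, so symmetrisation, contraction with the
  elasticity tensor and multiplication by the density are all instances.\<close>

lemma ae_linear_compose:
  fixes T :: "'a::real_vector \<Rightarrow> 'm \<Rightarrow> 'b::euclidean_space" and L :: "'m \<Rightarrow> 'b \<Rightarrow> 'c::euclidean_space"
  assumes T: "ae_linear M V T" and K: "K \<ge> 0"
    and meas: "\<And>f. f \<in> borel_measurable M \<Longrightarrow> (\<lambda>x. L x (f x)) \<in> borel_measurable M"
    and lin: "AE x in M. linear (L x)" and bd: "AE x in M. \<forall>y. norm (L x y) \<le> K * norm y"
  shows "ae_linear M V (\<lambda>u x. L x (T u x))"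
    "u \<in> V \<Longrightarrow> L2_norm M (\<lambda>x. L x (T u x)) \<le> K * L2_norm M (T u)"
proof -
  have L2: "T u \<in> L2 M" if "u \<in> V" for u using T that by (simp add: ae_linear_def)
  show "u \<in> V \<Longrightarrow> L2_norm M (\<lambda>x. L x (T u x)) \<le> K * L2_norm M (T u)"
    using L2_compose(2)[OF L2 meas K bd] L2_measurable[OF L2] by blast
  show "ae_linear M V (\<lambda>u x. L x (T u x))"
    unfolding ae_linear_def
  proof (intro conjI ballI allI)
    show "(\<lambda>x. L x (T u x)) \<in> L2 M" if "u \<in> V" for u
      using L2_compose(1)[OF L2 meas K bd] L2_measurable[OF L2] that by blast
    show "AE x in M. L x (T (u + v) x) = L x (T u x) + L x (T v x)" if "u \<in> V" "v \<in> V" for u v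
    proof -
      have "AE x in M. T (u + v) x = T u x + T v x" using T that by (simp add: ae_linear_def)
      with lin show ?thesis by eventually_elim (simp add: linear_add)
    qed
    show "AE x in M. L x (T (c *\<^sub>R v) x) = c *\<^sub>R L x (T v x)" if "v \<in> V" for c v
    proof -
      have "AE x in M. T (c *\<^sub>R v) x = c *\<^sub>R T v x" using T that by (simp add: ae_linear_def)
      with lin show ?thesis by eventually_elim (simp add: linear_scale)
    qed
  qed
qed

section \<open>The Sobolev space as a Hilbert space\<close>

locale bounded_domain =
  fixes \<Omega> :: "(real ^ 'n::finite) set"
  assumes open_domain: "open \<Omega>" and bounded_domain: "bounded \<Omega>"
begin

abbreviation "M \<equiv> lebesgue_on \<Omega>"
abbreviation "V1 \<equiv> H1 \<Omega>"
abbreviation "n1 \<equiv> H1_norm \<Omega>"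
abbreviation "grad \<equiv> weak_grad \<Omega>"

lemma domain_measurable: "\<Omega> \<in> sets lebesgue"
  using open_domain by simp

lemma finite_measure_M: "finite_measure M"
  by (intro finite_measure_lebesgue_on bounded_set_imp_lmeasurable bounded_domain domain_measurable)

lemma continuous_measurable:
  "continuous_on UNIV f \<Longrightarrow> (f :: _ \<Rightarrow> 'b::euclidean_space) \<in> borel_measurable M"
  using continuous_imp_measurable_on_sets_lebesgue[OF continuous_on_subset domain_measurable] by blast

lemma compactly_supported_L2:
  fixes \<psi> :: "real ^ 'n \<Rightarrow> real"
  assumes "continuous_on UNIV \<psi>" "compact S" "\<And>x. x \<notin> S \<Longrightarrow> \<psi> x = 0"
  shows "(\<lambda>x. \<psi> x *\<^sub>R (e :: 'b::euclidean_space)) \<in> L2 M"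
proof -
  have "bounded (\<psi> ` S)"
    by (intro compact_imp_bounded compact_continuous_image continuous_on_subset[OF assms(1)] assms(2)) auto
  then obtain K where K: "\<And>x. x \<in> S \<Longrightarrow> \<bar>\<psi> x\<bar> \<le> K" by (auto simp: bounded_iff)
  have "\<bar>\<psi> x\<bar> \<le> \<bar>K\<bar>" for x using K[of x] assms(3)[of x] by (cases "x \<in> S") auto
  then have "norm (\<psi> x *\<^sub>R e) \<le> \<bar>K\<bar> * norm e" for x by (simp add: mult_right_mono)
  then show ?thesis
    by (intro L2_bounded_finite_measure[OF finite_measure_M, where K="\<bar>K\<bar> * norm e"]
        continuous_measurable continuous_intros assms(1)) auto
qed

lemma test_function_L2:
  assumes \<phi>: "\<phi> \<in> test_functions \<Omega>"
  shows "(\<lambda>x. \<phi> x *\<^sub>R (e :: 'b::euclidean_space)) \<in> L2 M"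
    "(\<lambda>x. frechet_derivative \<phi> (at x) (axis j 1) *\<^sub>R (e :: 'b)) \<in> L2 M"
proof -
  define S where "S = closure {x. \<phi> x \<noteq> 0}"
  have S: "compact S" "closed S" and sm: "\<And>k. k_times_diff k \<phi>"
    using \<phi> by (auto simp: S_def test_functions_def smooth_def simp del: compact_closure)
  have out: "\<phi> x = 0" if "x \<notin> S" for x
    using that closure_subset[of "{x. \<phi> x \<noteq> 0}"] unfolding S_def by blast
  show "(\<lambda>x. \<phi> x *\<^sub>R e) \<in> L2 M"
    by (rule compactly_supported_L2[OF _ S(1) out]) (use sm[of 0] in simp_all)
  have d0: "frechet_derivative \<phi> (at x) = (\<lambda>_. 0)" if x: "x \<notin> S" for x
  proof (rule frechet_derivative_at[symmetric])
    have "((\<lambda>_. 0) has_derivative (\<lambda>_. 0)) (at x)" by simp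
    then show "(\<phi> has_derivative (\<lambda>_. 0)) (at x)"
      by (rule has_derivative_transform_within_open[where s="- S"]) (use x S(2) out in auto)
  qed
  have "axis j (1::real) \<in> Basis" by (simp add: axis_in_Basis_iff)
  then have "continuous_on UNIV (\<lambda>x. frechet_derivative \<phi> (at x) (axis j 1))"
    using k_times_diff_SucD(2)[OF sm[of "Suc 0"]] by simp
  then show "(\<lambda>x. frechet_derivative \<phi> (at x) (axis j 1) *\<^sub>R e) \<in> L2 M"
    by (rule compactly_supported_L2[OF _ S(1)]) (simp add: d0)
qed

text \<open>Both sides become \<open>L\<^sup>2\<close> pairings with fixed fields, so that linearity
  and stability under \<open>L\<^sup>2\<close> limits follow from those of the inner
  product.\<close>

lemma is_weak_grad_iff:
  "is_weak_grad \<Omega> v G \<longleftrightarrow> (\<forall>\<phi>\<in>test_functions \<Omega>. \<forall>i j.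
     L2_inner M v (\<lambda>x. frechet_derivative \<phi> (at x) (axis j 1) *\<^sub>R axis i 1) =
     - L2_inner M G (\<lambda>x. \<phi> x *\<^sub>R axis i (axis j 1)))"
  unfolding is_weak_grad_def L2_inner_def by (simp add: inner_axis mult.commute)

sublocale LV: semi_inner "L2 M :: 'n vfield set" "L2_inner M" by (rule L2_semi_inner)
sublocale LM: semi_inner "L2 M :: 'n mfield set" "L2_inner M" by (rule L2_semi_inner)

lemma is_weak_grad_add:
  assumes "u \<in> L2 M" "v \<in> L2 M" "G \<in> L2 M" "G' \<in> L2 M" "is_weak_grad \<Omega> u G" "is_weak_grad \<Omega> v G'"
  shows "is_weak_grad \<Omega> (u + v) (G + G')"
  using assms unfolding is_weak_grad_iff
  by (simp add: LV.add_left[OF test_function_L2(2)] LM.add_left[OF test_function_L2(1)])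

lemma is_weak_grad_scale:
  assumes "u \<in> L2 M" "G \<in> L2 M" "is_weak_grad \<Omega> u G"
  shows "is_weak_grad \<Omega> (c *\<^sub>R u) (c *\<^sub>R G)"
  using assms unfolding is_weak_grad_iff
  by (simp add: LV.scale_left[OF test_function_L2(2)] LM.scale_left[OF test_function_L2(1)])

lemma is_weak_grad_zero: "is_weak_grad \<Omega> 0 0"
  by (simp add: is_weak_grad_def)

lemma is_weak_grad_unique:
  assumes "G \<in> L2 M" "G' \<in> L2 M" "is_weak_grad \<Omega> v G" "is_weak_grad \<Omega> v G'"
  shows "AE x in M. G x = G' x"
proof -
  have "AE x in M. (G - G') x $ i $ j = 0" for i j
  proof (rule du_Bois_Reymond[OF open_domain])
    have D: "G - G' \<in> L2 M" using assms LM.closed(2) by blast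
    \<comment> \<open>Pairing with this constant matrix extracts one entry and yields its
      integrability; constants lie in \<open>L2 M\<close> because the domain has finite
      measure.\<close>
    have "(\<lambda>x. axis i (axis j 1)) \<in> L2 M"
      using finite_measure_M by (intro L2_bounded_finite_measure[where K="norm (axis i (axis j 1))"]) auto
    from L2_inner_integrable[OF D this] show "integrable M (\<lambda>x. (G - G') x $ i $ j)"
      by (simp add: inner_axis)
    fix \<phi> assume \<phi>: "\<phi> \<in> test_functions \<Omega>"
    have "(\<integral>x. (G - G') x $ i $ j * \<phi> x \<partial>M) = L2_inner M (G - G') (\<lambda>x. \<phi> x *\<^sub>R axis i (axis j 1))"
      by (simp add: L2_inner_def inner_axis mult.commute)
    also have "\<dots> = 0"
      using assms \<phi> unfolding is_weak_grad_iff by (simp add: LM.diff_left[OF test_function_L2(1)[OF \<phi>]])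
    finally show "(\<integral>x. (G - G') x $ i $ j * \<phi> x \<partial>M) = 0" .
  qed
  then have "AE x in M. \<forall>i j. (G - G') x $ i $ j = 0" by (simp add: AE_all_countable)
  then show ?thesis by eventually_elim (simp add: vec_eq_iff)
qed

lemma weak_grad:
  assumes "v \<in> V1"
  shows "v \<in> L2 M" "grad v \<in> L2 M" "is_weak_grad \<Omega> v (grad v)"
proof -
  show "v \<in> L2 M" using assms by (simp add: H1_def)
  have "\<exists>G. G \<in> L2 M \<and> is_weak_grad \<Omega> v G" using assms by (auto simp: H1_def)
  from someI_ex[OF this] show "grad v \<in> L2 M" "is_weak_grad \<Omega> v (grad v)"
    by (simp_all add: weak_grad_def)
qed

lemma weak_grad_eqI:
  assumes "v \<in> L2 M" "G \<in> L2 M" "is_weak_grad \<Omega> v G"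
  shows "v \<in> V1" "AE x in M. grad v x = G x"
proof -
  show v: "v \<in> V1" using assms by (auto simp: H1_def)
  show "AE x in M. grad v x = G x"
    using is_weak_grad_unique[OF _ assms(2) _ assms(3)] weak_grad[OF v] by blast
qed

lemma H1_add:
  assumes "u \<in> V1" "v \<in> V1"
  shows "u + v \<in> V1" "AE x in M. grad (u + v) x = grad u x + grad v x"
proof -
  note u = weak_grad[OF assms(1)] and v = weak_grad[OF assms(2)]
  note * = weak_grad_eqI[OF LV.closed(1)[OF u(1) v(1)] LM.closed(1)[OF u(2) v(2)]
      is_weak_grad_add[OF u(1) v(1) u(2) v(2) u(3) v(3)]]
  show "u + v \<in> V1" by (rule *)
  show "AE x in M. grad (u + v) x = grad u x + grad v x" using *(2) by simp
qed

lemma H1_scale: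
  assumes "v \<in> V1"
  shows "c *\<^sub>R v \<in> V1" "AE x in M. grad (c *\<^sub>R v) x = c *\<^sub>R grad v x"
proof -
  note v = weak_grad[OF assms]
  note * = weak_grad_eqI[OF LV.closed(3)[OF v(1)] LM.closed(3)[OF v(2)] is_weak_grad_scale[OF v]]
  show "c *\<^sub>R v \<in> V1" by (rule *)
  show "AE x in M. grad (c *\<^sub>R v) x = c *\<^sub>R grad v x"
    using *(2)[of c] by (simp add: scaleR_fun_def)
qed

lemma H1_subspace: "subspace V1"
  using H1_add H1_scale weak_grad_eqI(1)[OF LV.closed(4) LM.closed(4) is_weak_grad_zero]
  by (simp add: subspace_def)

lemma ae_linear_id_H1: "ae_linear M V1 (\<lambda>u. u)"
  by (rule ae_linear_subset[OF ae_linear_id]) (auto simp: H1_def)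

lemma ae_linear_weak_grad: "ae_linear M V1 grad"
  using weak_grad H1_add H1_scale by (auto simp: ae_linear_def)

section \<open>The \<open>H\<^sup>1\<close> inner product and completeness\<close>

definition H1_inner where
  "H1_inner u v = L2_inner M u v + L2_inner M (grad u) (grad v)"

lemma H1_norm_nrm: "n1 = nrm H1_inner"
  by (simp add: H1_norm_def nrm_def H1_inner_def L2_norm_def L2_inner_def fun_eq_iff)

sublocale H1: semi_inner "V1" H1_inner
proof
  have "bilin_on V1 V1
     (\<lambda>u v. L2_inner M u v + 1 * L2_inner M (grad u) (grad v))"
    by (intro bilin_on_sum bilin_on_L2_inner[OF H1_subspace] ae_linear_id_H1 ae_linear_weak_grad)
  then show "bilin_on V1 V1 H1_inner" by (simp add: H1_inner_def[abs_def])
qed (auto simp: H1_subspace H1_inner_def L2_inner_def inner_commute)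

lemma H1_norm_nonneg: "0 \<le> n1 v"
  by (simp add: H1_norm_def)

lemma L2_norm_le_H1_norm: "L2_norm M v \<le> n1 v" "L2_norm M (grad v) \<le> n1 v"
  unfolding H1_norm_def by (auto intro!: real_le_rsqrt)

lemma weak_grad_diff:
  assumes "u \<in> V1" "v \<in> V1"
  shows "AE x in M. grad (u - v) x = grad u x - grad v x"
proof -
  have "AE x in M. grad ((u - v) + v) x = grad (u - v) x + grad v x"
    using assms H1.closed(2) by (intro H1_add)
  then show ?thesis by eventually_elim simp
qed

text \<open>Closedness of the weak gradient: fields and gradients converge separately in
  \<open>L\<^sup>2\<close>, and the defining identity passes to the limit for each fixed test
  function.\<close>

lemma H1_complete: "seq_complete V1 n1"
  unfolding seq_complete_def
proof (intro allI impI, elim conjE)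
  fix X :: "nat \<Rightarrow> 'n vfield"
  assume X: "\<forall>k. X k \<in> V1" and Cau: "\<forall>e>0. \<exists>m. \<forall>i\<ge>m. \<forall>j\<ge>m. n1 (X i - X j) \<le> e"
  have XL: "X k \<in> L2 M" "grad (X k) \<in> L2 M" for k using X weak_grad by auto
  have "L2_norm M (grad (X i) - grad (X j)) = L2_norm M (grad (X i - X j))" for i j
  proof (rule L2_norm_cong_AE)
    show "grad (X i) - grad (X j) \<in> borel_measurable M"
      using L2_measurable[OF LM.closed(2)[OF XL(2) XL(2)]] .
    show "grad (X i - X j) \<in> borel_measurable M"
      using L2_measurable[OF weak_grad(2)[OF H1.closed(2)[OF X[rule_format] X[rule_format]]]] .
    show "AE x in M. (grad (X i) - grad (X j)) x = grad (X i - X j) x"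
      using weak_grad_diff[OF X[rule_format] X[rule_format], of i j] by eventually_elim simp
  qed
  then have le: "L2_norm M (grad (X i) - grad (X j)) \<le> n1 (X i - X j)" for i j
    using L2_norm_le_H1_norm(2) by simp
  have C: "\<exists>m. \<forall>i\<ge>m. \<forall>j\<ge>m. L2_norm M (X i - X j) \<le> e"
    "\<exists>m. \<forall>i\<ge>m. \<forall>j\<ge>m. L2_norm M (grad (X i) - grad (X j)) \<le> e" if e: "e > 0" for e
  proof -
    obtain m where m: "\<forall>i\<ge>m. \<forall>j\<ge>m. n1 (X i - X j) \<le> e" using Cau[rule_format, OF e] ..
    have "L2_norm M (X i - X j) \<le> e \<and> L2_norm M (grad (X i) - grad (X j)) \<le> e"
      if "i \<ge> m" "j \<ge> m" for i j
      using m[rule_format, OF that] L2_norm_le_H1_norm(1)[of "X i - X j"] le[of i j] by simp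
    then show "\<exists>m. \<forall>i\<ge>m. \<forall>j\<ge>m. L2_norm M (X i - X j) \<le> e"
      "\<exists>m. \<forall>i\<ge>m. \<forall>j\<ge>m. L2_norm M (grad (X i) - grad (X j)) \<le> e" by blast+
  qed
  obtain v where v: "v \<in> L2 M" "(\<lambda>k. L2_norm M (X k - v)) \<longlonglongrightarrow> 0"
    using seq_completeE[of _ _ X, OF L2_complete XL(1) C(1)] by blast
  obtain G where G: "G \<in> L2 M" "(\<lambda>k. L2_norm M (grad (X k) - G)) \<longlonglongrightarrow> 0"
    using seq_completeE[of _ _ "\<lambda>k. grad (X k)", OF L2_complete XL(2) C(2)] by blast
  have "is_weak_grad \<Omega> v G"
    unfolding is_weak_grad_iff
  proof (intro ballI allI)
    fix \<phi> and i j :: 'n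
    assume \<phi>: "\<phi> \<in> test_functions \<Omega>"
    let ?p = "\<lambda>x. frechet_derivative \<phi> (at x) (axis j 1) *\<^sub>R axis i (1::real)"
    let ?q = "\<lambda>x. \<phi> x *\<^sub>R axis i (axis j (1::real))"
    note pq = test_function_L2[OF \<phi>]
    have l1: "(\<lambda>k. L2_inner M (X k) ?p) \<longlonglongrightarrow> L2_inner M v ?p"
      by (rule LV.tendsto_ip_left[OF XL(1) v[unfolded L2_norm_nrm] pq(2)])
    have l2: "(\<lambda>k. L2_inner M (grad (X k)) ?q) \<longlonglongrightarrow> L2_inner M G ?q"
      by (rule LM.tendsto_ip_left[OF XL(2) G[unfolded L2_norm_nrm] pq(1)])
    have "L2_inner M (X k) ?p = - L2_inner M (grad (X k)) ?q" for k
      using weak_grad(3)[OF X[rule_format, of k]] \<phi> unfolding is_weak_grad_iff by blast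
    then have "(\<lambda>k. L2_inner M (X k) ?p) \<longlonglongrightarrow> - L2_inner M G ?q" using tendsto_minus[OF l2] by simp
    with l1 show "L2_inner M v ?p = - L2_inner M G ?q" by (rule LIMSEQ_unique)
  qed
  note vG = weak_grad_eqI[OF v(1) G(1) this]
  have "L2_norm M (grad (X k - v)) = L2_norm M (grad (X k) - G)" for k
  proof (rule L2_norm_cong_AE)
    show "AE x in M. grad (X k - v) x = (grad (X k) - G) x"
      using weak_grad_diff[OF X[rule_format, of k] vG(1)] vG(2) by eventually_elim simp
    have "X k - v \<in> V1" using X vG(1) H1.closed(2) by blast
    then show "grad (X k - v) \<in> borel_measurable M" using weak_grad(2) L2_measurable by blast
    show "grad (X k) - G \<in> borel_measurable M" using XL G LM.closed(2) L2_measurable by blast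
  qed
  then have "n1 (X k - v) = sqrt ((L2_norm M (X k - v))\<^sup>2 + (L2_norm M (grad (X k) - G))\<^sup>2)" for k
    by (simp add: H1_norm_def)
  moreover have "(\<lambda>k. sqrt ((L2_norm M (X k - v))\<^sup>2 + (L2_norm M (grad (X k) - G))\<^sup>2)) \<longlonglongrightarrow> sqrt (0\<^sup>2 + 0\<^sup>2)"
    by (intro tendsto_intros v(2) G(2))
  ultimately have "(\<lambda>k. n1 (X k - v)) \<longlonglongrightarrow> 0" by simp
  with vG(1) show "\<exists>v\<in>V1. (\<lambda>k. n1 (X k - v)) \<longlonglongrightarrow> 0" by blast
qed

end

section \<open>Traces\<close>

locale regular = fixes \<Omega> :: "(real ^ 'n::finite) set"
  assumes regular: "regular_domain \<Omega>"
begin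

sublocale bounded_domain \<Omega>
  using regular by (simp add: bounded_domain_def regular_domain_def)

abbreviation "S \<equiv> surface_measure \<Omega>"

lemma traces:
  "smooth \<phi> \<Longrightarrow> has_trace \<Omega> \<phi> \<phi>" "v \<in> V1 \<Longrightarrow> \<exists>g. has_trace \<Omega> v g"
  "\<exists>K. \<forall>v g. has_trace \<Omega> v g \<longrightarrow> L2_norm S g \<le> K * n1 v"
  using regular by (auto simp: regular_domain_def trace_theorem_def)

lemma has_trace_H1: "has_trace \<Omega> v g \<Longrightarrow> v \<in> V1"
  and has_trace_L2: "has_trace \<Omega> v g \<Longrightarrow> g \<in> L2 S"
  by (auto simp: has_trace_def)

lemma smooth_H1: "smooth \<phi> \<Longrightarrow> \<phi> \<in> V1" "smooth \<phi> \<Longrightarrow> \<phi> \<in> L2 S"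
  using traces(1) has_trace_H1 has_trace_L2 by blast+

sublocale LS: semi_inner "L2 S :: 'n vfield set" "L2_inner S" by (rule L2_semi_inner)

lemma nn_integral_tendsto_0_iff:
  fixes X :: "nat \<Rightarrow> 'n vfield"
  assumes "\<And>k. X k \<in> L2 S"
  shows "(\<lambda>k. \<integral>\<^sup>+x. ennreal ((norm (X k x))\<^sup>2) \<partial>S) \<longlonglongrightarrow> 0 \<longleftrightarrow> (\<lambda>k. L2_norm S (X k)) \<longlonglongrightarrow> 0"
proof -
  have "(\<lambda>k. ennreal ((L2_norm S (X k))\<^sup>2)) \<longlonglongrightarrow> ennreal 0 \<longleftrightarrow> (\<lambda>k. (L2_norm S (X k))\<^sup>2) \<longlonglongrightarrow> 0"
    by (intro tendsto_ennreal_iff) auto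
  also have "\<dots> \<longleftrightarrow> (\<lambda>k. L2_norm S (X k)) \<longlonglongrightarrow> 0"
  proof
    assume "(\<lambda>k. (L2_norm S (X k))\<^sup>2) \<longlonglongrightarrow> 0"
    then have "(\<lambda>k. sqrt ((L2_norm S (X k))\<^sup>2)) \<longlonglongrightarrow> sqrt 0" by (rule tendsto_real_sqrt)
    then show "(\<lambda>k. L2_norm S (X k)) \<longlonglongrightarrow> 0" by (simp add: L2_norm_nonneg)
  next
    assume "(\<lambda>k. L2_norm S (X k)) \<longlonglongrightarrow> 0"
    then have "(\<lambda>k. (L2_norm S (X k))\<^sup>2) \<longlonglongrightarrow> 0\<^sup>2" by (rule tendsto_power)
    then show "(\<lambda>k. (L2_norm S (X k))\<^sup>2) \<longlonglongrightarrow> 0" by simp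
  qed
  finally show ?thesis using L2_norm_nn_integral[OF assms] by simp
qed

text \<open>Smooth fields lie in \<open>L2 S\<close> by the trace theorem, so the extended integral
  of the definition can be replaced by a seminorm, for which the triangle inequality is at
  hand.\<close>

lemma has_trace_iff:
  "has_trace \<Omega> v g \<longleftrightarrow> v \<in> V1 \<and> g \<in> L2 S \<and>
     (\<exists>\<phi>. (\<forall>k. smooth (\<phi> k)) \<and> (\<lambda>k. n1 (\<phi> k - v)) \<longlonglongrightarrow> 0 \<and> (\<lambda>k. L2_norm S (\<phi> k - g)) \<longlonglongrightarrow> 0)"
proof -
  have "(\<lambda>k. \<integral>\<^sup>+x. ennreal ((norm (\<phi> k x - g x))\<^sup>2) \<partial>S) \<longlonglongrightarrow> 0 \<longleftrightarrow> (\<lambda>k. L2_norm S (\<phi> k - g)) \<longlonglongrightarrow> 0"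
    if "g \<in> L2 S" "\<forall>k. smooth (\<phi> k)" for \<phi> :: "nat \<Rightarrow> 'n vfield"
    using nn_integral_tendsto_0_iff[of "\<lambda>k. \<phi> k - g"] LS.closed(2)[OF smooth_H1(2) that(1)] that(2)
    by (simp add: fun_diff_def)
  then show ?thesis unfolding has_trace_def by (auto simp: fun_diff_def)
qed

lemma smooth_add: "smooth f \<Longrightarrow> smooth g \<Longrightarrow> smooth (f + g)"
  by (simp add: smooth_def plus_fun_def k_times_diff_add)

lemma smooth_scaleR: "smooth f \<Longrightarrow> smooth (c *\<^sub>R f)"
  by (simp add: smooth_def scaleR_fun_def k_times_diff_scaleR)

lemma smooth_zero: "smooth 0"
  by (simp add: smooth_def zero_fun_def k_times_diff_const)

lemma has_trace_add:
  assumes "has_trace \<Omega> v g" "has_trace \<Omega> v' g'"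
  shows "has_trace \<Omega> (v + v') (g + g')"
proof -
  obtain \<phi> \<phi>' where \<phi>: "\<forall>k. smooth (\<phi> k)" "(\<lambda>k. n1 (\<phi> k - v)) \<longlonglongrightarrow> 0" "(\<lambda>k. L2_norm S (\<phi> k - g)) \<longlonglongrightarrow> 0"
    and \<phi>': "\<forall>k. smooth (\<phi>' k)" "(\<lambda>k. n1 (\<phi>' k - v')) \<longlonglongrightarrow> 0" "(\<lambda>k. L2_norm S (\<phi>' k - g')) \<longlonglongrightarrow> 0"
    using assms unfolding has_trace_iff by blast
  note v = has_trace_H1[OF assms(1)] has_trace_H1[OF assms(2)]
    and g = has_trace_L2[OF assms(1)] has_trace_L2[OF assms(2)]
  have "(\<lambda>k. n1 ((\<phi> k + \<phi>' k) - (v + v'))) \<longlonglongrightarrow> 0"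
  proof (rule null_comparison)
    show "(\<lambda>k. n1 (\<phi> k - v) + n1 (\<phi>' k - v')) \<longlonglongrightarrow> 0"
      using tendsto_add[OF \<phi>(2) \<phi>'(2)] by simp
    show "\<bar>n1 ((\<phi> k + \<phi>' k) - (v + v'))\<bar> \<le> n1 (\<phi> k - v) + n1 (\<phi>' k - v')" for k
      using H1.N_triangle[OF H1.closed(2)[OF smooth_H1(1) v(1)] H1.closed(2)[OF smooth_H1(1) v(2)]]
        \<phi>(1) \<phi>'(1) H1_norm_nonneg by (simp add: H1_norm_nrm[symmetric] add_diff_add)
  qed
  moreover have "(\<lambda>k. L2_norm S ((\<phi> k + \<phi>' k) - (g + g'))) \<longlonglongrightarrow> 0"
  proof (rule null_comparison)
    show "(\<lambda>k. L2_norm S (\<phi> k - g) + L2_norm S (\<phi>' k - g')) \<longlonglongrightarrow> 0"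
      using tendsto_add[OF \<phi>(3) \<phi>'(3)] by simp
    show "\<bar>L2_norm S ((\<phi> k + \<phi>' k) - (g + g'))\<bar> \<le> L2_norm S (\<phi> k - g) + L2_norm S (\<phi>' k - g')" for k
      using LS.N_triangle[OF LS.closed(2)[OF smooth_H1(2) g(1)] LS.closed(2)[OF smooth_H1(2) g(2)]]
        \<phi>(1) \<phi>'(1) by (simp add: L2_norm_nrm[symmetric] add_diff_add L2_norm_nonneg)
  qed
  ultimately show ?thesis
    unfolding has_trace_iff using H1.closed(1)[OF v] LS.closed(1)[OF g] \<phi>(1) \<phi>'(1)
    by (intro conjI exI[of _ "\<lambda>k. \<phi> k + \<phi>' k"]) (auto simp: smooth_add)
qed

lemma has_trace_scale:
  assumes "has_trace \<Omega> v g"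
  shows "has_trace \<Omega> (c *\<^sub>R v) (c *\<^sub>R g)"
proof -
  obtain \<phi> where \<phi>: "\<forall>k. smooth (\<phi> k)" "(\<lambda>k. n1 (\<phi> k - v)) \<longlonglongrightarrow> 0" "(\<lambda>k. L2_norm S (\<phi> k - g)) \<longlonglongrightarrow> 0"
    using assms unfolding has_trace_iff by blast
  note v = has_trace_H1[OF assms(1)] and g = has_trace_L2[OF assms(1)]
  have "n1 (c *\<^sub>R \<phi> k - c *\<^sub>R v) = \<bar>c\<bar> * n1 (\<phi> k - v)" for k
    using H1.N_scale[OF H1.closed(2)[OF smooth_H1(1) v]] \<phi>(1)
    by (simp add: H1_norm_nrm[symmetric] flip: scaleR_diff_right)
  then have "(\<lambda>k. n1 (c *\<^sub>R \<phi> k - c *\<^sub>R v)) \<longlonglongrightarrow> 0"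
    using tendsto_mult_right_zero[OF \<phi>(2)] by simp
  moreover have "L2_norm S (c *\<^sub>R \<phi> k - c *\<^sub>R g) = \<bar>c\<bar> * L2_norm S (\<phi> k - g)" for k
    using LS.N_scale[OF LS.closed(2)[OF smooth_H1(2) g]] \<phi>(1)
    by (simp add: L2_norm_nrm[symmetric] flip: scaleR_diff_right)
  then have "(\<lambda>k. L2_norm S (c *\<^sub>R \<phi> k - c *\<^sub>R g)) \<longlonglongrightarrow> 0"
    using tendsto_mult_right_zero[OF \<phi>(3)] by simp
  ultimately show ?thesis
    unfolding has_trace_iff using H1.closed(3)[OF v] LS.closed(3)[OF g] \<phi>(1)
    by (intro conjI exI[of _ "\<lambda>k. c *\<^sub>R \<phi> k"]) (auto simp: smooth_scaleR)
qed

lemma has_trace_diff: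
  assumes "has_trace \<Omega> v g" "has_trace \<Omega> v' g'"
  shows "has_trace \<Omega> (v - v') (g - g')"
  using has_trace_add[OF assms(1) has_trace_scale[OF assms(2), of "-1"]] by simp

lemma H1_zero_H1: "v \<in> H1_zero \<Omega> \<Sigma> \<Longrightarrow> v \<in> V1"
  by (simp add: H1_zero_def)

lemma H1_zero_iff:
  "v \<in> H1_zero \<Omega> \<Sigma> \<longleftrightarrow> (\<exists>g. has_trace \<Omega> v g \<and> (AE x in S. x \<in> \<Sigma> \<longrightarrow> g x = 0))"
  by (auto simp: H1_zero_def vanishes_on_def has_trace_H1)

lemma H1_zero_mono: "\<Sigma> \<subseteq> \<Sigma>' \<Longrightarrow> H1_zero \<Omega> \<Sigma>' \<subseteq> H1_zero \<Omega> \<Sigma>"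
  unfolding H1_zero_iff subset_iff by (fastforce elim: eventually_mono)

lemma H1_zero_subspace: "subspace (H1_zero \<Omega> \<Sigma>)"
  unfolding subspace_def
proof (intro conjI ballI allI)
  show "0 \<in> H1_zero \<Omega> \<Sigma>"
    unfolding H1_zero_iff using traces(1)[OF smooth_zero] by (intro exI[of _ 0]) simp
next
  fix u v assume "u \<in> H1_zero \<Omega> \<Sigma>" "v \<in> H1_zero \<Omega> \<Sigma>"
  then obtain g h where g: "has_trace \<Omega> u g" "AE x in S. x \<in> \<Sigma> \<longrightarrow> g x = 0"
    and h: "has_trace \<Omega> v h" "AE x in S. x \<in> \<Sigma> \<longrightarrow> h x = 0" unfolding H1_zero_iff by blast
  have "AE x in S. x \<in> \<Sigma> \<longrightarrow> (g + h) x = 0" using g(2) h(2) by eventually_elim simp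
  with has_trace_add[OF g(1) h(1)] show "u + v \<in> H1_zero \<Omega> \<Sigma>" unfolding H1_zero_iff by blast
next
  fix c v assume "v \<in> H1_zero \<Omega> \<Sigma>"
  then obtain g where g: "has_trace \<Omega> v g" "AE x in S. x \<in> \<Sigma> \<longrightarrow> g x = 0" unfolding H1_zero_iff by blast
  have "AE x in S. x \<in> \<Sigma> \<longrightarrow> (c *\<^sub>R g) x = 0" using g(2) by eventually_elim (simp add: scaleR_fun_def)
  with has_trace_scale[OF g(1)] show "c *\<^sub>R v \<in> H1_zero \<Omega> \<Sigma>" unfolding H1_zero_iff by blast
qed

text \<open>The set \<open>\<Sigma>\<close> need not be measurable, hence the passage to an a.e. convergent subsequence of
  the traces.\<close>

lemma H1_zero_closed:
  assumes X: "\<And>k. X k \<in> H1_zero \<Omega> \<Sigma>" and v: "v \<in> V1" and lim: "(\<lambda>k. n1 (X k - v)) \<longlonglongrightarrow> 0"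
  shows "v \<in> H1_zero \<Omega> \<Sigma>"
proof -
  have "\<exists>g. has_trace \<Omega> (X k) g \<and> (AE x in S. x \<in> \<Sigma> \<longrightarrow> g x = 0)" for k
    using X H1_zero_iff by blast
  then obtain g where g: "\<And>k. has_trace \<Omega> (X k) (g k)" "\<And>k. AE x in S. x \<in> \<Sigma> \<longrightarrow> g k x = 0"
    by metis
  obtain h where h: "has_trace \<Omega> v h" using traces(2)[OF v] by blast
  obtain K where K: "\<And>v g. has_trace \<Omega> v g \<Longrightarrow> L2_norm S g \<le> K * n1 v" using traces(3) by blast
  have "(\<lambda>k. L2_norm S (g k - h)) \<longlonglongrightarrow> 0"
  proof (rule null_comparison)
    show "(\<lambda>k. K * n1 (X k - v)) \<longlonglongrightarrow> 0" using tendsto_mult_right_zero[OF lim] .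
    \<comment> \<open>\<open>g k - h\<close> is a trace of \<open>X k - v\<close>, and the trace
      bound holds for every trace of a field.\<close>
    show "\<bar>L2_norm S (g k - h)\<bar> \<le> K * n1 (X k - v)" for k
      using K[OF has_trace_diff[OF g(1) h]] L2_norm_nonneg[of S "g k - h"] by simp
  qed
  from L2_AE_subseq[OF has_trace_L2[OF g(1)] has_trace_L2[OF h] this]
  obtain r :: "nat \<Rightarrow> nat" where r: "AE x in S. (\<lambda>k. g (r k) x) \<longlonglongrightarrow> h x" by blast
  have "AE x in S. \<forall>k. x \<in> \<Sigma> \<longrightarrow> g (r k) x = 0" unfolding AE_all_countable using g(2) by blast
  with r have "AE x in S. x \<in> \<Sigma> \<longrightarrow> h x = 0"
  proof eventually_elim
    case (elim x)
    show ?case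
    proof
      assume "x \<in> \<Sigma>"
      then have "(\<lambda>k. g (r k) x) = (\<lambda>k. 0)" using elim(2) by simp
      then show "h x = 0" using elim(1) by (simp add: LIMSEQ_const_iff)
    qed
  qed
  with h show ?thesis unfolding H1_zero_iff by blast
qed

lemma H1_zero_complete: "seq_complete (H1_zero \<Omega> \<Sigma>) n1"
  unfolding seq_complete_def
proof (intro allI impI, elim conjE)
  fix X :: "nat \<Rightarrow> 'n vfield"
  assume X: "\<forall>k. X k \<in> H1_zero \<Omega> \<Sigma>" and Cau: "\<forall>e>0. \<exists>m. \<forall>i\<ge>m. \<forall>j\<ge>m. n1 (X i - X j) \<le> e"
  have "\<forall>k. X k \<in> V1" using X H1_zero_H1 by blast
  with Cau obtain v where v: "v \<in> V1" "(\<lambda>k. n1 (X k - v)) \<longlonglongrightarrow> 0"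
    using H1_complete[unfolded seq_complete_def, rule_format, of X] by blast
  then show "\<exists>v\<in>H1_zero \<Omega> \<Sigma>. (\<lambda>k. n1 (X k - v)) \<longlonglongrightarrow> 0"
    using H1_zero_closed X by blast
qed

end

section \<open>The elastodynamic forms\<close>

definition sym_part :: "real ^ 'n ^ 'n \<Rightarrow> real ^ 'n::finite ^ 'n" where
  "sym_part G = (1 / 2) *\<^sub>R (G + transpose G)"

lemma linear_sym_part: "linear sym_part"
  by (rule linearI) (simp_all add: sym_part_def vec_eq_iff transpose_def algebra_simps)

lemma transpose_sym_part: "transpose (sym_part G) = sym_part G"
  by (simp add: sym_part_def vec_eq_iff transpose_def add.commute)

lemma strain_sym_part: "strain \<Omega> v x = sym_part (weak_grad \<Omega> v x)"
  by (simp add: strain_def sym_part_def)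

lemma linear_ddot: "linear (ddot c)" "linear (\<lambda>c. ddot c e)"
  by (rule linearI; simp add: ddot_def vec_eq_iff algebra_simps sum.distrib sum_distrib_left)+

lemma bounded_bilinear_ddot: "bounded_bilinear (ddot :: ('n::finite) tensor4 \<Rightarrow> _)"
  by (simp add: bilinear_conv_bounded_bilinear[symmetric] bilinear_def linear_ddot)

lemma ddot_sym:
  fixes c :: "('n::finite) tensor4"
  assumes "c \<in> elasticity_tensors"
  shows "e \<bullet> ddot c e' = e' \<bullet> ddot c e"
proof -
  \<comment> \<open>With double sums written over index pairs, a single exchange of summation swaps
    \<open>(i, j)\<close> with \<open>(k, l)\<close>, as the major symmetry of the tensor
    requires.\<close>
  have pair: "(\<Sum>i\<in>UNIV. \<Sum>j\<in>UNIV. h i j) = (\<Sum>p\<in>UNIV. h (fst p) (snd p))" for h :: "'n \<Rightarrow> 'n \<Rightarrow> real"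
    by (simp add: sum.cartesian_product split_def)
  have "e \<bullet> ddot c e' = (\<Sum>i\<in>UNIV. \<Sum>j\<in>UNIV. \<Sum>k\<in>UNIV. \<Sum>l\<in>UNIV. e $ i $ j * (c $ i $ j $ k $ l * e' $ k $ l))"
    by (simp add: inner_vec_def ddot_def sum_distrib_left)
  also have "\<dots> = (\<Sum>k\<in>UNIV. \<Sum>l\<in>UNIV. \<Sum>i\<in>UNIV. \<Sum>j\<in>UNIV. e $ i $ j * (c $ i $ j $ k $ l * e' $ k $ l))"
    unfolding pair by (rule sum.swap)
  also have "\<dots> = (\<Sum>k\<in>UNIV. \<Sum>l\<in>UNIV. \<Sum>i\<in>UNIV. \<Sum>j\<in>UNIV. e' $ k $ l * (c $ k $ l $ i $ j * e $ i $ j))"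
  proof -
    have "c $ i $ j $ k $ l = c $ k $ l $ i $ j" for i j k l
      using assms unfolding elasticity_tensors_def by blast
    then show ?thesis by (intro sum.cong refl) (simp add: mult_ac)
  qed
  also have "\<dots> = e' \<bullet> ddot c e"
    by (simp add: inner_vec_def ddot_def sum_distrib_left)
  finally show ?thesis .
qed

section \<open>Bounded bilinear forms\<close>

definition bounded_bilin_on ::
  "'a::real_vector set \<Rightarrow> 'a set \<Rightarrow> ('a \<Rightarrow> real) \<Rightarrow> ('a \<Rightarrow> 'a \<Rightarrow> real) \<Rightarrow> bool" where
  "bounded_bilin_on U W n g \<longleftrightarrow>
     bilin_on U W g \<and> (\<exists>C\<ge>0. \<forall>u\<in>U. \<forall>w\<in>W. \<bar>g u w\<bar> \<le> C * n u * n w)"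

lemma bounded_bilin_onE:
  assumes "bounded_bilin_on U W n g"
  obtains C where "C \<ge> 0" "\<And>u w. u \<in> U \<Longrightarrow> w \<in> W \<Longrightarrow> \<bar>g u w\<bar> \<le> C * n u * n w"
  using assms unfolding bounded_bilin_on_def by blast

lemma bounded_bilin_on_sum:
  assumes g: "bounded_bilin_on U W n g" and h: "bounded_bilin_on U W n h"
  shows "bounded_bilin_on U W n (\<lambda>u w. g u w + c * h u w)"
proof -
  obtain C where C: "C \<ge> 0" "\<And>u w. u \<in> U \<Longrightarrow> w \<in> W \<Longrightarrow> \<bar>g u w\<bar> \<le> C * n u * n w"
    by (rule bounded_bilin_onE[OF g]) blast
  obtain C' where C': "C' \<ge> 0" "\<And>u w. u \<in> U \<Longrightarrow> w \<in> W \<Longrightarrow> \<bar>h u w\<bar> \<le> C' * n u * n w"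
    by (rule bounded_bilin_onE[OF h]) blast
  have "\<bar>g u w + c * h u w\<bar> \<le> (C + \<bar>c\<bar> * C') * n u * n w" if "u \<in> U" "w \<in> W" for u w
  proof -
    have "\<bar>g u w + c * h u w\<bar> \<le> \<bar>g u w\<bar> + \<bar>c\<bar> * \<bar>h u w\<bar>"
      using abs_triangle_ineq[of "g u w" "c * h u w"] by (simp add: abs_mult)
    also have "\<dots> \<le> C * n u * n w + \<bar>c\<bar> * (C' * n u * n w)"
      by (intro add_mono mult_left_mono C(2) C'(2) that) auto
    finally show ?thesis by (simp add: algebra_simps)
  qed
  moreover have "0 \<le> C + \<bar>c\<bar> * C'" using C(1) C'(1) by simp
  ultimately show ?thesis
    using assms bilin_on_sum[of U W g h c] unfolding bounded_bilin_on_def by blast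
qed

lemma bounded_bilin_on_mono:
  assumes g: "bounded_bilin_on V V n g" and sub: "U \<subseteq> V" "W \<subseteq> V"
    and le: "\<And>v. v \<in> V \<Longrightarrow> 0 \<le> n v" "\<And>v. v \<in> V \<Longrightarrow> n v \<le> K * n' v"
  shows "bounded_bilin_on U W n' g"
proof -
  obtain C where C: "C \<ge> 0" "\<And>u w. u \<in> V \<Longrightarrow> w \<in> V \<Longrightarrow> \<bar>g u w\<bar> \<le> C * n u * n w"
    by (rule bounded_bilin_onE[OF g]) blast
  have "\<bar>g u w\<bar> \<le> (C * (K * K)) * n' u * n' w" if "u \<in> U" "w \<in> W" for u w
  proof -
    have uw: "u \<in> V" "w \<in> V" using that sub by auto
    have "\<bar>g u w\<bar> \<le> C * (n u * n w)" using C(2)[OF uw] by (simp add: mult.assoc)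
    also have "\<dots> \<le> C * ((K * n' u) * (K * n' w))"
      using C(1) le(1)[OF uw(1)] le(1)[OF uw(2)] le(2)[OF uw(1)] le(2)[OF uw(2)]
      by (intro mult_left_mono mult_mono) auto
    finally show ?thesis by (simp add: mult_ac)
  qed
  moreover have "0 \<le> C * (K * K)" using C(1) by simp
  ultimately show ?thesis
    using g bilin_on_subset[OF _ sub] unfolding bounded_bilin_on_def by blast
qed

locale elastic_body = regular +
  fixes \<C> :: "real ^ 'a::finite \<Rightarrow> 'a tensor4" and \<rho> :: "real ^ 'a \<Rightarrow> real" and \<omega> :: real
  assumes elasticity: "elasticity_field \<Omega> \<C>" and density: "density_field \<Omega> \<rho>" and \<omega>: "\<omega> > 0"
begin

abbreviation "fA \<equiv> form_A \<Omega> \<C>"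
abbreviation "fm \<equiv> form_mass \<Omega> \<rho>"

definition stress :: "'a vfield \<Rightarrow> 'a mfield" where
  "stress v x = ddot (\<C> x) (strain \<Omega> v x)"

lemma strain_linear: "ae_linear M V1 (strain \<Omega>)"
  and strain_bound: "\<exists>K\<ge>0. \<forall>v\<in>V1. L2_norm M (strain \<Omega> v) \<le> K * L2_norm M (grad v)"
proof -
  obtain K where K: "K > 0" "\<And>G :: real ^ 'a ^ 'a. norm (sym_part G) \<le> norm G * K"
    using bounded_linear.pos_bounded[of sym_part] linear_sym_part by (auto simp: linear_conv_bounded_linear)
  have [measurable]: "sym_part \<in> borel_measurable borel"
    using linear_sym_part by (intro borel_measurable_continuous_onI linear_continuous_on)
      (simp add: linear_conv_bounded_linear)
  have bd: "norm (sym_part G) \<le> K * norm G" for G :: "real ^ 'a ^ 'a"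
    using K(2)[of G] by (simp add: mult.commute)
  have eq: "strain \<Omega> = (\<lambda>v x. sym_part (grad v x))" by (simp add: fun_eq_iff strain_sym_part)
  note * = ae_linear_compose[OF ae_linear_weak_grad, of K "\<lambda>_. sym_part", OF less_imp_le[OF K(1)]
      _ AE_I2[OF linear_sym_part] AE_I2[OF allI[OF bd]]]
  show "ae_linear M V1 (strain \<Omega>)"
    unfolding eq by (rule *) measurable
  have "\<forall>v\<in>V1. L2_norm M (strain \<Omega> v) \<le> K * L2_norm M (grad v)"
    unfolding eq by (rule ballI, rule *) (measurable, assumption)
  then show "\<exists>K\<ge>0. \<forall>v\<in>V1. L2_norm M (strain \<Omega> v) \<le> K * L2_norm M (grad v)"
    using K(1) less_imp_le by blast
qed

lemma stress_linear: "ae_linear M V1 stress"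
  and stress_bound: "\<exists>K\<ge>0. \<forall>v\<in>V1. L2_norm M (stress v) \<le> K * L2_norm M (strain \<Omega> v)"
proof -
  interpret bounded_bilinear "ddot :: 'a tensor4 \<Rightarrow> _" by (rule bounded_bilinear_ddot)
  obtain K0 where K0: "K0 \<ge> 0" "\<And>(c :: 'a tensor4) e. norm (ddot c e) \<le> norm c * norm e * K0"
    using nonneg_bounded by blast
  obtain KC where KC: "AE x in M. norm (\<C> x) \<le> KC" and Cm: "\<C> \<in> borel_measurable M"
    using elasticity by (auto simp: elasticity_field_def Linfty_def)
  define K where "K = \<bar>KC\<bar> * K0"
  have K: "K \<ge> 0" using K0 by (simp add: K_def)
  have "continuous_on UNIV (\<lambda>p. ddot (fst p) (snd p) :: real ^ 'a ^ 'a)"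
    by (intro continuous_on continuous_intros)
  then have meas: "(\<lambda>x. ddot (\<C> x) (f x)) \<in> borel_measurable M" if "f \<in> borel_measurable M" for f
    using borel_measurable_continuous_Pair[OF Cm that, of ddot] by blast
  have bd: "AE x in M. \<forall>e. norm (ddot (\<C> x) e) \<le> K * norm e"
    using KC
  proof eventually_elim
    case (elim x)
    have "norm (ddot (\<C> x) e) \<le> K * norm e" for e
    proof -
      have "norm (ddot (\<C> x) e) \<le> norm (\<C> x) * (norm e * K0)" using K0(2)[of "\<C> x" e] by (simp add: mult.assoc)
      also have "\<dots> \<le> \<bar>KC\<bar> * (norm e * K0)" using elim K0(1) by (intro mult_right_mono) auto
      finally show ?thesis by (simp add: K_def mult_ac)
    qed
    then show ?case by blast
  qed
  have eq: "stress = (\<lambda>v x. ddot (\<C> x) (strain \<Omega> v x))" by (simp add: fun_eq_iff stress_def)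
  note * = ae_linear_compose[OF strain_linear K, of "\<lambda>x. ddot (\<C> x)", OF meas _ bd]
  show "ae_linear M V1 stress"
    unfolding eq by (rule *) (simp_all add: linear_ddot)
  have "\<forall>v\<in>V1. L2_norm M (stress v) \<le> K * L2_norm M (strain \<Omega> v)"
    unfolding eq by (intro ballI *) (simp_all add: linear_ddot)
  then show "\<exists>K\<ge>0. \<forall>v\<in>V1. L2_norm M (stress v) \<le> K * L2_norm M (strain \<Omega> v)" using K by blast
qed

lemma form_A_eq: "fA u v = L2_inner M (strain \<Omega> u) (stress v)"
  by (simp add: form_A_def stress_def[abs_def])

lemma A_bilin: "bilin_on V1 V1 fA"
  unfolding form_A_eq[abs_def] by (rule bilin_on_L2_inner[OF H1_subspace strain_linear stress_linear])

lemma strain_L2: "v \<in> V1 \<Longrightarrow> strain \<Omega> v \<in> L2 M" and stress_L2: "v \<in> V1 \<Longrightarrow> stress v \<in> L2 M"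
  using strain_linear stress_linear ae_linear_L2 by blast+

lemma A_sym:
  assumes "u \<in> V1" "v \<in> V1"
  shows "fA u v = fA v u"
  unfolding form_A_eq L2_inner_def
proof (rule integral_cong_AE)
  have "AE x in M. \<C> x \<in> elasticity_tensors" using elasticity by (simp add: elasticity_field_def)
  then show "AE x in M. strain \<Omega> u x \<bullet> stress v x = strain \<Omega> v x \<bullet> stress u x"
    by eventually_elim (simp add: stress_def ddot_sym)
qed (use assms strain_L2 stress_L2 L2_measurable in \<open>auto intro!: borel_measurable_inner\<close>)

text \<open>The strain is a symmetric matrix at every point, so ellipticity on symmetric matrices
  can be integrated.\<close>

lemma A_coercive:
  obtains c0 where "c0 > 0" "\<And>v. v \<in> V1 \<Longrightarrow> c0 * (L2_norm M (strain \<Omega> v))\<^sup>2 \<le> fA v v"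
proof -
  obtain c0 where c0: "c0 > 0" "AE x in M. \<forall>e. transpose e = e \<longrightarrow> c0 * (e \<bullet> e) \<le> e \<bullet> ddot (\<C> x) e"
    using elasticity by (auto simp: elasticity_field_def)
  have "c0 * (L2_norm M (strain \<Omega> v))\<^sup>2 \<le> fA v v" if v: "v \<in> V1" for v
  proof -
    have "AE x in M. c0 * (norm (strain \<Omega> v x))\<^sup>2 \<le> strain \<Omega> v x \<bullet> stress v x"
      using c0(2) by eventually_elim
        (simp add: stress_def power2_norm_eq_inner strain_sym_part transpose_sym_part)
    then have "(\<integral>x. c0 * (norm (strain \<Omega> v x))\<^sup>2 \<partial>M) \<le> fA v v"
      unfolding form_A_eq L2_inner_def using L2_integrable_sq[OF strain_L2[OF v]]
      by (intro integral_mono_AE L2_inner_integrable strain_L2 stress_L2 v) auto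
    then show ?thesis by (simp add: L2_norm_sq)
  qed
  with c0(1) show ?thesis by (rule that)
qed

lemma A_bounded: "bounded_bilin_on V1 V1 n1 fA"
proof -
  obtain K1 where K1: "K1 \<ge> 0" "\<forall>v\<in>V1. L2_norm M (strain \<Omega> v) \<le> K1 * L2_norm M (grad v)"
    using strain_bound by blast
  obtain K2 where K2: "K2 \<ge> 0" "\<forall>v\<in>V1. L2_norm M (stress v) \<le> K2 * L2_norm M (strain \<Omega> v)"
    using stress_bound by blast
  have s1: "L2_norm M (strain \<Omega> v) \<le> K1 * n1 v" if "v \<in> V1" for v
    using K1(2)[rule_format, OF that] mult_left_mono[OF L2_norm_le_H1_norm(2)[of v] K1(1)] by simp
  have s2: "L2_norm M (stress v) \<le> K2 * (K1 * n1 v)" if "v \<in> V1" for v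
    using K2(2)[rule_format, OF that] mult_left_mono[OF s1[OF that] K2(1)] by simp
  have "\<bar>fA u v\<bar> \<le> (K1 * K2 * K1) * n1 u * n1 v"
    if u: "u \<in> V1" and v: "v \<in> V1" for u v
  proof -
    have "\<bar>fA u v\<bar> \<le> L2_norm M (strain \<Omega> u) * L2_norm M (stress v)"
      unfolding form_A_eq using LM.Cauchy_Schwarz[OF strain_L2[OF u] stress_L2[OF v]] by (simp add: L2_norm_nrm)
    also have "\<dots> \<le> (K1 * n1 u) * (K2 * (K1 * n1 v))"
      using s1[OF u] s2[OF v] K1(1) H1_norm_nonneg L2_norm_nonneg by (intro mult_mono) auto
    finally show ?thesis by (simp add: mult_ac)
  qed
  moreover have "0 \<le> K1 * K2 * K1" using K1(1) K2(1) by simp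
  ultimately show ?thesis using A_bilin unfolding bounded_bilin_on_def by blast
qed

lemma density_linear: "ae_linear M (L2 M :: 'a vfield set) (\<lambda>v x. \<rho> x *\<^sub>R v x)"
  and density_bound: "\<exists>K\<ge>0. \<forall>v\<in>L2 M :: 'a vfield set. L2_norm M (\<lambda>x. \<rho> x *\<^sub>R v x) \<le> K * L2_norm M v"
proof -
  obtain K where K: "AE x in M. norm (\<rho> x) \<le> K" and [measurable]: "\<rho> \<in> borel_measurable M"
    using density by (auto simp: density_field_def Linfty_def)
  have bd: "AE x in M. \<forall>y :: real ^ 'a. norm (\<rho> x *\<^sub>R y) \<le> \<bar>K\<bar> * norm y"
    using K by eventually_elim (auto intro: mult_right_mono)
  note * = ae_linear_compose[OF ae_linear_id abs_ge_zero, of M "\<lambda>x. (*\<^sub>R) (\<rho> x)", OF _ _ bd]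
  show "ae_linear M (L2 M :: 'a vfield set) (\<lambda>v x. \<rho> x *\<^sub>R v x)"
    by (rule *) (auto intro: linear_scaleR)
  have "\<forall>v\<in>L2 M :: 'a vfield set. L2_norm M (\<lambda>x. \<rho> x *\<^sub>R v x) \<le> \<bar>K\<bar> * L2_norm M v"
    by (intro ballI *) (auto intro: linear_scaleR)
  then show "\<exists>K\<ge>0. \<forall>v\<in>L2 M :: 'a vfield set. L2_norm M (\<lambda>x. \<rho> x *\<^sub>R v x) \<le> K * L2_norm M v"
    using abs_ge_zero by blast
qed

lemma mass_bilin: "bilin_on (L2 M) (L2 M) fm"
  unfolding form_mass_def[abs_def] by (rule bilin_on_L2_inner[OF L2_subspace density_linear ae_linear_id])

lemma mass_sym: "fm u v = fm v u"
  by (simp add: form_mass_def L2_inner_def inner_commute)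

lemma mass_bounded: "bounded_bilin_on (L2 M) (L2 M) (L2_norm M) fm"
proof -
  obtain K where K: "K \<ge> 0" "\<forall>v\<in>L2 M :: 'a vfield set. L2_norm M (\<lambda>x. \<rho> x *\<^sub>R v x) \<le> K * L2_norm M v"
    using density_bound by blast
  have "\<bar>fm u v\<bar> \<le> K * L2_norm M u * L2_norm M v" if u: "u \<in> L2 M" and v: "v \<in> L2 M" for u v
  proof -
    have "\<bar>fm u v\<bar> \<le> L2_norm M (\<lambda>x. \<rho> x *\<^sub>R u x) * L2_norm M v"
      unfolding form_mass_def using LV.Cauchy_Schwarz[OF ae_linear_L2[OF density_linear u] v] by (simp add: L2_norm_nrm)
    also have "\<dots> \<le> (K * L2_norm M u) * L2_norm M v" using K(2) u L2_norm_nonneg by (intro mult_right_mono) auto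
    finally show ?thesis .
  qed
  with K(1) mass_bilin show ?thesis unfolding bounded_bilin_on_def by blast
qed

lemma mass_coercive:
  obtains r where "r > 0" "\<And>v. v \<in> L2 M \<Longrightarrow> r * (L2_norm M v)\<^sup>2 \<le> fm v v"
proof -
  obtain r where r: "r > 0" "AE x in M. r \<le> \<rho> x" using density by (auto simp: density_field_def)
  have "r * (L2_norm M v)\<^sup>2 \<le> fm v v" if v: "v \<in> L2 M" for v
  proof -
    have "AE x in M. r * (norm (v x))\<^sup>2 \<le> \<rho> x *\<^sub>R v x \<bullet> v x"
      using r(2) by eventually_elim (simp add: power2_norm_eq_inner mult_right_mono)
    then have "(\<integral>x. r * (norm (v x))\<^sup>2 \<partial>M) \<le> fm v v"
      unfolding form_mass_def L2_inner_def using L2_integrable_sq[OF v]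
      by (intro integral_mono_AE L2_inner_integrable ae_linear_L2[OF density_linear] v) auto
    then show ?thesis by (simp add: L2_norm_sq)
  qed
  with r(1) show ?thesis by (rule that)
qed

section \<open>The energy inner product and its equivalence with the \<open>H\<^sup>1\<close>
  norm\<close>

abbreviation "ip \<equiv> inner_omega \<Omega> \<C> \<rho> \<omega>"

lemma norm_omega_nrm: "norm_omega \<Omega> \<C> \<rho> \<omega> = nrm ip"
  by (simp add: norm_omega_def nrm_def fun_eq_iff)

lemma H1_L2: "V1 \<subseteq> L2 M"
  by (auto simp: H1_def)

text \<open>The coefficients \<open>\<omega>\<^sup>2\<close> and \<open>- \<omega>\<^sup>2\<close>
  give the inner product and the form \<B>.\<close>

lemma form_sum_bounded:
  "bounded_bilin_on V1 V1 n1 (\<lambda>u v. fA u v + c * fm u v)"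
proof -
  obtain C where C: "C \<ge> 0" "\<And>u v. u \<in> L2 M \<Longrightarrow> v \<in> L2 M \<Longrightarrow> \<bar>fm u v\<bar> \<le> C * L2_norm M u * L2_norm M v"
    by (rule bounded_bilin_onE[OF mass_bounded]) blast
  have "\<bar>fm u v\<bar> \<le> C * n1 u * n1 v" if "u \<in> V1" "v \<in> V1" for u v
  proof -
    have "u \<in> L2 M" "v \<in> L2 M" using that H1_L2 by auto
    then have "\<bar>fm u v\<bar> \<le> C * (L2_norm M u * L2_norm M v)" using C(2) by (simp add: mult.assoc)
    also have "\<dots> \<le> C * (n1 u * n1 v)"
      using C(1) L2_norm_le_H1_norm(1) L2_norm_nonneg H1_norm_nonneg by (intro mult_left_mono mult_mono) auto
    finally show ?thesis by (simp add: mult.assoc)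
  qed
  then have "bounded_bilin_on V1 V1 n1 fm"
    using C(1) bilin_on_subset[OF mass_bilin H1_L2 H1_L2] unfolding bounded_bilin_on_def by blast
  then show ?thesis by (rule bounded_bilin_on_sum[OF A_bounded])
qed

lemma ip_bounded: "bounded_bilin_on V1 V1 n1 ip"
  unfolding inner_omega_def[abs_def] by (rule form_sum_bounded)

lemma B_bounded: "bounded_bilin_on V1 V1 n1 (form_B \<Omega> \<C> \<rho> \<omega>)"
  using form_sum_bounded[of "- \<omega>\<^sup>2"] by (simp add: form_B_def[abs_def])

lemma ip_ge_mass: "v \<in> V1 \<Longrightarrow> \<omega>\<^sup>2 * fm v v \<le> ip v v"
proof -
  assume v: "v \<in> V1"
  obtain c0 where "c0 > 0" "\<And>v. v \<in> V1 \<Longrightarrow> c0 * (L2_norm M (strain \<Omega> v))\<^sup>2 \<le> fA v v"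
    by (rule A_coercive) blast
  then have "0 \<le> fA v v" using v by (meson mult_nonneg_nonneg less_imp_le order_trans zero_le_power2)
  then show ?thesis by (simp add: inner_omega_def)
qed

lemma ip_pos: "v \<in> V1 \<Longrightarrow> 0 \<le> ip v v"
proof -
  assume v: "v \<in> V1"
  obtain r where "r > 0" "\<And>v. v \<in> L2 M \<Longrightarrow> r * (L2_norm M v)\<^sup>2 \<le> fm v v"
    by (rule mass_coercive) blast
  then have "0 \<le> fm v v"
    using v H1_L2 by (meson mult_nonneg_nonneg less_imp_le order_trans zero_le_power2 subsetD)
  then have "0 \<le> \<omega>\<^sup>2 * fm v v" by simp
  then show ?thesis using ip_ge_mass[OF v] by linarith
qed

sublocale I: semi_inner "V1" ip
proof
  show "ip u v = ip v u" if "u \<in> V1" "v \<in> V1" for u v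
    using A_sym[OF that] mass_sym[of u v] by (simp add: inner_omega_def)
qed (use H1_subspace ip_bounded ip_pos in \<open>auto simp: bounded_bilin_on_def\<close>)

text \<open>The mass part of the energy dominates the \<open>L\<^sup>2\<close> norm. This is the
  bridge from the abstract \<open>N (u - u') = 0\<close> to equality almost everywhere.\<close>

lemma norm_zero_AE:
  assumes v: "v \<in> V1" and 0: "nrm ip v = 0"
  shows "AE x in M. v x = 0"
proof (rule L2_norm_zero_AE)
  show vL: "v \<in> L2 M" using v H1_L2 by blast
  obtain r where r: "r > 0" "\<And>v. v \<in> L2 M \<Longrightarrow> r * (L2_norm M v)\<^sup>2 \<le> fm v v"
    by (rule mass_coercive) blast
  have "\<omega>\<^sup>2 * fm v v \<le> 0" using ip_ge_mass[OF v] 0 I.N_zero_iff[OF v] by simp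
  then have "fm v v \<le> 0" using \<omega> by (simp add: mult_le_0_iff)
  then have "r * (L2_norm M v)\<^sup>2 \<le> 0" using r(2)[OF vL] by linarith
  then show "L2_norm M v = 0" using r(1) by (simp add: mult_le_0_iff)
qed

lemma norm_le_H1_norm: obtains C where "C > 0" "\<And>v. v \<in> V1 \<Longrightarrow> nrm ip v \<le> C * n1 v"
proof -
  obtain C where C: "C \<ge> 0" "\<And>u v. u \<in> V1 \<Longrightarrow> v \<in> V1 \<Longrightarrow> \<bar>ip u v\<bar> \<le> C * n1 u * n1 v"
    by (rule bounded_bilin_onE[OF ip_bounded]) blast
  have "nrm ip v \<le> sqrt (C + 1) * n1 v" if v: "v \<in> V1" for v
  proof (rule power2_le_imp_le)
    have "(nrm ip v)\<^sup>2 \<le> C * (n1 v)\<^sup>2"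
      using C(2)[OF v v] I.N_sq[OF v] by (simp add: power2_eq_square mult.assoc)
    also have "\<dots> \<le> (C + 1) * (n1 v)\<^sup>2" by (intro mult_right_mono) auto
    also have "\<dots> = (sqrt (C + 1) * n1 v)\<^sup>2" using C(1) by (simp add: power_mult_distrib)
    finally show "(nrm ip v)\<^sup>2 \<le> (sqrt (C + 1) * n1 v)\<^sup>2" .
    show "0 \<le> sqrt (C + 1) * n1 v" using C(1) H1_norm_nonneg[of v] by simp
  qed
  then show ?thesis using that[of "sqrt (C + 1)"] C(1) by simp
qed

lemma H1_norm_le_norm: obtains C where "C > 0" "\<And>v. v \<in> V1 \<Longrightarrow> n1 v \<le> C * nrm ip v"
proof -
  obtain K where K: "\<forall>v\<in>V1. (n1 v)\<^sup>2 \<le> K * ((L2_norm M v)\<^sup>2 + (L2_norm M (strain \<Omega> v))\<^sup>2)"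
    using regular by (auto simp: regular_domain_def korn_inequality_def)
  obtain r where r: "r > 0" "\<And>v. v \<in> L2 M \<Longrightarrow> r * (L2_norm M v)\<^sup>2 \<le> fm v v"
    by (rule mass_coercive) blast
  obtain c0 where c0: "c0 > 0" "\<And>v. v \<in> V1 \<Longrightarrow> c0 * (L2_norm M (strain \<Omega> v))\<^sup>2 \<le> fA v v"
    by (rule A_coercive) blast
  \<comment> \<open>A common lower bound for the strain part and the mass part of the energy,
    matching the two terms of Korn's inequality.\<close>
  define m where "m = min c0 (\<omega>\<^sup>2 * r)"
  have m: "m > 0" using c0(1) r(1) \<omega> by (simp add: m_def)
  define C where "C = sqrt ((\<bar>K\<bar> + 1) / m)"
  have C: "C > 0" using m by (simp add: C_def add_nonneg_pos)
  have "n1 v \<le> C * nrm ip v" if v: "v \<in> V1" for v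
  proof (rule power2_le_imp_le)
    let ?s = "(L2_norm M v)\<^sup>2 + (L2_norm M (strain \<Omega> v))\<^sup>2"
    have "m * (L2_norm M v)\<^sup>2 \<le> \<omega>\<^sup>2 * r * (L2_norm M v)\<^sup>2" by (intro mult_right_mono) (auto simp: m_def)
    also have "\<dots> \<le> \<omega>\<^sup>2 * fm v v"
      using mult_left_mono[OF r(2)[of v], of "\<omega>\<^sup>2"] v H1_L2 by (auto simp: mult.assoc)
    finally have 1: "m * (L2_norm M v)\<^sup>2 \<le> \<omega>\<^sup>2 * fm v v" .
    have "m * (L2_norm M (strain \<Omega> v))\<^sup>2 \<le> c0 * (L2_norm M (strain \<Omega> v))\<^sup>2"
      by (intro mult_right_mono) (auto simp: m_def)
    then have "m * ?s \<le> ip v v" using 1 c0(2)[OF v] by (simp add: inner_omega_def distrib_left)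
    then have s: "?s \<le> ip v v / m" using m by (simp add: field_simps)
    have "(n1 v)\<^sup>2 \<le> K * ?s" using K v by blast
    also have "\<dots> \<le> (\<bar>K\<bar> + 1) * ?s" by (intro mult_right_mono) auto
    also have "\<dots> \<le> (\<bar>K\<bar> + 1) * (ip v v / m)" using s by (intro mult_left_mono) auto
    also have "\<dots> = (C * nrm ip v)\<^sup>2" using m I.N_sq[OF v] by (simp add: C_def power_mult_distrib)
    finally show "(n1 v)\<^sup>2 \<le> (C * nrm ip v)\<^sup>2" .
    show "0 \<le> C * nrm ip v" using C I.N_nonneg[OF v] by simp
  qed
  with C that show ?thesis by blast
qed

lemma bounded_bilin_on_norm:
  assumes "bounded_bilin_on V1 V1 n1 g" "V \<subseteq> V1" "W \<subseteq> V1"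
  shows "bounded_bilin_on V W (nrm ip) g"
proof -
  obtain C where "\<And>v. v \<in> V1 \<Longrightarrow> n1 v \<le> C * nrm ip v" by (rule H1_norm_le_norm) blast
  then show ?thesis by (rule bounded_bilin_on_mono[OF assms H1_norm_nonneg])
qed

text \<open>The inner product exceeds \<B> by \<open>2 * \<omega>\<^sup>2\<close> times the mass
  form. The latter is controlled by the \<open>L\<^sup>2\<close> norm, in which the compact
  embedding supplies a convergent subsequence.\<close>

lemma B_compact:
  fixes X :: "nat \<Rightarrow> 'a vfield"
  assumes X: "\<And>k. X k \<in> V1" "\<And>k. nrm ip (X k) \<le> 1"
  shows "\<exists>r :: nat \<Rightarrow> nat. strict_mono r \<and> (\<forall>e>0. \<exists>m. \<forall>i\<ge>m. \<forall>j\<ge>m. (nrm ip (X (r i) - X (r j)))\<^sup>2 \<le>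
    form_B \<Omega> \<C> \<rho> \<omega> (X (r i) - X (r j)) (X (r i) - X (r j)) + e)"
proof -
  obtain C where C: "C > 0" "\<And>v. v \<in> V1 \<Longrightarrow> n1 v \<le> C * nrm ip v"
    by (rule H1_norm_le_norm) blast
  obtain Cm where Cm: "Cm \<ge> 0" "\<And>u v. u \<in> L2 M \<Longrightarrow> v \<in> L2 M \<Longrightarrow> \<bar>fm u v\<bar> \<le> Cm * L2_norm M u * L2_norm M v"
    by (rule bounded_bilin_onE[OF mass_bounded]) blast
  have "n1 (X k) \<le> C" for k
    using C(2)[OF X(1), of k] mult_left_le[OF X(2)[of k] less_imp_le[OF C(1)]] by linarith
  then have bounded: "(\<forall>k. X k \<in> V1) \<and> (\<exists>K. \<forall>k. n1 (X k) \<le> K)" using X(1) by blast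
  have "compact_embedding \<Omega>" using regular by (simp add: regular_domain_def)
  from this[unfolded compact_embedding_def, THEN spec, THEN mp, OF bounded]
  obtain r u where r: "strict_mono (r :: nat \<Rightarrow> nat)" "u \<in> L2 M"
    "(\<lambda>k. L2_norm M (\<lambda>x. X (r k) x - u x)) \<longlonglongrightarrow> 0"
    by blast
  \<comment> \<open>Two members of the tail are at \<open>L\<^sup>2\<close> distance at most
    \<open>2 * h\<close>, so the mass defect is at most
    \<open>2 * \<omega>\<^sup>2 * Cm * (2 * h)\<^sup>2\<close>; the summand 1 keeps \<open>D\<close>
    positive.\<close>
  define D where "D = 8 * \<omega>\<^sup>2 * Cm + 1"
  have D: "D > 0" using Cm(1) by (simp add: D_def add_nonneg_pos)
  have "\<exists>m. \<forall>i\<ge>m. \<forall>j\<ge>m. (nrm ip (X (r i) - X (r j)))\<^sup>2 \<le>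
    form_B \<Omega> \<C> \<rho> \<omega> (X (r i) - X (r j)) (X (r i) - X (r j)) + e" if e: "e > 0" for e
  proof -
    define h where "h = sqrt (e / D)"
    have h: "h > 0" "h\<^sup>2 = e / D" using e D by (auto simp: h_def)
    obtain m where m: "\<And>k. k \<ge> m \<Longrightarrow> L2_norm M (X (r k) - u) < h"
      using order_tendstoD(2)[OF r(3) h(1)] by (auto simp: eventually_sequentially fun_diff_def)
    have "(nrm ip y)\<^sup>2 \<le> form_B \<Omega> \<C> \<rho> \<omega> y y + e" if ij: "i \<ge> m" "j \<ge> m" and y: "y = X (r i) - X (r j)" for i j y
    proof -
      have XL: "X k \<in> L2 M" for k using X(1) H1_L2 by blast
      have yL: "y \<in> L2 M" "y \<in> V1" using XL X(1) LV.closed(2) H1.closed(2) y by auto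
      have "L2_norm M y \<le> L2_norm M (X (r i) - u) + L2_norm M (u - X (r j))"
        using LV.N_triangle_via[OF XL XL r(2)] by (simp add: y L2_norm_nrm)
      also have "L2_norm M (u - X (r j)) = L2_norm M (X (r j) - u)"
        using LV.N_diff_commute[OF r(2) XL] by (simp add: L2_norm_nrm)
      finally have Ly: "L2_norm M y \<le> 2 * h" using m[OF ij(1)] m[OF ij(2)] by (simp add: fun_diff_def)
      have "fm y y \<le> Cm * (L2_norm M y)\<^sup>2"
        using Cm(2)[OF yL(1) yL(1)] by (simp add: power2_eq_square mult.assoc)
      also have "\<dots> \<le> Cm * (2 * h)\<^sup>2"
        using Ly L2_norm_nonneg Cm(1) by (intro mult_left_mono power_mono) auto
      finally have "2 * \<omega>\<^sup>2 * fm y y \<le> 2 * \<omega>\<^sup>2 * (Cm * (2 * h)\<^sup>2)" by (intro mult_left_mono) auto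
      also have "\<dots> = 8 * \<omega>\<^sup>2 * Cm * h\<^sup>2" by (simp add: power_mult_distrib)
      also have "\<dots> \<le> D * h\<^sup>2" by (intro mult_right_mono) (auto simp: D_def)
      also have "\<dots> = e" using h(2) D by simp
      finally have "2 * (\<omega>\<^sup>2 * fm y y) \<le> e" by simp
      then show ?thesis unfolding I.N_sq[OF yL(2)] inner_omega_def form_B_def by linarith
    qed
    then show ?thesis by blast
  qed
  with r(1) show ?thesis by blast
qed

lemma H1_zero_hilbert: "semi_hilbert (H1_zero \<Omega> \<Sigma>) ip"
proof -
  have sub: "H1_zero \<Omega> \<Sigma> \<subseteq> V1" using H1_zero_H1 by blast
  interpret Z: semi_inner "H1_zero \<Omega> \<Sigma>" ip by (rule I.semi_inner_subspace[OF H1_zero_subspace sub])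
  obtain C1 where C1: "\<And>v. v \<in> V1 \<Longrightarrow> n1 v \<le> C1 * nrm ip v" by (rule H1_norm_le_norm) blast
  obtain C2 where C2: "\<And>v. v \<in> V1 \<Longrightarrow> nrm ip v \<le> C2 * n1 v" by (rule norm_le_H1_norm) blast
  show ?thesis
  proof
    show "seq_complete (H1_zero \<Omega> \<Sigma>) (nrm ip)"
      by (rule seq_complete_equiv[OF H1_zero_subspace H1_zero_complete Z.N_nonneg C1 C2])
        (use sub in auto)
  qed
qed

text \<open>On fields vanishing on a boundary part of positive measure, Korn's inequality bounds the
  whole \<open>H\<^sup>1\<close> norm by the strain alone, hence also the mass part of the
  energy.\<close>

lemma A_coercive_boundary:
  assumes \<Sigma>: "\<Sigma> \<subseteq> frontier \<Omega>" "emeasure S \<Sigma> > 0"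
  obtains \<alpha> where "\<alpha> > 0" "\<And>v. v \<in> H1_zero \<Omega> \<Sigma> \<Longrightarrow> \<alpha> * (nrm ip v)\<^sup>2 \<le> fA v v"
proof -
  have "korn_boundary_inequality \<Omega>" using regular by (simp add: regular_domain_def)
  from this[unfolded korn_boundary_inequality_def, THEN spec, THEN mp, THEN mp, OF \<Sigma>]
  obtain K where K: "\<forall>v\<in>H1_zero \<Omega> \<Sigma>. n1 v \<le> K * L2_norm M (strain \<Omega> v)" ..
  obtain c0 where c0: "c0 > 0" "\<And>v. v \<in> V1 \<Longrightarrow> c0 * (L2_norm M (strain \<Omega> v))\<^sup>2 \<le> fA v v"
    by (rule A_coercive) blast
  obtain C where C: "C > 0" "\<And>v. v \<in> V1 \<Longrightarrow> nrm ip v \<le> C * n1 v" by (rule norm_le_H1_norm) blast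
  define L where "L = C * (\<bar>K\<bar> + 1)"
  have L: "L > 0" using C(1) by (simp add: L_def add_nonneg_pos)
  have "c0 / L\<^sup>2 * (nrm ip v)\<^sup>2 \<le> fA v v" if v: "v \<in> H1_zero \<Omega> \<Sigma>" for v
  proof -
    have vH: "v \<in> V1" using v by (rule H1_zero_H1)
    have "nrm ip v \<le> C * (K * L2_norm M (strain \<Omega> v))"
      using C(2)[OF vH] mult_left_mono[OF K[rule_format, OF v] less_imp_le[OF C(1)]] by linarith
    also have "\<dots> \<le> C * ((\<bar>K\<bar> + 1) * L2_norm M (strain \<Omega> v))"
      using C(1) L2_norm_nonneg by (intro mult_left_mono mult_right_mono) auto
    finally have "(nrm ip v)\<^sup>2 \<le> (L * L2_norm M (strain \<Omega> v))\<^sup>2"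
      using I.N_nonneg[OF vH] by (intro power_mono) (auto simp: L_def mult.assoc)
    then have "c0 / L\<^sup>2 * (nrm ip v)\<^sup>2 \<le> c0 / L\<^sup>2 * (L * L2_norm M (strain \<Omega> v))\<^sup>2"
      using c0(1) by (intro mult_left_mono) auto
    also have "\<dots> = c0 * (L2_norm M (strain \<Omega> v))\<^sup>2" using L by (simp add: power_mult_distrib)
    also have "\<dots> \<le> fA v v" using c0(2)[OF vH] .
    finally show ?thesis .
  qed
  then show ?thesis using that[of "c0 / L\<^sup>2"] c0(1) L by simp
qed

end

section \<open>Dual norms and transfer to the elastic body\<close>

lemma linear_on_fields_iff: "linear_on_fields V f \<longleftrightarrow> lin_on V f"
  by (simp add: linear_on_fields_def lin_on_def plus_fun_def scaleR_fun_def)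

text \<open>The infimum is itself an admissible constant: for \<open>n v > 0\<close> the quotient
  \<open>\<bar>f v\<bar> / n v\<close> lies below every admissible constant, and for
  \<open>n v = 0\<close> any of them forces \<open>f v = 0\<close>.\<close>

lemma dual_norm_bound:
  assumes f: "f \<in> dual_space n V" and n: "\<And>v. v \<in> V \<Longrightarrow> 0 \<le> n v"
  shows "0 \<le> dual_norm n V f" "v \<in> V \<Longrightarrow> \<bar>f v\<bar> \<le> dual_norm n V f * n v"
proof -
  let ?S = "{K. 0 \<le> K \<and> (\<forall>v\<in>V. \<bar>f v\<bar> \<le> K * n v)}"
  obtain K where K: "\<forall>v\<in>V. \<bar>f v\<bar> \<le> K * n v" using f by (auto simp: dual_space_def)
  have "\<bar>f v\<bar> \<le> \<bar>K\<bar> * n v" if "v \<in> V" for v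
    using K that mult_right_mono[OF abs_ge_self[of K] n[OF that]] by force
  then have ne: "?S \<noteq> {}" by (auto intro!: exI[of _ "\<bar>K\<bar>"])
  show "0 \<le> dual_norm n V f" unfolding dual_norm_def by (rule cInf_greatest[OF ne]) auto
  show "\<bar>f v\<bar> \<le> dual_norm n V f * n v" if v: "v \<in> V"
  proof (cases "n v = 0")
    case True
    then show ?thesis using K v by fastforce
  next
    case False
    then have nv: "n v > 0" using n[OF v] by simp
    have "\<bar>f v\<bar> / n v \<le> dual_norm n V f"
      unfolding dual_norm_def by (rule cInf_greatest[OF ne]) (use v nv in \<open>auto simp: field_simps\<close>)
    then show ?thesis using nv by (simp add: field_simps)
  qed
qed

text \<open>Well-posedness comprises existence, uniqueness up to null sets, and a bound by the dual
  norm with one constant for all data; the two limit problems are therefore treated for arbitrary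
  right-hand sides before the given one is inserted. The rate is claimed for every family of
  solutions, one for each \<kappa>, with a limit chosen beforehand.\<close>

theorem proposition1:
  fixes \<Omega> \<Gamma>\<^sub>D \<Gamma>\<^sub>N \<Gamma>\<^sub>c :: "(real ^ 'n::finite) set"
    and \<C> :: "real ^ 'n \<Rightarrow> 'n tensor4"
    and \<rho> :: "real ^ 'n \<Rightarrow> real"
    and \<omega> \<delta> :: real
    and \<A> \<B> \<D> :: "'n vfield \<Rightarrow> 'n vfield \<Rightarrow> real"
    and N :: "'n vfield \<Rightarrow> real"
    and \<U> \<W> \<H> Hp \<K> :: "'n vfield set"
    and f d :: "'n vfield \<Rightarrow> real"
  assumes dim: "CARD('n) \<le> 3"
    and domain: "regular_domain \<Omega>"
    and Gamma: "\<Gamma>\<^sub>D \<subseteq> frontier \<Omega>" "\<Gamma>\<^sub>N \<subseteq> frontier \<Omega>" "\<Gamma>\<^sub>D \<inter> \<Gamma>\<^sub>N = {}"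
    and Gamma_c: "\<Gamma>\<^sub>c = frontier \<Omega> - (\<Gamma>\<^sub>N \<union> \<Gamma>\<^sub>D)"
    and Gamma_pos: "emeasure (surface_measure \<Omega>) (\<Gamma>\<^sub>D \<union> \<Gamma>\<^sub>c) > 0"
    and rho: "density_field \<Omega> \<rho>"
    and omega: "\<omega> > 0"
    and elasticity: "elasticity_field \<Omega> \<C>"
    and U_def: "\<U> = H1_zero \<Omega> \<Gamma>\<^sub>D"
    and W_def: "\<W> = H1_zero \<Omega> (\<Gamma>\<^sub>D \<union> \<Gamma>\<^sub>c)"
    and A_def: "\<A> = form_A \<Omega> \<C>"
    and B_def: "\<B> = form_B \<Omega> \<C> \<rho> \<omega>"
    and N_def: "N = norm_omega \<Omega> \<C> \<rho> \<omega>"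
    and H_def: "\<H> = null_space \<B> \<U> \<W>"
    and Hp_def: "Hp = orth_complement (inner_omega \<Omega> \<C> \<rho> \<omega>) \<U> \<H>"
    and K_def: "\<K> = null_space_transpose \<B> \<U> \<W>"
    and D_form: "continuous_bilinear_form N \<U> \<D>"
    and D_sym: "\<forall>u\<in>\<U>. \<forall>v\<in>\<U>. \<D> u v = \<D> v u"
    and D_pos: "\<forall>u\<in>\<U>. \<D> u u \<ge> 0"
    and D_coercive: "\<delta> > 0" "\<forall>v\<in>\<H>. \<D> v v \<ge> \<delta> * (N v)\<^sup>2"
    and f: "f \<in> dual_space N \<W>"
    and d: "d \<in> dual_space N \<U>"
  shows
    "(\<forall>\<kappa>>0. \<exists>w\<in>\<W>. \<exists>u\<^sub>0\<in>\<H>. \<exists>u\<^sub>1\<in>Hp.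
       stationarity \<A> \<B> \<D> \<W> \<U> f d \<kappa> w (\<lambda>x. u\<^sub>0 x + u\<^sub>1 x) \<and>
       (\<forall>w'\<in>\<W>. \<forall>u\<^sub>0'\<in>\<H>. \<forall>u\<^sub>1'\<in>Hp.
          stationarity \<A> \<B> \<D> \<W> \<U> f d \<kappa> w' (\<lambda>x. u\<^sub>0' x + u\<^sub>1' x) \<longrightarrow>
          ae_eq \<Omega> w' w \<and> ae_eq \<Omega> u\<^sub>0' u\<^sub>0 \<and> ae_eq \<Omega> u\<^sub>1' u\<^sub>1)) \<and>
     (\<exists>K. \<forall>f'\<in>dual_space N \<W>. \<exists>w u\<^sub>1.
       limit_mixed_problem \<A> \<B> \<W> Hp f' w u\<^sub>1 \<and>
       N w + N u\<^sub>1 \<le> K * dual_norm N \<W> f' \<and>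
       (\<forall>w' u\<^sub>1'. limit_mixed_problem \<A> \<B> \<W> Hp f' w' u\<^sub>1' \<longrightarrow> ae_eq \<Omega> w' w \<and> ae_eq \<Omega> u\<^sub>1' u\<^sub>1)) \<and>
     (\<exists>K. \<forall>g\<in>dual_space N \<H>. \<exists>u\<^sub>0.
       limit_kernel_problem \<D> \<H> g u\<^sub>0 \<and>
       N u\<^sub>0 \<le> K * dual_norm N \<H> g \<and>
       (\<forall>u\<^sub>0'. limit_kernel_problem \<D> \<H> g u\<^sub>0' \<longrightarrow> ae_eq \<Omega> u\<^sub>0' u\<^sub>0)) \<and>
     (\<exists>w u\<^sub>0 u\<^sub>1.
       limit_mixed_problem \<A> \<B> \<W> Hp f w u\<^sub>1 \<and>
       limit_kernel_problem \<D> \<H> (\<lambda>h. d h - \<D> u\<^sub>1 h) u\<^sub>0 \<and>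
       (\<forall>w\<^sub>\<kappa> u\<^sub>0\<^sub>\<kappa> u\<^sub>1\<^sub>\<kappa> :: real \<Rightarrow> 'n vfield.
          (\<forall>\<kappa>>0. w\<^sub>\<kappa> \<kappa> \<in> \<W> \<and> u\<^sub>0\<^sub>\<kappa> \<kappa> \<in> \<H> \<and> u\<^sub>1\<^sub>\<kappa> \<kappa> \<in> Hp \<and>
             stationarity \<A> \<B> \<D> \<W> \<U> f d \<kappa> (w\<^sub>\<kappa> \<kappa>) (\<lambda>x. u\<^sub>0\<^sub>\<kappa> \<kappa> x + u\<^sub>1\<^sub>\<kappa> \<kappa> x)) \<longrightarrow>
          (\<lambda>\<kappa>. sqrt ((N (\<lambda>x. w\<^sub>\<kappa> \<kappa> x - w x))\<^sup>2 +
                      (N (\<lambda>x. (u\<^sub>0\<^sub>\<kappa> \<kappa> x + u\<^sub>1\<^sub>\<kappa> \<kappa> x) - (u\<^sub>0 x + u\<^sub>1 x)))\<^sup>2))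
            \<in> O[at_right 0](\<lambda>\<kappa>. \<kappa>)) \<and>
       ((\<forall>v\<in>\<K>. ae_eq \<Omega> v (\<lambda>x. 0)) \<longrightarrow> ae_eq \<Omega> w (\<lambda>x. 0)))"
proof -
  interpret elastic_body \<Omega> \<C> \<rho> \<omega>
    by unfold_locales (use domain elasticity rho omega in auto)
  have sub: "\<U> \<subseteq> H1 \<Omega>" "\<W> \<subseteq> H1 \<Omega>" using H1_zero_H1 by (auto simp: U_def W_def)
  have WU: "\<W> \<subseteq> \<U>" unfolding U_def W_def by (rule H1_zero_mono) blast
  have Nip: "N = nrm (inner_omega \<Omega> \<C> \<rho> \<omega>)" by (simp add: N_def norm_omega_nrm)
  have "\<Gamma>\<^sub>D \<union> \<Gamma>\<^sub>c \<subseteq> frontier \<Omega>" using Gamma Gamma_c by blast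
  from A_coercive_boundary[OF this Gamma_pos]
  obtain \<alpha> where \<alpha>: "\<alpha> > 0" "\<And>w. w \<in> \<W> \<Longrightarrow> \<alpha> * (nrm ip w)\<^sup>2 \<le> \<A> w w"
    unfolding A_def W_def by blast
  have D_bounded: "bounded_bilin_on \<U> \<U> (nrm ip) \<D>"
  proof -
    obtain K where K: "\<forall>u\<in>\<U>. \<forall>v\<in>\<U>. \<bar>\<D> u v\<bar> \<le> K * nrm ip u * nrm ip v"
      using D_form by (auto simp: continuous_bilinear_form_def Nip)
    have "\<bar>\<D> u v\<bar> \<le> \<bar>K\<bar> * nrm ip u * nrm ip v" if "u \<in> \<U>" "v \<in> \<U>" for u v
    proof -
      have "0 \<le> nrm ip u * nrm ip v" using I.N_nonneg sub(1) that by (simp add: subset_iff)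
      from mult_right_mono[OF abs_ge_self[of K] this] show ?thesis
        using K[rule_format, OF that] by (simp add: mult.assoc)
    qed
    moreover have "bilin_on \<U> \<U> \<D>"
      using D_form by (simp add: continuous_bilinear_form_def bilin_on_def linear_on_fields_iff)
    ultimately show ?thesis unfolding bounded_bilin_on_def using abs_ge_zero by blast
  qed
  have bounded: "bounded_bilin_on \<W> \<W> (nrm ip) \<A>" "bounded_bilin_on \<U> \<W> (nrm ip) \<B>"
    unfolding A_def B_def by (intro bounded_bilin_on_norm A_bounded B_bounded sub)+
  obtain Ca where Ca: "Ca \<ge> 0" "\<And>v w. v \<in> \<W> \<Longrightarrow> w \<in> \<W> \<Longrightarrow> \<bar>\<A> v w\<bar> \<le> Ca * nrm ip v * nrm ip w"
    by (rule bounded_bilin_onE[OF bounded(1)]) blast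
  obtain Cb where Cb: "Cb \<ge> 0" "\<And>u w. u \<in> \<U> \<Longrightarrow> w \<in> \<W> \<Longrightarrow> \<bar>\<B> u w\<bar> \<le> Cb * nrm ip u * nrm ip w"
    by (rule bounded_bilin_onE[OF bounded(2)]) blast
  obtain Cd where Cd: "Cd \<ge> 0" "\<And>u v. u \<in> \<U> \<Longrightarrow> v \<in> \<U> \<Longrightarrow> \<bar>\<D> u v\<bar> \<le> Cd * nrm ip u * nrm ip v"
    by (rule bounded_bilin_onE[OF D_bounded]) blast
  interpret P: saddle_point \<U> ip \<W> \<A> \<B> \<D> \<alpha> \<delta> Ca Cb Cd
  proof (intro saddle_point.intro saddle_point_axioms.intro)
    show "semi_hilbert \<U> ip" "semi_hilbert \<W> ip" unfolding U_def W_def by (rule H1_zero_hilbert)+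
    show "bilin_on \<W> \<W> \<A>" "bilin_on \<U> \<W> \<B>" "bilin_on \<U> \<U> \<D>"
      using bounded D_bounded by (simp_all add: bounded_bilin_on_def)
    show "\<A> v w = \<A> w v" if "v \<in> \<W>" "w \<in> \<W>" for v w
      unfolding A_def using A_sym sub(2) that by blast
    show "\<exists>r :: nat \<Rightarrow> nat. strict_mono r \<and> (\<forall>e>0. \<exists>M. \<forall>i\<ge>M. \<forall>j\<ge>M.
        (nrm ip (X (r i) - X (r j)))\<^sup>2 \<le> \<B> (X (r i) - X (r j)) (X (r i) - X (r j)) + e)"
      if "\<And>k. X k \<in> \<W>" "\<And>k. nrm ip (X k) \<le> 1" for X
      unfolding B_def by (rule B_compact) (use that sub(2) in auto)
    show "\<delta> * (nrm ip u)\<^sup>2 \<le> \<D> u u" if "u \<in> \<U>" "\<And>w. w \<in> \<W> \<Longrightarrow> \<B> u w = 0" for u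
      using D_coercive(2) that by (simp add: H_def null_space_def Nip)
  qed (use WU \<alpha> Ca Cb Cd D_sym D_pos D_coercive(1) in auto)
  have spaces: "\<H> = P.H" "\<K> = P.K" "Hp = P.Hp"
    by (simp_all add: H_def K_def Hp_def P.H_def P.K_def P.Hp_def null_space_def
        null_space_transpose_def orth_complement_def)
  have stat: "stationarity \<A> \<B> \<D> \<W> \<U> f d \<kappa> w (\<lambda>x. u0 x + u1 x) \<longleftrightarrow> P.penalised f d \<kappa> w (u0 + u1)"
    for \<kappa> w u0 u1
    by (simp add: stationarity_def P.penalised_def plus_fun_def)
  have mix: "limit_mixed_problem \<A> \<B> \<W> Hp f w u \<longleftrightarrow> P.mixed f w u" for f w u
    by (simp add: limit_mixed_problem_def P.mixed_def spaces)
  have ae: "ae_eq \<Omega> v v'" if "v \<in> \<U>" "v' \<in> \<U>" "nrm ip (v - v') = 0" for v v'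
  proof -
    have "v - v' \<in> H1 \<Omega>" using that sub(1) H1.closed(2) by blast
    from norm_zero_AE[OF this that(3)] show ?thesis by (simp add: ae_eq_def)
  qed
  have dual: "lin_on V g" "dual_norm N V g \<ge> 0" "v \<in> V \<Longrightarrow> \<bar>g v\<bar> \<le> dual_norm N V g * nrm ip v"
    if V: "V \<subseteq> \<U>" and g: "g \<in> dual_space N V" for V g v
  proof -
    have nn: "0 \<le> N v" if "v \<in> V" for v using P.N_nonneg V that by (auto simp: Nip)
    show "lin_on V g" using g by (simp add: dual_space_def linear_on_fields_iff)
    show "0 \<le> dual_norm N V g" by (rule dual_norm_bound(1)[OF g nn])
    show "v \<in> V \<Longrightarrow> \<bar>g v\<bar> \<le> dual_norm N V g * nrm ip v"
      using dual_norm_bound(2)[OF g nn] by (simp add: Nip)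
  qed
  note f' = dual[OF WU f] and d' = dual[OF order_refl d]
  have HU: "\<H> \<subseteq> \<U>" using P.in_U(2) spaces by blast
  show ?thesis
  proof (intro conjI, goal_cases)
    case 1
    show ?case
    proof (intro allI impI, goal_cases)
      case (1 \<kappa>)
      note \<kappa> = 1
      obtain w u where wu: "P.penalised f d \<kappa> w u"
        using P.penalised_exists[OF \<kappa> f'(1) f'(3) d'(1) d'(3)] by blast
      then have "u \<in> \<U>" "w \<in> \<W>" by (auto simp: P.penalised_def)
      then obtain u0 u1 where s: "u0 \<in> \<H>" "u1 \<in> Hp" "u = u0 + u1" using P.split_U spaces by metis
      have "ae_eq \<Omega> w' w \<and> ae_eq \<Omega> u0' u0 \<and> ae_eq \<Omega> u1' u1"
        if "w' \<in> \<W>" "u0' \<in> \<H>" "u1' \<in> Hp" "P.penalised f d \<kappa> w' (u0' + u1')" for w' u0' u1'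
      proof -
        have "nrm ip (w' - w) = 0" "nrm ip ((u0' + u1') - (u0 + u1)) = 0"
          using P.penalised_unique[OF \<kappa> f'(1) f'(3) that(4) wu] s(3) by auto
        moreover from this(2) have "nrm ip (u0' - u0) = 0" "nrm ip (u1' - u1) = 0"
          using P.N_split_zero that s spaces by metis+
        moreover have "u0 \<in> \<U>" "u1 \<in> \<U>" "u0' \<in> \<U>" "u1' \<in> \<U>" "w \<in> \<U>" "w' \<in> \<U>"
          using s that \<open>w \<in> \<W>\<close> WU P.in_U spaces by auto
        ultimately show ?thesis using ae by blast
      qed
      then show ?case
        unfolding stat using wu s \<open>w \<in> \<W>\<close> by metis
    qed
  next
    case 2
    obtain K where K: "K \<ge> 0" "\<And>f Cf. lin_on \<W> f \<Longrightarrow> Cf \<ge> 0 \<Longrightarrow> \<forall>v\<in>\<W>. \<bar>f v\<bar> \<le> Cf * nrm ip v \<Longrightarrow>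
        \<exists>w u. P.mixed f w u \<and> nrm ip w + nrm ip u \<le> K * Cf"
      by (rule P.mixed_exists) blast
    have "\<exists>w u. P.mixed g w u \<and> N w + N u \<le> K * dual_norm N \<W> g \<and>
        (\<forall>w' u'. P.mixed g w' u' \<longrightarrow> ae_eq \<Omega> w' w \<and> ae_eq \<Omega> u' u)" if g: "g \<in> dual_space N \<W>" for g
    proof -
      note g' = dual[OF WU g]
      obtain w u where wu: "P.mixed g w u" "N w + N u \<le> K * dual_norm N \<W> g"
        using K(2)[OF g'(1,2)] g'(3) unfolding Nip by blast
      have "ae_eq \<Omega> w' w \<and> ae_eq \<Omega> u' u" if m: "P.mixed g w' u'" for w' u'
        using P.mixed_unique[OF g'(1) g'(3) m wu(1)] m wu(1) WU P.in_U(3)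
        by (auto simp: P.mixed_def intro!: ae)
      with wu show ?thesis by blast
    qed
    then show ?case
      unfolding mix by blast
  next
    case 3
    have "\<exists>u. limit_kernel_problem \<D> \<H> g u \<and> N u \<le> 1 / \<delta> * dual_norm N \<H> g \<and>
        (\<forall>u'. limit_kernel_problem \<D> \<H> g u' \<longrightarrow> ae_eq \<Omega> u' u)" if g: "g \<in> dual_space N \<H>" for g
    proof -
      note g' = dual[OF HU g]
      obtain u where u: "u \<in> \<H>" "\<forall>h\<in>\<H>. \<D> u h = g h" "N u \<le> 1 / \<delta> * dual_norm N \<H> g"
        using P.kernel_exists[of g "dual_norm N \<H> g"] g' unfolding Nip spaces by blast
      have "ae_eq \<Omega> u' u" if u': "limit_kernel_problem \<D> \<H> g u'" for u'
      proof (rule ae)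
        show "nrm ip (u' - u) = 0"
          using P.kernel_unique[of u' u g] u u' unfolding limit_kernel_problem_def spaces by blast
      qed (use u u' HU in \<open>auto simp: limit_kernel_problem_def\<close>)
      with u show ?thesis unfolding limit_kernel_problem_def by blast
    qed
    then show ?case
      by blast
  next
    case 4
    obtain w u1 where m: "P.mixed f w u1"
      using P.mixed_exists f' by metis
    have u1: "u1 \<in> \<U>" using m P.in_U(3) by (auto simp: P.mixed_def)
    let ?g = "\<lambda>h. d h - \<D> u1 h"
    \<comment> \<open>The right-hand side of the kernel problem depends on \<open>u1\<close>;
      continuity of \<open>d\<close> and \<D> makes it a bounded functional with the displayed
      constant.\<close>
    have "\<exists>u0\<in>P.H. (\<forall>h\<in>P.H. \<D> u0 h = ?g h) \<and> nrm ip u0 \<le> 1 / \<delta> * (dual_norm N \<U> d + Cd * nrm ip u1)"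
    proof (rule P.kernel_exists)
      have "lin_on \<U> ?g"
        using d'(1) bilin_on_right[OF P.D_bilin u1] by (simp add: lin_on_def algebra_simps)
      then show "lin_on P.H ?g" using HU spaces by (auto intro: lin_on_subset)
      show "0 \<le> dual_norm N \<U> d + Cd * nrm ip u1" using d'(2) Cd(1) P.N_nonneg[OF u1] by simp
      show "\<forall>h\<in>P.H. \<bar>?g h\<bar> \<le> (dual_norm N \<U> d + Cd * nrm ip u1) * nrm ip h"
      proof
        fix h assume "h \<in> P.H"
        then have h: "h \<in> \<U>" by (rule P.in_U)
        have "\<bar>?g h\<bar> \<le> \<bar>d h\<bar> + \<bar>\<D> u1 h\<bar>" by (rule abs_triangle_ineq4)
        also have "\<dots> \<le> dual_norm N \<U> d * nrm ip h + Cd * nrm ip u1 * nrm ip h"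
          by (intro add_mono d'(3) Cd(2) h u1)
        finally show "\<bar>?g h\<bar> \<le> (dual_norm N \<U> d + Cd * nrm ip u1) * nrm ip h" by (simp add: algebra_simps)
      qed
    qed
    then obtain u0 where u0: "u0 \<in> P.H" "\<forall>h\<in>P.H. \<D> u0 h = ?g h" by blast
    from P.expansion[OF f'(1) f'(3) d'(1) d'(3) m u0]
    obtain C where C: "\<forall>\<kappa>>0. \<forall>w' u'. P.penalised f d \<kappa> w' u' \<longrightarrow>
        nrm ip (w' - w) \<le> C * \<kappa> \<and> nrm ip (u' - (u0 + u1)) \<le> C * \<kappa>" ..
    have big: "(\<lambda>\<kappa>. sqrt ((N (\<lambda>x. w' \<kappa> x - w x))\<^sup>2 + (N (\<lambda>x. (u0' \<kappa> x + u1' \<kappa> x) - (u0 x + u1 x)))\<^sup>2))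
        \<in> O[at_right 0](\<lambda>\<kappa>. \<kappa>)"
      if sol: "\<forall>\<kappa>>0. w' \<kappa> \<in> \<W> \<and> u0' \<kappa> \<in> \<H> \<and> u1' \<kappa> \<in> Hp \<and>
        stationarity \<A> \<B> \<D> \<W> \<U> f d \<kappa> (w' \<kappa>) (\<lambda>x. u0' \<kappa> x + u1' \<kappa> x)" for w' u0' u1' :: "real \<Rightarrow> 'n vfield"
    proof (rule bigoI)
      \<comment> \<open>The product norm is at most the sum of the component norms, and each of
        these is at most \<open>C * \<kappa>\<close>; hence \<open>2 * C\<close>.\<close>
      have "norm (sqrt ((N (\<lambda>x. w' \<kappa> x - w x))\<^sup>2 + (N (\<lambda>x. (u0' \<kappa> x + u1' \<kappa> x) - (u0 x + u1 x)))\<^sup>2))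
          \<le> (2 * C) * norm \<kappa>" if \<kappa>: "\<kappa> > 0" for \<kappa>
      proof -
        have p: "P.penalised f d \<kappa> (w' \<kappa>) (u0' \<kappa> + u1' \<kappa>)" using sol \<kappa> stat by blast
        define x y where "x = N (w' \<kappa> - w)" and "y = N ((u0' \<kappa> + u1' \<kappa>) - (u0 + u1))"
        have le: "x \<le> C * \<kappa>" "y \<le> C * \<kappa>" using C[rule_format, OF \<kappa> p] by (auto simp: x_def y_def Nip)
        have wU: "w' \<kappa> - w \<in> \<U>" "(u0' \<kappa> + u1' \<kappa>) - (u0 + u1) \<in> \<U>"
          using p m u0(1) u1 WU P.in_U(2) P.closed by (auto simp: P.penalised_def P.mixed_def subset_iff)
        have "0 \<le> x" "0 \<le> y" using P.N_nonneg wU by (auto simp: x_def y_def Nip)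
        then have "sqrt (x\<^sup>2 + y\<^sup>2) \<le> x + y" by (rule sqrt_sum_squares_le_sum)
        with le \<kappa> have "norm (sqrt (x\<^sup>2 + y\<^sup>2)) \<le> (2 * C) * norm \<kappa>" by simp
        then show ?thesis by (simp add: x_def y_def fun_diff_def plus_fun_def)
      qed
      then show "eventually (\<lambda>\<kappa>. norm (sqrt ((N (\<lambda>x. w' \<kappa> x - w x))\<^sup>2 +
          (N (\<lambda>x. (u0' \<kappa> x + u1' \<kappa> x) - (u0 x + u1 x)))\<^sup>2)) \<le> (2 * C) * norm \<kappa>) (at_right 0)"
        by (auto simp: eventually_at_filter intro!: always_eventually)
    qed
    have w0: "ae_eq \<Omega> w (\<lambda>x. 0)" if "\<forall>v\<in>\<K>. ae_eq \<Omega> v (\<lambda>x. 0)"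
      using that P.mixed_in_K[OF m] spaces by blast
    have "limit_mixed_problem \<A> \<B> \<W> Hp f w u1" using m mix by blast
    moreover have "limit_kernel_problem \<D> \<H> ?g u0"
      using u0 unfolding limit_kernel_problem_def spaces by simp
    ultimately show ?case
      using big w0 by (intro exI[of _ w] exI[of _ u0] exI[of _ u1] conjI allI impI) blast+
  qed
qed

end
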